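(* Let $a,b\ge0$, let $n$ be a measure on $(0,\infty)$ with $\int_0^\infty\min\{y^2,y\}n(dy)<\infty$, set $\tilde n(dy)=n([y,\infty))\,dy$, and let $\Phi(\lambda)=\int_0^\lambda\big(au+b+\int_0^\infty(1-e^{-uy})\tilde n(dy)\big)^{-1}du$. Suppose $\Phi(1)<\infty$ and that $\Lambda$ is a Lévy measure on $(0,\infty)$ with $\Phi(\lambda)=\int_0^\infty(1-e^{-\lambda y})\Lambda(dy)$ for all $\lambda\ge0$. Let $0<C<\infty$. Then the following are equivalent: (i) for all $\delta>0$ and all $f,g\in\mathcal{F}_0$, $$B_\delta(f,g)^2\le C\int xf'(x)^2\nu_\delta(dx)\int x\int_0^\infty n(dy)(g(x+y)-g(x))^2\,\nu_\delta(dx);$$ (ii) for all $f,g\in\mathcal{F}_0$, $$B_0(f,g)^2\le C\int\Lambda(dx)\,xf'(x)^2\cdot\int\Lambda(dx)\,x\int_0^\infty n(dy)(g(x+y)-g(x))^2.$$ Moreover, if $a>0$ and the inequality in (i) holds for some $\delta>0$ (for all $f,g\in\mathcal{F}_0$), then $\mathrm{Sect}(\mathcal{E}^\delta)\le1+\sqrt{2C/a}$.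
   Context: For $\delta>0$, the CBCI-process with quadruplet $(a,b,n,\delta)$ has generator $L_\delta f(x)=axf''(x)-bxf'(x)+x\int_0^\infty[f(x+y)-f(x)-yf'(x)]n(dy)+\delta f'(x)$ (domain $D(L_\delta)$); when $\Phi(1)<\infty$ its unique stationary distribution $\nu_\delta$ satisfies $\int e^{-\lambda x}\nu_\delta(dx)=e^{-\delta\Phi(\lambda)}$. $\mathcal{E}^\delta(f,g)=\int(-L_\delta f)g\,d\nu_\delta$. $\mathcal{F}_0$ is the linear span of $\{x\mapsto e^{-\lambda x}:\lambda\ge0\}$. $B_\delta(f,g)=\int x\int_0^\infty\tilde n(dy)f'(x+y)(g(x+y)-g(x))\,\nu_\delta(dx)$ for $\delta>0$, and $B_0(f,g)=\int\Lambda(dx)\,x\int_0^\infty\tilde n(dy)f'(x+y)(g(x+y)-g(x))$. The sector constant $\mathrm{Sect}(\mathcal{E}^\delta)$ is the infimum of finite $C'$ with $\mathcal{E}^\delta(f,g)\le C'\mathcal{E}^\delta(f,f)^{1/2}\mathcal{E}^\delta(g,g)^{1/2}$ for all $f,g\in D(L_\delta)$ ($=\infty$ if none). *)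

theory Defs
  imports "HOL-Probability.Probability"
begin

text \<open>Measures on (0,infinity) are represented as Borel measures on the reals
  that put no mass on the half-line ]-infinity,0].\<close>

definition ntilde :: "real measure \<Rightarrow> real measure" where
  "ntilde n = density lborel (\<lambda>y. indicator {0<..} y * emeasure n {y..})"

definition psi_tilde :: "real \<Rightarrow> real \<Rightarrow> real measure \<Rightarrow> real \<Rightarrow> ennreal" where
  "psi_tilde a b n u = ennreal (a * u + b) + (\<integral>\<^sup>+ y. ennreal (1 - exp (- u * y)) \<partial>ntilde n)"

text \<open>Phi(lambda) = int_0^lambda psi_tilde(u)^(-1) du, as an extended nonnegative real
  (inverse 0 = infinity in ennreal).\<close>
definition Phi :: "real \<Rightarrow> real \<Rightarrow> real measure \<Rightarrow> real \<Rightarrow> ennreal" where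
  "Phi a b n l = (\<integral>\<^sup>+ u. indicator {0..l} u * inverse (psi_tilde a b n u) \<partial>lborel)"

text \<open>Branching mechanism of the CBCI-process with generator
  a x f'' - b x f' + x int [f(x+y)-f(x)-y f'(x)] n(dy) + delta f'.\<close>
definition psi :: "real \<Rightarrow> real \<Rightarrow> real measure \<Rightarrow> real \<Rightarrow> real" where
  "psi a b n l = a * l\<^sup>2 + b * l + (\<integral>y. exp (- l * y) - 1 + l * y \<partial>n)"

definition F0 :: "(real \<Rightarrow> real) set" where
  "F0 = {f. \<exists>(m::nat) (c::nat \<Rightarrow> real) (l::nat \<Rightarrow> real). (\<forall>i<m. l i \<ge> 0) \<and>
              f = (\<lambda>x. \<Sum>i<m. c i * exp (- l i * x))}"

text \<open>B(f,g) = int M(dx) x int ntilde(dy) f'(x+y)(g(x+y)-g(x));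
  M = nu_delta gives B_delta, M = Lambda gives B_0.\<close>
definition Bform :: "real measure \<Rightarrow> real measure \<Rightarrow> (real \<Rightarrow> real) \<Rightarrow> (real \<Rightarrow> real) \<Rightarrow> real" where
  "Bform n M f g = (\<integral>x. x * (\<integral>y. deriv f (x + y) * (g (x + y) - g x) \<partial>ntilde n) \<partial>M)"

definition Dterm :: "real measure \<Rightarrow> (real \<Rightarrow> real) \<Rightarrow> real" where
  "Dterm M f = (\<integral>x. x * (deriv f x)\<^sup>2 \<partial>M)"

definition Jterm :: "real measure \<Rightarrow> real measure \<Rightarrow> (real \<Rightarrow> real) \<Rightarrow> real" where
  "Jterm n M g = (\<integral>x. x * (\<integral>y. (g (x + y) - g x)\<^sup>2 \<partial>n) \<partial>M)"

text \<open>L^2(nu) generator of the Markov semigroup P_t f(x) = int f(y) K t x (dy):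
  the pair (f, h) is in the graph of the generator iff f, h are in L^2(nu) and
  (P_t f - f)/t converges to h in L^2(nu) as t goes to 0+.\<close>
definition L2_generator ::
  "(real \<Rightarrow> real \<Rightarrow> real measure) \<Rightarrow> real measure \<Rightarrow> (real \<Rightarrow> real) \<Rightarrow> (real \<Rightarrow> real) \<Rightarrow> bool" where
  "L2_generator K \<nu> f h \<longleftrightarrow>
     f \<in> borel_measurable borel \<and> integrable \<nu> (\<lambda>x. (f x)\<^sup>2) \<and>
     h \<in> borel_measurable borel \<and> integrable \<nu> (\<lambda>x. (h x)\<^sup>2) \<and>
     (\<forall>\<^sub>F t in at_right 0.
        integrable \<nu> (\<lambda>x. (((\<integral>y. f y \<partial>K t x) - f x) / t - h x)\<^sup>2)) \<and>
     ((\<lambda>t. \<integral>x. (((\<integral>y. f y \<partial>K t x) - f x) / t - h x)\<^sup>2 \<partial>\<nu>) \<longlongrightarrow> 0) (at_right 0)"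

text \<open>Sector constant of E(f,g) = int (-L f) g d nu over f, g in D(L);
  infimum in the extended reals, = infinity if no finite constant works.\<close>
definition sector_const :: "(real \<Rightarrow> real \<Rightarrow> real measure) \<Rightarrow> real measure \<Rightarrow> ereal" where
  "sector_const K \<nu> = Inf {ereal c | c. \<forall>f Lf g Lg. L2_generator K \<nu> f Lf \<longrightarrow> L2_generator K \<nu> g Lg \<longrightarrow>
      (\<integral>x. - Lf x * g x \<partial>\<nu>) \<le> c * sqrt (\<integral>x. - Lf x * f x \<partial>\<nu>) * sqrt (\<integral>x. - Lg x * g x \<partial>\<nu>)}"

end

theory Submission
  imports Defs
begin

text \<open>
  On exponentials \<open>e\<^sub>l(x) = exp (- l x)\<close> every form is explicit: over a measure \<open>M\<close> it is a finite
  double sum of coefficients, independent of \<open>M\<close>, times \<open>m(l + k)\<close> with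
  \<open>m(l) = \<integral> x exp (- l x) M(dx)\<close>. Differentiating the Laplace transform of \<open>\<nu>\<^sub>\<delta>\<close> gives
  \<open>m\<^sub>\<nu> = \<delta> exp (- \<delta> \<Phi>) m\<^sub>\<Lambda>\<close>. Hence \<open>B\<^sub>\<delta>(f, g) / \<delta>\<close> is the \<open>\<nu>\<^sub>\<delta>\<close>-average of
  \<open>B\<^sub>0(f(z + .), g(z + .))\<close>, and Cauchy--Schwarz yields (i) from (ii); letting \<open>\<delta>\<close> tend to
  \<open>0\<close> yields the converse.

  Since \<open>\<psi>(l) = l R(l)\<close> where \<open>R(l) = a l + b + \<integral> (1 - exp (- l y)) n([y, \<infinity>)) dy\<close>, and \<open>\<Phi>' = 1 / R\<close>, the
  Dirichlet form is \<open>a \<integral> x f' g' d\<nu> + B\<^sub>\<delta>(f, g)\<close>, whose diagonal is \<open>a \<integral> x f'\<^sup>2 d\<nu>\<close> plus one half of the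
  jump term; this gives the sector bound on the span of exponentials. The span is dense in \<open>L\<^sup>2\<close> and
  invariant under the contraction semigroup, so it is a core, and the bound passes to the closure.\<close>

section \<open>Differentiating Laplace transforms\<close>

text \<open>Three obstacles shape the proof. The moment m(0) may be infinite (R(0) = b can be 0), so
  terms with l + k = 0 must not occur: in each form their coefficient vanishes, through a factor l
  or l k, or through a second difference that degenerates at 0. Only positive exponents are
  therefore differentiated. The passage from \<Lambda> to \<nu> multiplies the (l, k) term by a
  function of l + k only, and exp (- \<delta> \<Phi>(l + k)) is the \<nu>-integral of exp (- l z)
  exp (- k z). This splitting is what turns a scalar factor into a translation of both arguments.
  The span is invariant because the semigroup sends the exponential with exponent l to a multiple of
  the one with exponent v t l: exponents move along the flow of - \<psi>. The usual resolvent, an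
  integral over time, would leave the span, whose elements are finite sums; a truncated geometric
  series in P at multiples of a small time step takes its place. Besides density, only
  contractivity, dissipativity and the commutation of semigroup and generator are then
  needed.\<close>

lemma mult_exp_neg_le:
  fixes x l :: real
  assumes "l > 0"
  shows "x * exp (- l * x) \<le> 1 / l"
proof -
  have "l * x \<le> exp (l * x)"
    using exp_ge_add_one_self[of "l * x"] by linarith
  then have "l * x * exp (- l * x) \<le> exp (l * x) * exp (- l * x)"
    by (intro mult_right_mono) auto
  then show ?thesis
    using assms by (simp add: field_simps flip: exp_add)
qed

text \<open>Half of the exponential absorbs one factor x, so second moments are controlled by first
  moments at l / 2.\<close>

lemma square_mult_exp_neg_le:
  fixes x l :: real
  assumes "l > 0" "x \<ge> 0"
  shows "x\<^sup>2 * exp (- l * x) \<le> 2 / l * (x * exp (- (l / 2) * x))"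
proof -
  have "x\<^sup>2 * exp (- l * x) = (x * exp (- (l / 2) * x)) * (x * exp (- (l / 2) * x))"
    by (simp add: power2_eq_square mult_ac flip: exp_add)
  also have "\<dots> \<le> 2 / l * (x * exp (- (l / 2) * x))"
    using mult_exp_neg_le[of "l / 2" x] assms by (intro mult_right_mono) auto
  finally show ?thesis .
qed

text \<open>Remainder bound for both signs of y, because the increment h of a two-sided difference
  quotient may be negative; this is the reason for the factor
  \<open>exp \<bar>y\<bar>\<close>.\<close>

lemma exp_neg_second_order:
  fixes y :: real
  shows "\<bar>exp (- y) - 1 + y\<bar> \<le> y\<^sup>2 * exp \<bar>y\<bar>"
proof -
  have nn: "0 \<le> exp (- y) - 1 + y"
    using exp_ge_add_one_self[of "- y"] by linarith
  have bd: "\<bar>exp z - 1\<bar> \<le> \<bar>z\<bar> * exp \<bar>z\<bar>" for z :: real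
  proof (cases "z \<ge> 0")
    case True
    have "exp z * (1 - z) \<le> exp z * exp (- z)"
      using exp_ge_add_one_self[of "- z"] by (intro mult_left_mono) auto
    then show ?thesis using True by (simp add: algebra_simps flip: exp_add)
  next
    case False
    have "1 + z \<le> exp z" by (rule exp_ge_add_one_self)
    moreover have "- z * 1 \<le> - z * exp (- z)"
      using False by (intro mult_left_mono) auto
    moreover have "exp z \<le> 1" using False by simp
    ultimately have "1 - exp z \<le> - z * exp (- z)" by linarith
    then show ?thesis using False by (simp add: abs_if)
  qed
  have "exp (- y) - 1 + y \<le> \<bar>y\<bar> * \<bar>exp (-y) - 1\<bar>"
  proof -
    \<comment> \<open>Either side is a rearrangement of exp (-y) - 1 + y \<le> y (1 - exp
      (-y)).\<close>
    have "(exp (-y) - 1 + y) + (-y) * (exp (-y) * -1 + 1) + 0 \<le> 0 \<longleftrightarrow> exp (-y) * (1 + y) \<le> 1"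
      by (simp add: algebra_simps)
    moreover have "exp (-y) * (1 + y) \<le> exp (-y) * exp y"
      using exp_ge_add_one_self[of y] by (intro mult_left_mono) auto
    ultimately have "exp (-y) - 1 + y \<le> y * (1 - exp (-y))"
      by (simp flip: exp_add)
    also have "\<dots> \<le> \<bar>y * (1 - exp (-y))\<bar>" by simp
    finally show ?thesis by (simp add: abs_mult abs_minus_commute)
  qed
  also have "\<dots> \<le> \<bar>y\<bar> * (\<bar>y\<bar> * exp \<bar>y\<bar>)"
    using bd[of "- y"] by (intro mult_left_mono) auto
  finally show ?thesis using nn by (simp add: power2_eq_square abs_mult mult_ac)
qed

text \<open>The moment function m of the overview. For l = 0 the integral may diverge and then has
  the default value 0, so formulas for it are only used at positive l.\<close>

definition laplace1 :: "real measure \<Rightarrow> real \<Rightarrow> real" where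
  "laplace1 M l = (\<integral>x. x * exp (- l * x) \<partial>M)"

locale levy_measure =
  fixes M :: "real measure"
  assumes sets_M [measurable_cong]: "sets M = sets borel"
    and pos: "AE x in M. 0 \<le> x"
    and min_int: "integrable M (\<lambda>x. min 1 x)"
begin

lemma integrable_mult_exp_neg:
  assumes "l > 0"
  shows "integrable M (\<lambda>x. x * exp (- l * x))"
proof (rule Bochner_Integration.integrable_bound)
  show "integrable M (\<lambda>x. (1 + 1 / l) * min 1 x)"
    using min_int by simp
  show "AE x in M. norm (x * exp (- l * x)) \<le> norm ((1 + 1 / l) * min 1 x)"
    using pos
  proof eventually_elim
    fix x :: real assume x: "0 \<le> x"
    have "x * exp (- l * x) \<le> x * 1"
      using x assms by (intro mult_left_mono) auto
    moreover have "x * exp (- l * x) \<le> 1 / l"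
      by (rule mult_exp_neg_le[OF assms])
    moreover have "0 \<le> 1 / l" using assms by simp
    ultimately have "x * exp (- l * x) \<le> (1 + 1 / l) * min 1 x"
      using x by (cases "x \<le> 1") (auto simp: min_def distrib_right intro: order_trans)
    then show "norm (x * exp (- l * x)) \<le> norm ((1 + 1 / l) * min 1 x)"
      using x assms by auto
  qed
qed measurable

lemma integrable_square_mult_exp_neg:
  assumes "l > 0"
  shows "integrable M (\<lambda>x. x\<^sup>2 * exp (- l * x))"
proof (rule Bochner_Integration.integrable_bound)
  show "integrable M (\<lambda>x. 2 / l * (x * exp (- (l / 2) * x)))"
    using integrable_mult_exp_neg[of "l / 2"] assms by simp
  show "AE x in M. norm (x\<^sup>2 * exp (- l * x)) \<le> norm (2 / l * (x * exp (- (l / 2) * x)))"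
    using pos
  proof eventually_elim
    fix x :: real assume x: "0 \<le> x"
    show "norm (x\<^sup>2 * exp (- l * x)) \<le> norm (2 / l * (x * exp (- (l / 2) * x)))"
      using square_mult_exp_neg_le[OF assms x] x assms by simp
  qed
qed measurable

lemma integrable_one_minus_exp_neg:
  assumes "l \<ge> 0"
  shows "integrable M (\<lambda>x. 1 - exp (- l * x))"
proof (rule Bochner_Integration.integrable_bound)
  show "integrable M (\<lambda>x. (1 + l) * min 1 x)"
    using min_int by simp
  show "AE x in M. norm (1 - exp (- l * x)) \<le> norm ((1 + l) * min 1 x)"
    using pos
  proof eventually_elim
    fix x :: real assume x: "0 \<le> x"
    have "1 - exp (- l * x) \<le> l * x"
      using exp_ge_add_one_self[of "- l * x"] by simp
    moreover have "1 - exp (- l * x) \<le> 1" by simp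
    moreover have "l * x \<ge> 0" using x assms by simp
    ultimately have "1 - exp (- l * x) \<le> (1 + l) * min 1 x"
    proof (cases "x \<le> 1")
      case True
      then have "min 1 x = x" by simp
      with \<open>1 - exp (- l * x) \<le> l * x\<close> x show ?thesis by (simp only: distrib_right)
    next
      case False
      then have "min 1 x = 1" by simp
      with \<open>1 - exp (- l * x) \<le> 1\<close> assms show ?thesis by (simp only: mult_1_right)
    qed
    moreover have "exp (- l * x) \<le> 1" using x assms by simp
    ultimately show "norm (1 - exp (- l * x)) \<le> norm ((1 + l) * min 1 x)"
      using x assms by auto
  qed
qed measurable

text \<open>Under the integral, the difference quotient minus x exp (- l x) is a second-order Taylor
  remainder divided by h. For |h| < l / 2 the factor exp (|h| x) costs at most half of the decay, so
  the error is at most |h| times the finite integral \<open>Q\<close>.\<close>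

lemma DERIV_integral_one_minus_exp_neg:
  assumes l: "l > 0"
  shows "((\<lambda>l. \<integral>x. 1 - exp (- l * x) \<partial>M) has_real_derivative laplace1 M l) (at l)"
proof -
  define Q where "Q = (\<integral>x. x\<^sup>2 * exp (- (l / 2) * x) \<partial>M)"
  have bound: "norm (((\<integral>x. 1 - exp (- (l + h) * x) \<partial>M) - (\<integral>x. 1 - exp (- l * x) \<partial>M)) / h - laplace1 M l)
      \<le> \<bar>h\<bar> * Q" if h: "h \<noteq> 0" "\<bar>h\<bar> < l / 2" for h
  proof -
    have ip: "l + h \<ge> 0" using h by auto
    have i1: "integrable M (\<lambda>x. 1 - exp (- (l + h) * x))"
      by (rule integrable_one_minus_exp_neg[OF ip])
    have i2: "integrable M (\<lambda>x. 1 - exp (- l * x))"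
      using l by (intro integrable_one_minus_exp_neg) auto
    have i3: "integrable M (\<lambda>x. ((1 - exp (- (l + h) * x)) - (1 - exp (- l * x))) / h)"
      by (intro integrable_divide_zero impI Bochner_Integration.integrable_diff i1 i2)
    note i4 = integrable_mult_exp_neg[OF l]
    have "((\<integral>x. 1 - exp (- (l + h) * x) \<partial>M) - (\<integral>x. 1 - exp (- l * x) \<partial>M)) / h - laplace1 M l
       = (\<integral>x. ((1 - exp (- (l + h) * x)) - (1 - exp (- l * x))) / h - x * exp (- l * x) \<partial>M)"
      unfolding laplace1_def Bochner_Integration.integral_diff[OF i3 i4] integral_divide_zero
        Bochner_Integration.integral_diff[OF i1 i2] by (rule refl)
    also have "norm \<dots> \<le> (\<integral>x. \<bar>h\<bar> * (x\<^sup>2 * exp (- (l / 2) * x)) \<partial>M)"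
    proof (rule order_trans[OF integral_norm_bound integral_mono_AE])
      show "integrable M (\<lambda>x. norm (((1 - exp (- (l + h) * x)) - (1 - exp (- l * x))) / h - x * exp (- l * x)))"
        by (intro integrable_norm Bochner_Integration.integrable_diff[OF i3 i4])
      show "integrable M (\<lambda>x. \<bar>h\<bar> * (x\<^sup>2 * exp (- (l / 2) * x)))"
        using integrable_square_mult_exp_neg[of "l / 2"] l by auto
      show "AE x in M. norm (((1 - exp (- (l + h) * x)) - (1 - exp (- l * x))) / h - x * exp (- l * x))
           \<le> \<bar>h\<bar> * (x\<^sup>2 * exp (- (l / 2) * x))"
        using pos
      proof eventually_elim
        fix x :: real assume x: "0 \<le> x"
        have "((1 - exp (- (l + h) * x)) - (1 - exp (- l * x))) / h - x * exp (- l * x)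
            = - (exp (- l * x) * (exp (- (h * x)) - 1 + h * x) / h)"
          using h by (simp add: field_simps flip: exp_add)
        also have "norm \<dots> = exp (- l * x) * \<bar>exp (- (h * x)) - 1 + h * x\<bar> / \<bar>h\<bar>"
          by (simp add: abs_mult)
        also have "\<dots> \<le> exp (- l * x) * ((h * x)\<^sup>2 * exp \<bar>h * x\<bar>) / \<bar>h\<bar>"
          by (intro divide_right_mono mult_left_mono exp_neg_second_order) auto
        also have "\<dots> = \<bar>h\<bar> * (x\<^sup>2 * exp (- l * x + \<bar>h\<bar> * x))"
        proof -
          have "((h * x)\<^sup>2 * exp \<bar>h * x\<bar>) / \<bar>h\<bar> = \<bar>h\<bar> * (x\<^sup>2 * exp (\<bar>h\<bar> * x))"
            using h x by (simp add: power2_eq_square abs_mult) (simp add: abs_if)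
          then show ?thesis
            by (simp only: exp_add mult.assoc mult.left_commute[of _ "exp (- l * x)"]
                times_divide_eq_right[symmetric, of "exp (- l * x)"])
        qed
        also have "\<dots> \<le> \<bar>h\<bar> * (x\<^sup>2 * exp (- (l / 2) * x))"
        proof -
          have "\<bar>h\<bar> * x \<le> (l / 2) * x" using h x by (intro mult_right_mono) auto
          then show ?thesis by (intro mult_left_mono) (auto simp: algebra_simps)
        qed
        finally show "norm (((1 - exp (- (l + h) * x)) - (1 - exp (- l * x))) / h - x * exp (- l * x))
           \<le> \<bar>h\<bar> * (x\<^sup>2 * exp (- (l / 2) * x))" .
      qed
    qed
    also have "\<dots> = \<bar>h\<bar> * Q" by (simp add: Q_def)
    finally show ?thesis .
  qed
  have "((\<lambda>h. ((\<integral>x. 1 - exp (- (l + h) * x) \<partial>M) - (\<integral>x. 1 - exp (- l * x) \<partial>M)) / h - laplace1 M l)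
      \<longlongrightarrow> 0) (at 0)"
  proof (rule Lim_null_comparison)
    show "\<forall>\<^sub>F h in at 0. norm (((\<integral>x. 1 - exp (- (l + h) * x) \<partial>M) - (\<integral>x. 1 - exp (- l * x) \<partial>M)) / h - laplace1 M l)
      \<le> \<bar>h\<bar> * Q"
      unfolding eventually_at using bound l by (intro exI[of _ "l / 2"]) auto
    show "((\<lambda>h. \<bar>h\<bar> * Q) \<longlongrightarrow> 0) (at 0)"
      by (auto intro!: tendsto_eq_intros)
  qed
  then show ?thesis
    unfolding DERIV_def by (simp add: LIM_zero_iff)
qed

end

section \<open>The branching measure and its tail\<close>

definition compensated_laplace :: "real measure \<Rightarrow> real \<Rightarrow> real" where
  "compensated_laplace n l = (\<integral>y. exp (- l * y) - 1 + l * y \<partial>n)"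

text \<open>The jump part of R in the overview, just as \<open>compensated_laplace\<close> is the
  jump part of \<open>psi\<close>.\<close>

definition tail_exponent :: "real measure \<Rightarrow> real \<Rightarrow> real" where
  "tail_exponent n l = (\<integral>y. 1 - exp (- l * y) \<partial>ntilde n)"

locale branching_measure =
  fixes n :: "real measure"
  assumes n_borel [measurable_cong]: "sets n = sets borel"
    and n_pos: "emeasure n {..0} = 0"
    and n_int: "(\<integral>\<^sup>+ y. ennreal (min (y\<^sup>2) y) \<partial>n) < \<infinity>"
begin

lemma AE_n_pos: "AE y in n. 0 < y"
proof (rule AE_I)
  show "{y \<in> space n. \<not> 0 < y} \<subseteq> {..0}" by auto
qed (use n_pos n_borel in auto)

lemma integrable_n_min: "integrable n (\<lambda>y. min (y\<^sup>2) y)"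
proof (rule integrableI_nonneg)
  show "AE y in n. 0 \<le> min (y\<^sup>2) y" using AE_n_pos by eventually_elim auto
qed (use n_int in auto)

lemma integrable_n_bound:
  assumes [measurable]: "f \<in> borel_measurable borel"
    and "\<And>y. y > 0 \<Longrightarrow> \<bar>f y\<bar> \<le> c * min (y\<^sup>2) y"
  shows "integrable n f"
proof (rule Bochner_Integration.integrable_bound)
  show "integrable n (\<lambda>y. c * min (y\<^sup>2) y)" using integrable_n_min by simp
  show "AE y in n. norm (f y) \<le> norm (c * min (y\<^sup>2) y)"
    using AE_n_pos
  proof eventually_elim
    fix y :: real assume "0 < y"
    then show "norm (f y) \<le> norm (c * min (y\<^sup>2) y)"
      using assms(2)[of y] by (simp add: order_trans[OF _ abs_ge_self])
  qed
qed measurable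

text \<open>Needed for Tonelli. By Markov's inequality the sets k min(y^2, y) \<ge> 1 have finite
  measure; they exhaust the positive half-line, and the null half-line is added to each.\<close>

lemma sigma_finite_n: "sigma_finite_measure n"
proof -
  define A :: "nat \<Rightarrow> real set" where "A k = {..0} \<union> {y. 1 \<le> real k * min (y\<^sup>2) y}" for k
  have A_sets: "A k \<in> sets n" for k
    unfolding A_def by measurable
  have "emeasure n (A k) < \<infinity>" for k
  proof -
    have "{y \<in> space n. 1 \<le> ennreal (real k) * ennreal (min (y\<^sup>2) y)} \<supseteq> {y. 1 \<le> real k * min (y\<^sup>2) y}"
      using sets_eq_imp_space_eq[OF n_borel]
      by (auto simp flip: ennreal_mult')
    then have "emeasure n {y. 1 \<le> real k * min (y\<^sup>2) y}
        \<le> emeasure n {y \<in> space n. 1 \<le> ennreal (real k) * ennreal (min (y\<^sup>2) y)}"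
      by (intro emeasure_mono) measurable
    also have "\<dots> \<le> ennreal (real k) * (\<integral>\<^sup>+ y. ennreal (min (y\<^sup>2) y) \<partial>n)"
      using nn_integral_Markov_inequality[of "\<lambda>y. ennreal (min (y\<^sup>2) y)" "space n" n "ennreal (real k)"]
      by (simp add: nn_integral_set_ennreal)
    also have "\<dots> < \<infinity>" using n_int by (simp add: ennreal_mult_less_top)
    finally have "emeasure n {y. 1 \<le> real k * min (y\<^sup>2) y} < \<infinity>" .
    moreover have "emeasure n (A k) \<le> emeasure n {..0} + emeasure n {y. 1 \<le> real k * min (y\<^sup>2) y}"
      unfolding A_def by (intro emeasure_subadditive) measurable
    ultimately show ?thesis using n_pos by (simp add: order_le_less_trans)
  qed
  moreover have "(\<Union>k. A k) = space n"
  proof -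
    have "y \<in> (\<Union>k. A k)" for y
    proof (cases "y > 0")
      case True
      obtain k :: nat where "1 / min (y\<^sup>2) y \<le> real k"
        using real_arch_simple by blast
      then have "y \<in> A k" using True by (auto simp: A_def field_simps min_def split: if_splits)
      then show ?thesis by blast
    qed (auto simp: A_def)
    then show ?thesis using sets_eq_imp_space_eq[OF n_borel] by auto
  qed
  ultimately show ?thesis
    using A_sets by (intro sigma_finite_measure.intro exI[of _ "range A"]) (auto simp: less_top)
qed

text \<open>The tail at y is the measure of the y-section of {(y, z). y \<le> z}, which is
  measurable in y by sigma-finiteness.\<close>

lemma measurable_tail [measurable]: "(\<lambda>y. emeasure n {y..}) \<in> borel_measurable borel"
proof -
  interpret n: sigma_finite_measure n by (rule sigma_finite_n)
    have "(\<lambda>y. \<integral>\<^sup>+ z. indicator {p. fst p \<le> snd p} (y, z) \<partial>n) \<in> borel_measurable borel"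
      by measurable
    also have "(\<lambda>y. \<integral>\<^sup>+ z. indicator {p. fst p \<le> snd p} (y, z) \<partial>n) = (\<lambda>y. emeasure n {y..})"
    proof
      fix y
      have "(\<integral>\<^sup>+ z. indicator {p. fst p \<le> snd p} (y, z) \<partial>n) = (\<integral>\<^sup>+ z. indicator {y..} z \<partial>n)"
        by (intro nn_integral_cong) (auto simp: indicator_def)
      then show "(\<integral>\<^sup>+ z. indicator {p. fst p \<le> snd p} (y, z) \<partial>n) = emeasure n {y..}"
        by simp
    qed
    finally show ?thesis .
qed

text \<open>Tonelli: the tail density of \<^const>\<open>ntilde\<close> trades a function for its primitive.\<close>

lemma nn_integral_ntilde:
  assumes [measurable]: "h \<in> borel_measurable borel"
    and h_nonneg: "\<And>y. y \<ge> 0 \<Longrightarrow> 0 \<le> h y"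
    and H: "\<And>y. y \<ge> 0 \<Longrightarrow> (H has_real_derivative h y) (at y)" and H0: "H 0 = 0"
  shows "(\<integral>\<^sup>+ y. ennreal (h y) \<partial>ntilde n) = (\<integral>\<^sup>+ z. ennreal (H z) \<partial>n)"
proof -
  interpret n: sigma_finite_measure n by (rule sigma_finite_n)
  interpret pair_sigma_finite lborel n ..
  have "(\<integral>\<^sup>+ y. ennreal (h y) \<partial>ntilde n)
      = (\<integral>\<^sup>+ y. (indicator {0<..} y * emeasure n {y..}) * ennreal (h y) \<partial>lborel)"
    unfolding ntilde_def by (subst nn_integral_density) auto
  also have "\<dots> = (\<integral>\<^sup>+ y. (\<integral>\<^sup>+ z. ennreal (h y) * indicator {p. 0 < fst p \<and> fst p \<le> snd p} (y, z) \<partial>n) \<partial>lborel)"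
  proof (intro nn_integral_cong)
    fix y :: real
    have "(\<integral>\<^sup>+ z. ennreal (h y) * indicator {p. 0 < fst p \<and> fst p \<le> snd p} (y, z) \<partial>n)
        = (\<integral>\<^sup>+ z. (ennreal (h y) * indicator {0<..} y) * indicator {y..} z \<partial>n)"
      by (intro nn_integral_cong) (auto simp: indicator_def)
    also have "\<dots> = (ennreal (h y) * indicator {0<..} y) * emeasure n {y..}"
      by (subst nn_integral_cmult_indicator) auto
    finally show "(indicator {0<..} y * emeasure n {y..}) * ennreal (h y)
        = (\<integral>\<^sup>+ z. ennreal (h y) * indicator {p. 0 < fst p \<and> fst p \<le> snd p} (y, z) \<partial>n)"
      by (simp add: mult_ac)
  qed
  also have "\<dots> = (\<integral>\<^sup>+ z. (\<integral>\<^sup>+ y. ennreal (h y) * indicator {p. 0 < fst p \<and> fst p \<le> snd p} (y, z) \<partial>lborel) \<partial>n)"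
    by (intro Fubini'[symmetric]) measurable
  also have "\<dots> = (\<integral>\<^sup>+ z. ennreal (H z) \<partial>n)"
  proof (rule nn_integral_cong_AE)
    show "AE z in n. (\<integral>\<^sup>+ y. ennreal (h y) * indicator {p. 0 < fst p \<and> fst p \<le> snd p} (y, z) \<partial>lborel)
        = ennreal (H z)"
      using AE_n_pos
    proof eventually_elim
      fix z :: real assume z: "0 < z"
      have "(\<integral>\<^sup>+ y. ennreal (h y) * indicator {p. 0 < fst p \<and> fst p \<le> snd p} (y, z) \<partial>lborel)
          = (\<integral>\<^sup>+ y. ennreal (h y) * indicator {0..z} y \<partial>lborel)"
      proof (rule nn_integral_cong_AE)
        show "AE y in lborel. ennreal (h y) * indicator {p. 0 < fst p \<and> fst p \<le> snd p} (y, z)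
            = ennreal (h y) * indicator {0..z} y"
          using AE_lborel_singleton[of 0] by eventually_elim (auto simp: indicator_def)
      qed
      also have "\<dots> = ennreal (H z - H 0)"
        using z by (intro nn_integral_FTC_Icc) (auto intro!: h_nonneg DERIV_subset[OF H])
      finally show "(\<integral>\<^sup>+ y. ennreal (h y) * indicator {p. 0 < fst p \<and> fst p \<le> snd p} (y, z) \<partial>lborel)
        = ennreal (H z)" by (simp add: H0)
    qed
  qed
  finally show ?thesis .
qed

lemma AE_ntilde_pos: "AE y in ntilde n. 0 < y"
proof -
  have "(\<lambda>y. indicator {0<..} y * emeasure n {y..}) \<in> borel_measurable lborel" by measurable
  from AE_density[OF this] show ?thesis
    unfolding ntilde_def by (auto simp: indicator_def split: if_splits)
qed

lemma sets_ntilde [measurable_cong, simp]: "sets (ntilde n) = sets borel"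
  by (simp add: ntilde_def)

text \<open>The integrand is of order y^2 for y \<le> 1 and at most l y beyond, which is what
  \<open>n_int\<close> controls; the constant is the sum of the two bounds.\<close>

lemma integrable_compensated_laplace:
  assumes l: "l \<ge> 0"
  shows "integrable n (\<lambda>y. exp (- l * y) - 1 + l * y)"
proof (rule integrable_n_bound)
  fix y :: real assume y: "y > 0"
  have nn: "0 \<le> exp (- l * y) - 1 + l * y"
    using exp_ge_add_one_self[of "- l * y"] by linarith
  have lin: "exp (- l * y) - 1 + l * y \<le> l * y"
    using l y by simp
  have exp_nn: "0 \<le> l\<^sup>2 * exp l" by simp
  show "\<bar>exp (- l * y) - 1 + l * y\<bar> \<le> (l\<^sup>2 * exp l + l) * min (y\<^sup>2) y"
  proof (cases "y \<le> 1")
    case True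
    have "\<bar>exp (- l * y) - 1 + l * y\<bar> \<le> (l * y)\<^sup>2 * exp \<bar>l * y\<bar>"
      using exp_neg_second_order[of "l * y"] by simp
    also have "\<dots> \<le> (l * y)\<^sup>2 * exp l"
      using True l y by (intro mult_left_mono) (auto simp: abs_mult mult_left_le)
    also have "\<dots> \<le> (l\<^sup>2 * exp l + l) * y\<^sup>2"
      using l by (simp add: power_mult_distrib algebra_simps)
    also have "\<dots> = (l\<^sup>2 * exp l + l) * min (y\<^sup>2) y"
      using True y by (simp add: power2_eq_square mult_left_le min_def)
    finally show ?thesis .
  next
    case False
    have "\<bar>exp (- l * y) - 1 + l * y\<bar> \<le> l * y" using nn lin by linarith
    also have "\<dots> \<le> (l\<^sup>2 * exp l + l) * y"
      using exp_nn y by (intro mult_right_mono) auto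
    also have "\<dots> = (l\<^sup>2 * exp l + l) * min (y\<^sup>2) y"
      using False by (simp add: power2_eq_square min_def)
    finally show ?thesis .
  qed
qed measurable

lemma compensated_laplace_nonneg: "0 \<le> compensated_laplace n l"
proof -
  have "0 \<le> exp (- l * y) - 1 + l * y" for y
    using exp_ge_add_one_self[of "- l * y"] by linarith
  then show ?thesis unfolding compensated_laplace_def by (intro integral_nonneg_AE) auto
qed

text \<open>A primitive of 1 - exp (- l y) vanishing at 0 is (exp (- l z) - 1 + l z) / l. This is
  the source of \<psi>(l) = l R(l).\<close>

lemma nn_integral_tail_exponent:
  assumes l: "l > 0"
  shows "(\<integral>\<^sup>+ y. ennreal (1 - exp (- l * y)) \<partial>ntilde n) = ennreal (compensated_laplace n l / l)"
proof -
  have "(\<integral>\<^sup>+ y. ennreal (1 - exp (- l * y)) \<partial>ntilde n)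
      = (\<integral>\<^sup>+ z. ennreal ((exp (- l * z) - 1 + l * z) / l) \<partial>n)"
    by (rule nn_integral_ntilde) (use l in \<open>auto intro!: derivative_eq_intros simp: field_simps\<close>)
  also have "\<dots> = ennreal (\<integral>z. (exp (- l * z) - 1 + l * z) / l \<partial>n)"
  proof (rule nn_integral_eq_integral)
    show "integrable n (\<lambda>z. (exp (- l * z) - 1 + l * z) / l)"
      using integrable_compensated_laplace[of l] l by (intro integrable_divide_zero) simp
    have "0 \<le> (exp (- l * y) - 1 + l * y) / l" for y
      using exp_ge_add_one_self[of "- l * y"] l by (intro divide_nonneg_pos) linarith+
    then show "AE z in n. 0 \<le> (exp (- l * z) - 1 + l * z) / l" by (intro AE_I2)
  qed
  also have "(\<integral>z. (exp (- l * z) - 1 + l * z) / l \<partial>n) = compensated_laplace n l / l"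
    by (simp only: compensated_laplace_def integral_divide_zero)
  finally show ?thesis .
qed

lemma integrable_tail_exponent:
  assumes l: "l \<ge> 0"
  shows "integrable (ntilde n) (\<lambda>y. 1 - exp (- l * y))"
proof (cases "l = 0")
  case False
  then have "l > 0" using l by simp
  show ?thesis
  proof (rule integrableI_nonneg)
    show "AE y in ntilde n. 0 \<le> 1 - exp (- l * y)"
      using AE_ntilde_pos by eventually_elim (use l in auto)
  qed (use nn_integral_tail_exponent[OF \<open>l > 0\<close>] in auto)
qed simp

lemma tail_exponent_eq:
  assumes l: "l \<ge> 0"
  shows "l * tail_exponent n l = compensated_laplace n l"
proof (cases "l = 0")
  case False
  then have "l > 0" using l by simp
  have "ennreal (tail_exponent n l) = ennreal (compensated_laplace n l / l)"
    unfolding nn_integral_tail_exponent[OF \<open>l > 0\<close>, symmetric] tail_exponent_def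
    using AE_ntilde_pos l
    by (intro nn_integral_eq_integral[symmetric] integrable_tail_exponent) auto
  moreover have "tail_exponent n l \<ge> 0"
    unfolding tail_exponent_def using AE_ntilde_pos l by (intro integral_nonneg_AE) auto
  ultimately show ?thesis
    using \<open>l > 0\<close> compensated_laplace_nonneg[of l] by (simp add: field_simps)
qed (simp add: compensated_laplace_def)

lemma AE_ntilde_nonneg: "AE y in ntilde n. 0 \<le> y"
  using AE_ntilde_pos by eventually_elim simp

lemma tail_exponent_nonneg: "l \<ge> 0 \<Longrightarrow> 0 \<le> tail_exponent n l"
  unfolding tail_exponent_def using AE_ntilde_nonneg by (intro integral_nonneg_AE) auto

text \<open>Comparison with an integrand already known to be integrable: min 1 y \<le> 2 y / (1 + y)
  \<le> 2 (1 - exp (- y)).\<close>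

lemma integrable_ntilde_min: "integrable (ntilde n) (\<lambda>y. min 1 y)"
proof (rule Bochner_Integration.integrable_bound)
  show "integrable (ntilde n) (\<lambda>y. 2 * (1 - exp (- 1 * y)))"
    by (intro integrable_mult_right integrable_tail_exponent) simp
  show "AE y in ntilde n. norm (min 1 y) \<le> norm (2 * (1 - exp (- 1 * y)))"
    using AE_ntilde_pos
  proof eventually_elim
    fix y :: real assume y: "0 < y"
    have "exp (- y) * (1 + y) \<le> exp (- y) * exp y"
      using exp_ge_add_one_self[of y] by (intro mult_left_mono) auto
    then have "exp (- y) * (1 + y) \<le> 1" by (simp flip: exp_add)
    then have "y / (1 + y) \<le> 1 - exp (- y)" using y by (simp add: field_simps)
    moreover have "min 1 y \<le> 2 * (y / (1 + y))"
      using y by (cases "y \<le> 1") (auto simp: field_simps mult_left_le)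
    ultimately show "norm (min 1 y) \<le> norm (2 * (1 - exp (- 1 * y)))"
      using y by auto
  qed
qed measurable

lemma levy_measure_ntilde: "levy_measure (ntilde n)"
  by (intro levy_measure.intro sets_ntilde AE_ntilde_nonneg integrable_ntilde_min)

lemma isCont_tail_exponent:
  assumes "l > 0"
  shows "isCont (tail_exponent n) l"
proof -
  have "(tail_exponent n has_real_derivative laplace1 (ntilde n) l) (at l)"
    using levy_measure.DERIV_integral_one_minus_exp_neg[OF levy_measure_ntilde assms]
    unfolding tail_exponent_def[abs_def] .
  then show ?thesis by (rule DERIV_isCont)
qed

lemma
  assumes "l \<ge> 0" "k \<ge> 0"
  shows integrable_ntilde_exp_diff: "integrable (ntilde n) (\<lambda>y. exp (- l * y) * (1 - exp (- k * y)))"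
    and integral_ntilde_exp_diff:
      "(\<integral>y. exp (- l * y) * (1 - exp (- k * y)) \<partial>ntilde n) = tail_exponent n (l + k) - tail_exponent n l"
proof -
  have eq: "(\<lambda>y. exp (- l * y) * (1 - exp (- k * y)))
      = (\<lambda>y. (1 - exp (- (l + k) * y)) - (1 - exp (- l * y)))"
    by (auto simp: algebra_simps simp flip: exp_add)
  have i: "integrable (ntilde n) (\<lambda>y. 1 - exp (- (l + k) * y))"
    "integrable (ntilde n) (\<lambda>y. 1 - exp (- l * y))"
    using assms by (intro integrable_tail_exponent; simp)+
  show "integrable (ntilde n) (\<lambda>y. exp (- l * y) * (1 - exp (- k * y)))"
    unfolding eq by (intro Bochner_Integration.integrable_diff i)
  show "(\<integral>y. exp (- l * y) * (1 - exp (- k * y)) \<partial>ntilde n) = tail_exponent n (l + k) - tail_exponent n l"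
    unfolding eq tail_exponent_def by (intro Bochner_Integration.integral_diff i)
qed

text \<open>The product is a second difference of exp (- l y) - 1 + l y in l; the linear terms
  cancel.\<close>

lemma
  assumes "l \<ge> 0" "k \<ge> 0"
  shows integrable_n_exp_prod: "integrable n (\<lambda>y. (1 - exp (- l * y)) * (1 - exp (- k * y)))"
    and integral_n_exp_prod: "(\<integral>y. (1 - exp (- l * y)) * (1 - exp (- k * y)) \<partial>n)
      = compensated_laplace n (l + k) - compensated_laplace n l - compensated_laplace n k"
proof -
  have eq: "(\<lambda>y. (1 - exp (- l * y)) * (1 - exp (- k * y)))
      = (\<lambda>y. (exp (- (l + k) * y) - 1 + (l + k) * y) - (exp (- l * y) - 1 + l * y) - (exp (- k * y) - 1 + k * y))"
    by (auto simp: algebra_simps simp flip: exp_add)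
  have i: "integrable n (\<lambda>y. exp (- (l + k) * y) - 1 + (l + k) * y)"
    "integrable n (\<lambda>y. exp (- l * y) - 1 + l * y)" "integrable n (\<lambda>y. exp (- k * y) - 1 + k * y)"
    using assms by (intro integrable_compensated_laplace; simp)+
  show "integrable n (\<lambda>y. (1 - exp (- l * y)) * (1 - exp (- k * y)))"
    unfolding eq by (intro Bochner_Integration.integrable_diff i)
  show "(\<integral>y. (1 - exp (- l * y)) * (1 - exp (- k * y)) \<partial>n)
      = compensated_laplace n (l + k) - compensated_laplace n l - compensated_laplace n k"
    unfolding eq compensated_laplace_def
    by (subst Bochner_Integration.integral_diff | intro i Bochner_Integration.integrable_diff refl)+
qed

end

section \<open>The forms on sums of exponentials\<close>

definition expsum :: "nat \<Rightarrow> (nat \<Rightarrow> real) \<Rightarrow> (nat \<Rightarrow> real) \<Rightarrow> real \<Rightarrow> real" where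
  "expsum m c l x = (\<Sum>i<m. c i * exp (- l i * x))"

lemma F0_eq: "F0 = {expsum m c l | m c l. \<forall>i<m. l i \<ge> 0}"
  unfolding F0_def expsum_def by auto

lemma borel_measurable_expsum [measurable]: "expsum m c l \<in> borel_measurable borel"
  unfolding expsum_def by measurable

lemma deriv_expsum: "deriv (expsum m c l) x = (\<Sum>i<m. - (c i * l i) * exp (- l i * x))"
  unfolding expsum_def
  by (rule DERIV_imp_deriv) (auto intro!: derivative_eq_intros sum.cong)

text \<open>The three coefficient arrays come from carrying out the integral over y at fixed x (for
  \<open>D_coeff\<close> there is none), so the outer measure does not enter them.\<close>

definition B_coeff where
  "B_coeff n c l d k i j = c i * d j * (l i * (tail_exponent n (l i + k j) - tail_exponent n (l i)))"

definition D_coeff :: "(nat \<Rightarrow> real) \<Rightarrow> (nat \<Rightarrow> real) \<Rightarrow> (nat \<Rightarrow> real) \<Rightarrow> (nat \<Rightarrow> real) \<Rightarrow> nat \<Rightarrow> nat \<Rightarrow> real" where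
  "D_coeff c l d k i j = c i * d j * (l i * k j)"

definition J_coeff where
  "J_coeff n c l d k i j = c i * d j *
     (compensated_laplace n (l i + k j) - compensated_laplace n (l i) - compensated_laplace n (k j))"

definition laplace_form :: "real measure \<Rightarrow> nat \<Rightarrow> nat \<Rightarrow> (nat \<Rightarrow> nat \<Rightarrow> real) \<Rightarrow> (nat \<Rightarrow> real) \<Rightarrow> (nat \<Rightarrow> real) \<Rightarrow> real" where
  "laplace_form M m p A l k = (\<Sum>i<m. \<Sum>j<p. A i j * laplace1 M (l i + k j))"

lemma integral_double_sum:
  fixes f :: "nat \<Rightarrow> nat \<Rightarrow> real \<Rightarrow> real"
  assumes "\<And>i j. i < m \<Longrightarrow> j < p \<Longrightarrow> integrable M (f i j)"
  shows "(\<integral>x. (\<Sum>i<m. \<Sum>j<p. f i j x) \<partial>M) = (\<Sum>i<m. \<Sum>j<p. \<integral>x. f i j x \<partial>M)"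
proof -
  have "(\<integral>x. (\<Sum>i<m. \<Sum>j<p. f i j x) \<partial>M) = (\<Sum>i<m. \<integral>x. (\<Sum>j<p. f i j x) \<partial>M)"
    using assms by (intro Bochner_Integration.integral_sum Bochner_Integration.integrable_sum) auto
  also have "\<dots> = (\<Sum>i<m. \<Sum>j<p. \<integral>x. f i j x \<partial>M)"
    using assms by (intro sum.cong refl Bochner_Integration.integral_sum) auto
  finally show ?thesis .
qed

text \<open>Positivity of l i + k j is asked only where the coefficient is nonzero: a term with
  exponent 0 would involve the possibly infinite first moment of \<open>M\<close>, but multiplied by
  0 it is harmless.\<close>

lemma (in levy_measure)
  assumes "\<And>i j. i < m \<Longrightarrow> j < p \<Longrightarrow> A i j \<noteq> 0 \<Longrightarrow> 0 < l i + k j"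
  shows integrable_double_expsum:
      "integrable M (\<lambda>x. x * (\<Sum>i<m. \<Sum>j<p. A i j * exp (- (l i + k j) * x)))"
    and integral_double_expsum:
      "(\<integral>x. x * (\<Sum>i<m. \<Sum>j<p. A i j * exp (- (l i + k j) * x)) \<partial>M) = laplace_form M m p A l k"
proof -
  have eq: "(\<lambda>x. x * (\<Sum>i<m. \<Sum>j<p. A i j * exp (- (l i + k j) * x)))
      = (\<lambda>x. \<Sum>i<m. \<Sum>j<p. A i j * (x * exp (- (l i + k j) * x)))"
    by (simp add: sum_distrib_left mult_ac)
  have int: "integrable M (\<lambda>x. A i j * (x * exp (- (l i + k j) * x)))" if "i < m" "j < p" for i j
  proof (cases "A i j = 0")
    case False
    then show ?thesis
      using that assms[of i j] by (intro integrable_mult_right integrable_mult_exp_neg) auto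
  qed simp
  show "integrable M (\<lambda>x. x * (\<Sum>i<m. \<Sum>j<p. A i j * exp (- (l i + k j) * x)))"
    unfolding eq by (intro Bochner_Integration.integrable_sum int) auto
  have "(\<integral>x. (\<Sum>i<m. \<Sum>j<p. A i j * (x * exp (- (l i + k j) * x))) \<partial>M)
      = (\<Sum>i<m. \<Sum>j<p. \<integral>x. A i j * (x * exp (- (l i + k j) * x)) \<partial>M)"
    by (intro integral_double_sum int)
  also have "\<dots> = laplace_form M m p A l k"
    by (simp add: laplace_form_def laplace1_def)
  finally show "(\<integral>x. x * (\<Sum>i<m. \<Sum>j<p. A i j * exp (- (l i + k j) * x)) \<partial>M) = laplace_form M m p A l k"
    unfolding eq .
qed

lemma D_coeff_pos:
  "D_coeff c l d k i j \<noteq> 0 \<Longrightarrow> l i \<ge> 0 \<Longrightarrow> k j \<ge> 0 \<Longrightarrow> 0 < l i + k j"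
  by (auto simp: D_coeff_def add_pos_nonneg)

lemma B_coeff_pos:
  "B_coeff n c l d k i j \<noteq> 0 \<Longrightarrow> l i \<ge> 0 \<Longrightarrow> k j \<ge> 0 \<Longrightarrow> 0 < l i + k j"
  by (auto simp: B_coeff_def add_pos_nonneg)

text \<open>If l i = 0, the second difference collapses to - \<open>compensated_laplace n 0\<close>,
  which is 0.\<close>

lemma J_coeff_pos:
  "J_coeff n c l d k i j \<noteq> 0 \<Longrightarrow> l i \<ge> 0 \<Longrightarrow> k j \<ge> 0 \<Longrightarrow> 0 < l i + k j"
  by (cases "l i = 0") (auto simp: J_coeff_def compensated_laplace_def add_pos_nonneg)

lemma exp_neg_add_mult: "exp (- (l + k) * z) = exp (- l * z) * exp (- k * z)" for l k z :: real
  by (simp add: algebra_simps flip: exp_add)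

lemma (in levy_measure) D_form:
  assumes "\<forall>i<m. l i \<ge> 0" "\<forall>j<p. k j \<ge> 0"
  shows "integrable M (\<lambda>x. x * (deriv (expsum m c l) x * deriv (expsum p d k) x))"
    and "(\<integral>x. x * (deriv (expsum m c l) x * deriv (expsum p d k) x) \<partial>M) = laplace_form M m p (D_coeff c l d k) l k"
proof -
  have eq: "deriv (expsum m c l) x * deriv (expsum p d k) x
      = (\<Sum>i<m. \<Sum>j<p. D_coeff c l d k i j * exp (- (l i + k j) * x))" for x
    unfolding deriv_expsum sum_product D_coeff_def exp_neg_add_mult by (simp add: mult_ac)
  show "integrable M (\<lambda>x. x * (deriv (expsum m c l) x * deriv (expsum p d k) x))"
    "(\<integral>x. x * (deriv (expsum m c l) x * deriv (expsum p d k) x) \<partial>M) = laplace_form M m p (D_coeff c l d k) l k"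
    unfolding eq using assms by (intro integrable_double_expsum integral_double_expsum; blast intro: D_coeff_pos)+
qed

lemma (in levy_measure) Dterm_expsum:
  assumes "\<forall>i<m. l i \<ge> 0"
  shows "Dterm M (expsum m c l) = laplace_form M m m (D_coeff c l c l) l l"
  using D_form(2)[OF assms assms, of c c] by (simp add: Dterm_def power2_eq_square)

lemma (in branching_measure) inner_integral_B:
  assumes "\<forall>i<m. l i \<ge> 0" "\<forall>j<p. k j \<ge> 0"
  shows "(\<integral>y. deriv (expsum m c l) (x + y) * (expsum p d k (x + y) - expsum p d k x) \<partial>ntilde n)
      = (\<Sum>i<m. \<Sum>j<p. B_coeff n c l d k i j * exp (- (l i + k j) * x))"
proof -
  have eq: "deriv (expsum m c l) (x + y) * (expsum p d k (x + y) - expsum p d k x)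
      = (\<Sum>i<m. \<Sum>j<p. (c i * d j * l i * exp (- (l i + k j) * x)) * (exp (- l i * y) * (1 - exp (- k j * y))))" for y
  proof -
    have "(- (c i * l i) * exp (- l i * (x + y))) * (d j * exp (- k j * (x + y)) - d j * exp (- k j * x))
       = (c i * d j * l i * exp (- (l i + k j) * x)) * (exp (- l i * y) * (1 - exp (- k j * y)))" for i j
    proof -
      have "exp (- l i * (x + y)) = exp (- l i * x) * exp (- l i * y)"
        "exp (- k j * (x + y)) = exp (- k j * x) * exp (- k j * y)"
        "exp (- (l i + k j) * x) = exp (- l i * x) * exp (- k j * x)"
        by (simp_all add: algebra_simps flip: exp_add)
      then show ?thesis by (simp only:) (simp add: algebra_simps)
    qed
    then show ?thesis
      unfolding deriv_expsum unfolding expsum_def sum_subtractf[symmetric] sum_product by (simp only:)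
  qed
  have int: "integrable (ntilde n) (\<lambda>y. (c i * d j * l i * exp (- (l i + k j) * x)) * (exp (- l i * y) * (1 - exp (- k j * y))))"
    if "i < m" "j < p" for i j
    using that assms by (intro integrable_mult_right integrable_ntilde_exp_diff) auto
  have "(\<integral>y. deriv (expsum m c l) (x + y) * (expsum p d k (x + y) - expsum p d k x) \<partial>ntilde n)
     = (\<Sum>i<m. \<Sum>j<p. \<integral>y. (c i * d j * l i * exp (- (l i + k j) * x)) * (exp (- l i * y) * (1 - exp (- k j * y))) \<partial>ntilde n)"
    unfolding eq by (intro integral_double_sum int)
  also have "\<dots> = (\<Sum>i<m. \<Sum>j<p. B_coeff n c l d k i j * exp (- (l i + k j) * x))"
  proof (intro sum.cong refl)
    fix i j assume "i \<in> {..<m}" "j \<in> {..<p}"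
    then have "l i \<ge> 0" "k j \<ge> 0" using assms by auto
    note eqs = integral_ntilde_exp_diff[OF this]
    show "(\<integral>y. (c i * d j * l i * exp (- (l i + k j) * x)) * (exp (- l i * y) * (1 - exp (- k j * y))) \<partial>ntilde n)
        = B_coeff n c l d k i j * exp (- (l i + k j) * x)"
      unfolding B_coeff_def integral_mult_right_zero eqs by (simp only: mult_ac)
  qed
  finally show ?thesis .
qed

lemma (in branching_measure) inner_integral_J:
  assumes "\<forall>j<p. k j \<ge> 0"
  shows "(\<integral>y. (expsum p d k (x + y) - expsum p d k x)\<^sup>2 \<partial>n)
      = (\<Sum>i<p. \<Sum>j<p. J_coeff n d k d k i j * exp (- (k i + k j) * x))"
proof -
  have eq: "(expsum p d k (x + y) - expsum p d k x)\<^sup>2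
      = (\<Sum>i<p. \<Sum>j<p. (d i * d j * exp (- (k i + k j) * x)) * ((1 - exp (- k i * y)) * (1 - exp (- k j * y))))" for y
  proof -
    have "(d i * exp (- k i * (x + y)) - d i * exp (- k i * x)) * (d j * exp (- k j * (x + y)) - d j * exp (- k j * x))
       = (d i * d j * exp (- (k i + k j) * x)) * ((1 - exp (- k i * y)) * (1 - exp (- k j * y)))" for i j
    proof -
      have "exp (- k i * (x + y)) = exp (- k i * x) * exp (- k i * y)"
        "exp (- k j * (x + y)) = exp (- k j * x) * exp (- k j * y)"
        "exp (- (k i + k j) * x) = exp (- k i * x) * exp (- k j * x)"
        by (simp_all add: algebra_simps flip: exp_add)
      then show ?thesis by (simp only:) (simp add: algebra_simps)
    qed
    then show ?thesis
      unfolding power2_eq_square expsum_def sum_subtractf[symmetric] sum_product by (simp only:)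
  qed
  have int: "integrable n (\<lambda>y. (d i * d j * exp (- (k i + k j) * x)) * ((1 - exp (- k i * y)) * (1 - exp (- k j * y))))"
    if "i < p" "j < p" for i j
    using that assms by (intro integrable_mult_right integrable_n_exp_prod) auto
  have "(\<integral>y. (expsum p d k (x + y) - expsum p d k x)\<^sup>2 \<partial>n)
     = (\<Sum>i<p. \<Sum>j<p. \<integral>y. (d i * d j * exp (- (k i + k j) * x)) * ((1 - exp (- k i * y)) * (1 - exp (- k j * y))) \<partial>n)"
    unfolding eq by (intro integral_double_sum int)
  also have "\<dots> = (\<Sum>i<p. \<Sum>j<p. J_coeff n d k d k i j * exp (- (k i + k j) * x))"
  proof (intro sum.cong refl)
    fix i j assume "i \<in> {..<p}" "j \<in> {..<p}"
    then have "k i \<ge> 0" "k j \<ge> 0" using assms by auto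
    note eqs = integral_n_exp_prod[OF this]
    show "(\<integral>y. (d i * d j * exp (- (k i + k j) * x)) * ((1 - exp (- k i * y)) * (1 - exp (- k j * y))) \<partial>n)
        = J_coeff n d k d k i j * exp (- (k i + k j) * x)"
      unfolding J_coeff_def integral_mult_right_zero eqs by (simp only: mult_ac)
  qed
  finally show ?thesis .
qed

locale branching_forms = branching_measure n + levy_measure M for n M :: "real measure"
begin

lemma Bform_expsum:
  assumes "\<forall>i<m. l i \<ge> 0" "\<forall>j<p. k j \<ge> 0"
  shows "Bform n M (expsum m c l) (expsum p d k) = laplace_form M m p (B_coeff n c l d k) l k"
  unfolding Bform_def inner_integral_B[OF assms]
  using assms by (intro integral_double_expsum) (blast intro: B_coeff_pos)

lemma Jterm_expsum:
  assumes "\<forall>j<p. k j \<ge> 0"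
  shows "Jterm n M (expsum p d k) = laplace_form M p p (J_coeff n d k d k) k k"
  unfolding Jterm_def inner_integral_J[OF assms]
  using assms by (intro integral_double_expsum) (blast intro: J_coeff_pos)

text \<open>The antisymmetric part of \<^const>\<open>Bform\<close> disappears on the diagonal, and
  \<open>l * tail_exponent n l = compensated_laplace n l\<close> identifies what is left.\<close>

lemma Bform_diagonal:
  assumes l: "\<forall>i<m. l i \<ge> 0"
  shows "Bform n M (expsum m c l) (expsum m c l) = Jterm n M (expsum m c l) / 2"
proof -
  let ?B = "\<lambda>i j. B_coeff n c l c l i j * laplace1 M (l i + l j)"
  have "Bform n M (expsum m c l) (expsum m c l) = (\<Sum>i<m. \<Sum>j<m. ?B i j)"
    unfolding Bform_expsum[OF l l] laplace_form_def ..
  moreover have "(\<Sum>i<m. \<Sum>j<m. ?B i j) = (\<Sum>i<m. \<Sum>j<m. ?B j i)"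
    by (rule sum.swap)
  moreover have "?B i j + ?B j i = J_coeff n c l c l i j * laplace1 M (l i + l j)" if "i < m" "j < m" for i j
  proof -
    have "l i * tail_exponent n (l i) = compensated_laplace n (l i)"
      "l j * tail_exponent n (l j) = compensated_laplace n (l j)"
      "(l i + l j) * tail_exponent n (l i + l j) = compensated_laplace n (l i + l j)"
      using l that by (intro tail_exponent_eq; simp)+
    note eqs = this
    have "B_coeff n c l c l i j + B_coeff n c l c l j i
        = c i * c j * ((l i + l j) * tail_exponent n (l i + l j) - l i * tail_exponent n (l i) - l j * tail_exponent n (l j))"
      unfolding B_coeff_def add.commute[of "l j"] by (simp add: algebra_simps)
    also have "\<dots> = J_coeff n c l c l i j"
      unfolding J_coeff_def eqs ..
    finally have "B_coeff n c l c l i j + B_coeff n c l c l j i = J_coeff n c l c l i j" .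
    then show ?thesis by (simp add: add.commute[of "l j"] flip: distrib_right)
  qed
  moreover have "(\<Sum>i<m. \<Sum>j<m. ?B i j) + (\<Sum>i<m. \<Sum>j<m. ?B j i) = (\<Sum>i<m. \<Sum>j<m. ?B i j + ?B j i)"
    by (simp only: sum.distrib)
  ultimately have "2 * Bform n M (expsum m c l) (expsum m c l)
      = (\<Sum>i<m. \<Sum>j<m. J_coeff n c l c l i j * laplace1 M (l i + l j))"
    by simp
  then show ?thesis unfolding Jterm_expsum[OF l] laplace_form_def by simp
qed

end

section \<open>Infinitely divisible laws and the equivalence of the two bounds\<close>

lemma integrable_mult_L2:
  fixes f g :: "'a \<Rightarrow> real"
  assumes [measurable]: "f \<in> borel_measurable M" "g \<in> borel_measurable M"
    and "integrable M (\<lambda>x. (f x)\<^sup>2)" "integrable M (\<lambda>x. (g x)\<^sup>2)"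
  shows "integrable M (\<lambda>x. f x * g x)"
proof (rule Bochner_Integration.integrable_bound)
  show "integrable M (\<lambda>x. (f x)\<^sup>2 + (g x)\<^sup>2)" using assms by simp
  have "norm (f x * g x) \<le> norm ((f x)\<^sup>2 + (g x)\<^sup>2)" for x
  proof -
    have "0 \<le> (\<bar>f x\<bar> - \<bar>g x\<bar>)\<^sup>2" by simp
    then have "2 * (\<bar>f x\<bar> * \<bar>g x\<bar>) \<le> (f x)\<^sup>2 + (g x)\<^sup>2"
      by (simp add: power2_diff)
    moreover have "0 \<le> \<bar>f x\<bar> * \<bar>g x\<bar>" by simp
    ultimately show ?thesis unfolding real_norm_def abs_mult by linarith
  qed
  then show "AE x in M. norm (f x * g x) \<le> norm ((f x)\<^sup>2 + (g x)\<^sup>2)" by simp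
qed measurable

text \<open>The integral of (f + t g)^2 is a quadratic polynomial in t that never becomes
  negative.\<close>

lemma integral_Cauchy_Schwarz:
  fixes f g :: "'a \<Rightarrow> real"
  assumes [measurable]: "f \<in> borel_measurable M" "g \<in> borel_measurable M"
    and int: "integrable M (\<lambda>x. (f x)\<^sup>2)" "integrable M (\<lambda>x. (g x)\<^sup>2)"
  shows "(\<integral>x. f x * g x \<partial>M)\<^sup>2 \<le> (\<integral>x. (f x)\<^sup>2 \<partial>M) * (\<integral>x. (g x)\<^sup>2 \<partial>M)"
proof -
  define A B C where "A = (\<integral>x. (f x)\<^sup>2 \<partial>M)" and "B = (\<integral>x. f x * g x \<partial>M)"
    and "C = (\<integral>x. (g x)\<^sup>2 \<partial>M)"
  have quad: "0 \<le> A + 2 * t * B + t\<^sup>2 * C" for t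
  proof -
    have "0 \<le> (\<integral>x. (f x + t * g x)\<^sup>2 \<partial>M)" by simp
    also have "(\<lambda>x. (f x + t * g x)\<^sup>2) = (\<lambda>x. (f x)\<^sup>2 + 2 * t * (f x * g x) + t\<^sup>2 * (g x)\<^sup>2)"
      by (simp add: power2_eq_square algebra_simps)
    also have "(\<integral>x. (f x)\<^sup>2 + 2 * t * (f x * g x) + t\<^sup>2 * (g x)\<^sup>2 \<partial>M) = A + 2 * t * B + t\<^sup>2 * C"
      using int integrable_mult_L2[of f M g] by (simp add: A_def B_def C_def)
    finally show ?thesis .
  qed
  have "C \<ge> 0" by (simp add: C_def)
  have "B\<^sup>2 \<le> A * C"
  proof (cases "C = 0")
    case True
    have "B = 0"
    proof (rule ccontr)
      assume "B \<noteq> 0"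
      \<comment> \<open>With C = 0 the polynomial is affine in t; at this t it would equal
        -1.\<close>
      then have "2 * (- (A + 1) / (2 * B)) * B = - (A + 1)" by (simp add: field_simps)
      then show False using quad[of "- (A + 1) / (2 * B)"] True by simp
    qed
    then show ?thesis using True by simp
  next
    case False
    then show ?thesis
      \<comment> \<open>The minimiser of the quadratic polynomial.\<close>
      using quad[of "- B / C"] \<open>C \<ge> 0\<close> by (simp add: power2_eq_square field_simps)
  qed
  then show ?thesis by (simp add: A_def B_def C_def)
qed

definition levy_exponent :: "real measure \<Rightarrow> real \<Rightarrow> real" where
  "levy_exponent \<Lambda> l = (\<integral>x. 1 - exp (- l * x) \<partial>\<Lambda>)"

text \<open>\<open>N\<close> plays the role of \<nu> at parameter \<delta>: the driftless infinitely
  divisible law on the nonnegative half-line with Levy measure \<delta> \<Lambda>. Here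
  \<open>levy_exponent\<close> is the real-valued form of \<Phi>.\<close>

locale infinitely_divisible = L: levy_measure \<Lambda> + prob_space N
  for \<Lambda> N :: "real measure" +
  fixes \<delta> :: real
  assumes \<delta>_pos: "\<delta> > 0"
    and sets_N [measurable_cong]: "sets N = sets borel"
    and N_supp: "emeasure N {..<0} = 0"
    and laplace_nn: "\<And>l. l \<ge> 0 \<Longrightarrow>
        (\<integral>\<^sup>+ x. ennreal (exp (- l * x)) \<partial>N) = ennreal (exp (- \<delta> * levy_exponent \<Lambda> l))"
begin

lemma AE_nonneg: "AE x in N. 0 \<le> x"
proof (rule AE_I)
  show "{x \<in> space N. \<not> 0 \<le> x} \<subseteq> {..<0}" by auto
qed (use N_supp sets_N in auto)

lemma levy_measure_N: "levy_measure N"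
proof (intro levy_measure.intro sets_N AE_nonneg)
  show "integrable N (\<lambda>x. min 1 x)"
    by (rule integrable_const_bound[where B = 1]) (use AE_nonneg in auto)
qed

lemma integrable_exp_neg: "l \<ge> 0 \<Longrightarrow> integrable N (\<lambda>x. exp (- l * x))"
  by (rule integrable_const_bound[where B = 1]) (use AE_nonneg in auto)

lemma laplace: "l \<ge> 0 \<Longrightarrow> (\<integral>x. exp (- l * x) \<partial>N) = exp (- \<delta> * levy_exponent \<Lambda> l)"
  using laplace_nn[of l] by (simp add: integral_eq_nn_integral)

lemma laplace1_eq:
  assumes l: "l > 0"
  shows "laplace1 N l = \<delta> * exp (- \<delta> * levy_exponent \<Lambda> l) * laplace1 \<Lambda> l"
proof -
  have "((\<lambda>l. \<integral>x. 1 - exp (- l * x) \<partial>N) has_real_derivative laplace1 N l) (at l)"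
    by (rule levy_measure.DERIV_integral_one_minus_exp_neg[OF levy_measure_N l])
  moreover have "\<forall>\<^sub>F l in nhds l. (\<integral>x. 1 - exp (- l * x) \<partial>N) = 1 - exp (- \<delta> * levy_exponent \<Lambda> l)"
  proof -
    have "\<forall>\<^sub>F l in nhds l. l > 0" using l by (intro eventually_nhds_in_open[of "{0<..}", simplified]) auto
    then show ?thesis
    proof eventually_elim
      case (elim l)
      then show ?case
        using laplace[of l] integrable_exp_neg[of l]
        by (subst Bochner_Integration.integral_diff) (auto simp: prob_space)
    qed
  qed
  ultimately have "((\<lambda>l. 1 - exp (- \<delta> * levy_exponent \<Lambda> l)) has_real_derivative laplace1 N l) (at l)"
    by (subst (asm) DERIV_cong_ev[OF refl _ refl]) auto
  moreover have "(levy_exponent \<Lambda> has_real_derivative laplace1 \<Lambda> l) (at l)"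
    using L.DERIV_integral_one_minus_exp_neg[OF l] unfolding levy_exponent_def[abs_def] .
  then have "((\<lambda>l. 1 - exp (- \<delta> * levy_exponent \<Lambda> l)) has_real_derivative
      \<delta> * exp (- \<delta> * levy_exponent \<Lambda> l) * laplace1 \<Lambda> l) (at l)"
    by (auto intro!: derivative_eq_intros)
  ultimately show ?thesis by (rule DERIV_unique)
qed

lemma laplace_form_N:
  assumes "\<And>i j. i < m \<Longrightarrow> j < p \<Longrightarrow> A i j \<noteq> 0 \<Longrightarrow> 0 < l i + k j"
  shows "laplace_form N m p A l k
    = \<delta> * (\<Sum>i<m. \<Sum>j<p. A i j * laplace1 \<Lambda> (l i + k j) * exp (- \<delta> * levy_exponent \<Lambda> (l i + k j)))"
  unfolding laplace_form_def sum_distrib_left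
proof (intro sum.cong refl)
  fix i j assume "i \<in> {..<m}" "j \<in> {..<p}"
  then show "A i j * laplace1 N (l i + k j)
      = \<delta> * (A i j * laplace1 \<Lambda> (l i + k j) * exp (- \<delta> * levy_exponent \<Lambda> (l i + k j)))"
    using assms[of i j] laplace1_eq[of "l i + k j"] by (cases "A i j = 0") auto
qed

text \<open>The size-biased law \<open>x N(dx)\<close> is \<open>\<delta>\<close> times the convolution of \<open>N\<close> with
  \<open>x \<Lambda>(dx)\<close>; at the level of coefficients, a form over \<open>N\<close> is therefore the \<open>N\<close>-average of
  forms over \<open>\<Lambda>\<close> with translated arguments.\<close>

lemma
  assumes pos: "\<And>i j. i < m \<Longrightarrow> j < p \<Longrightarrow> A i j \<noteq> 0 \<Longrightarrow> 0 < l i + k j"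
  shows integrable_laplace_form_shift:
      "integrable N (\<lambda>z. laplace_form \<Lambda> m p (\<lambda>i j. A i j * exp (- (l i + k j) * z)) l k)"
    and laplace_form_shift:
      "laplace_form N m p A l k
        = \<delta> * (\<integral>z. laplace_form \<Lambda> m p (\<lambda>i j. A i j * exp (- (l i + k j) * z)) l k \<partial>N)"
proof -
  have eq: "laplace_form \<Lambda> m p (\<lambda>i j. A i j * exp (- (l i + k j) * z)) l k
      = (\<Sum>i<m. \<Sum>j<p. (A i j * laplace1 \<Lambda> (l i + k j)) * exp (- (l i + k j) * z))" for z
    by (simp add: laplace_form_def mult_ac)
  have int: "integrable N (\<lambda>z. (A i j * laplace1 \<Lambda> (l i + k j)) * exp (- (l i + k j) * z))"
    if "i < m" "j < p" for i j
  proof (cases "A i j = 0")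
    case False
    then show ?thesis using pos[OF that] by (intro integrable_mult_right integrable_exp_neg) auto
  qed simp
  show "integrable N (\<lambda>z. laplace_form \<Lambda> m p (\<lambda>i j. A i j * exp (- (l i + k j) * z)) l k)"
    unfolding eq by (intro Bochner_Integration.integrable_sum int) auto
  have "(\<integral>z. laplace_form \<Lambda> m p (\<lambda>i j. A i j * exp (- (l i + k j) * z)) l k \<partial>N)
      = (\<Sum>i<m. \<Sum>j<p. \<integral>z. (A i j * laplace1 \<Lambda> (l i + k j)) * exp (- (l i + k j) * z) \<partial>N)"
    unfolding eq by (intro integral_double_sum int)
  also have "\<dots> = (\<Sum>i<m. \<Sum>j<p. A i j * laplace1 \<Lambda> (l i + k j) * exp (- \<delta> * levy_exponent \<Lambda> (l i + k j)))"
  proof (intro sum.cong refl)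
    fix i j assume "i \<in> {..<m}" "j \<in> {..<p}"
    then show "(\<integral>z. (A i j * laplace1 \<Lambda> (l i + k j)) * exp (- (l i + k j) * z) \<partial>N)
        = A i j * laplace1 \<Lambda> (l i + k j) * exp (- \<delta> * levy_exponent \<Lambda> (l i + k j))"
      using pos[of i j] laplace[of "l i + k j"] by (cases "A i j = 0") auto
  qed
  finally show "laplace_form N m p A l k
        = \<delta> * (\<integral>z. laplace_form \<Lambda> m p (\<lambda>i j. A i j * exp (- (l i + k j) * z)) l k \<partial>N)"
    using laplace_form_N[OF pos] by simp
qed

end

text \<open>Translating the argument by z multiplies the i-th coefficient by exp (- l i z). The
  arrays are bilinear in the coefficients, so the product of both factors comes out.\<close>

lemma
  shows B_coeff_shift: "B_coeff n (\<lambda>i. c i * exp (- l i * z)) l (\<lambda>j. d j * exp (- k j * z)) k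
      = (\<lambda>i j. B_coeff n c l d k i j * exp (- (l i + k j) * z))"
    and J_coeff_shift: "J_coeff n (\<lambda>i. c i * exp (- l i * z)) l (\<lambda>j. d j * exp (- k j * z)) k
      = (\<lambda>i j. J_coeff n c l d k i j * exp (- (l i + k j) * z))"
    and D_coeff_shift: "D_coeff (\<lambda>i. c i * exp (- l i * z)) l (\<lambda>j. d j * exp (- k j * z)) k
      = (\<lambda>i j. D_coeff c l d k i j * exp (- (l i + k j) * z))"
  unfolding exp_neg_add_mult by (auto simp: fun_eq_iff B_coeff_def J_coeff_def D_coeff_def)

lemma Dterm_nonneg: "levy_measure M \<Longrightarrow> 0 \<le> Dterm M f"
  unfolding Dterm_def using levy_measure.pos[of M] by (intro integral_nonneg_AE) (auto elim!: eventually_mono)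

lemma Jterm_nonneg: "levy_measure M \<Longrightarrow> 0 \<le> Jterm n M f"
  unfolding Jterm_def using levy_measure.pos[of M] by (intro integral_nonneg_AE) (auto elim!: eventually_mono)

text \<open>The bound over \<Lambda> is applied to the translated pair for each z and integrated
  over \<open>N\<close>. Every form over \<open>N\<close> carries exactly one factor \<delta>, so
  both sides scale by \<delta>^2.\<close>

lemma bound_over_stationary_law:
  assumes n: "branching_measure n" and N: "infinitely_divisible \<Lambda> N \<delta>" and C: "C > 0"
    and bound: "\<forall>f\<in>F0. \<forall>g\<in>F0. (Bform n \<Lambda> f g)\<^sup>2 \<le> C * Dterm \<Lambda> f * Jterm n \<Lambda> g"
    and f: "f \<in> F0" and g: "g \<in> F0"
  shows "(Bform n N f g)\<^sup>2 \<le> C * Dterm N f * Jterm n N g"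
proof -
  interpret n: branching_measure n by fact
  interpret infinitely_divisible \<Lambda> N \<delta> by fact
  interpret FL: branching_forms n \<Lambda> ..
  interpret NL: levy_measure N by (rule levy_measure_N)
  interpret FN: branching_forms n N ..
  obtain m c l where fe: "f = expsum m c l" and l: "\<forall>i<m. l i \<ge> 0" using f by (auto simp: F0_eq)
  obtain p d k where ge: "g = expsum p d k" and k: "\<forall>j<p. k j \<ge> 0" using g by (auto simp: F0_eq)
  \<comment> \<open>\<open>ff z\<close> and \<open>gg z\<close> are the translates f (z + .) and g
    (z + .) in coefficient form, hence again in \<open>F0\<close>.\<close>
  define ff where "ff z = expsum m (\<lambda>i. c i * exp (- l i * z)) l" for z
  define gg where "gg z = expsum p (\<lambda>i. d i * exp (- k i * z)) k" for z
  have F0s: "ff z \<in> F0" "gg z \<in> F0" for z using l k by (auto simp: ff_def gg_def F0_eq)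
  have B: "integrable N (\<lambda>z. Bform n \<Lambda> (ff z) (gg z))"
    "Bform n N f g = \<delta> * (\<integral>z. Bform n \<Lambda> (ff z) (gg z) \<partial>N)"
    unfolding ff_def gg_def fe ge FN.Bform_expsum[OF l k] FL.Bform_expsum[OF l k] B_coeff_shift
    using l k by (intro integrable_laplace_form_shift laplace_form_shift; blast intro: B_coeff_pos)+
  have D: "integrable N (\<lambda>z. Dterm \<Lambda> (ff z))" "Dterm N f = \<delta> * (\<integral>z. Dterm \<Lambda> (ff z) \<partial>N)"
    unfolding ff_def fe NL.Dterm_expsum[OF l] L.Dterm_expsum[OF l] D_coeff_shift
    using l k by (intro integrable_laplace_form_shift laplace_form_shift; blast intro: D_coeff_pos)+
  have J: "integrable N (\<lambda>z. Jterm n \<Lambda> (gg z))" "Jterm n N g = \<delta> * (\<integral>z. Jterm n \<Lambda> (gg z) \<partial>N)"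
    unfolding gg_def ge FN.Jterm_expsum[OF k] FL.Jterm_expsum[OF k] J_coeff_shift
    using l k by (intro integrable_laplace_form_shift laplace_form_shift; blast intro: J_coeff_pos)+
  have D0: "0 \<le> Dterm \<Lambda> (ff z)" and J0: "0 \<le> Jterm n \<Lambda> (gg z)" for z
    by (intro Dterm_nonneg Jterm_nonneg L.levy_measure_axioms)+
  \<comment> \<open>With these square roots the pointwise bound reads |B| \<le> u w, and
    Cauchy-Schwarz over \<open>N\<close> returns the averages of the two terms.\<close>
  define u where "u z = sqrt (C * Dterm \<Lambda> (ff z))" for z
  define w where "w z = sqrt (Jterm n \<Lambda> (gg z))" for z
  have [measurable]: "u \<in> borel_measurable N" "w \<in> borel_measurable N"
    unfolding u_def[abs_def] w_def[abs_def] using D(1) J(1) by auto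
  have u2: "(\<lambda>z. (u z)\<^sup>2) = (\<lambda>z. C * Dterm \<Lambda> (ff z))" and w2: "(\<lambda>z. (w z)\<^sup>2) = (\<lambda>z. Jterm n \<Lambda> (gg z))"
    using D0 J0 C by (auto simp: u_def w_def)
  have i2: "integrable N (\<lambda>z. (u z)\<^sup>2)" "integrable N (\<lambda>z. (w z)\<^sup>2)"
    unfolding u2 w2 using D J by auto
  have "\<bar>Bform n \<Lambda> (ff z) (gg z)\<bar> \<le> u z * w z" for z
  proof (rule power2_le_imp_le)
    have "(Bform n \<Lambda> (ff z) (gg z))\<^sup>2 \<le> C * Dterm \<Lambda> (ff z) * Jterm n \<Lambda> (gg z)"
      using bound F0s by blast
    also have "\<dots> = (u z * w z)\<^sup>2" using fun_cong[OF u2, of z] fun_cong[OF w2, of z] by (simp add: power_mult_distrib)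
    finally show "\<bar>Bform n \<Lambda> (ff z) (gg z)\<bar>\<^sup>2 \<le> (u z * w z)\<^sup>2" by simp
    show "0 \<le> u z * w z" using D0 J0 C by (simp add: u_def w_def)
  qed
  then have "\<bar>\<integral>z. Bform n \<Lambda> (ff z) (gg z) \<partial>N\<bar> \<le> (\<integral>z. u z * w z \<partial>N)"
    using B(1) i2 integrable_mult_L2[of u N w]
    by (intro order_trans[OF integral_abs_bound integral_mono_AE]) auto
  then have "\<bar>\<integral>z. Bform n \<Lambda> (ff z) (gg z) \<partial>N\<bar>\<^sup>2 \<le> (\<integral>z. u z * w z \<partial>N)\<^sup>2"
    by (intro power_mono) auto
  also have "\<dots> \<le> (\<integral>z. (u z)\<^sup>2 \<partial>N) * (\<integral>z. (w z)\<^sup>2 \<partial>N)"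
    by (intro integral_Cauchy_Schwarz i2) measurable
  also have "\<dots> = C * (\<integral>z. Dterm \<Lambda> (ff z) \<partial>N) * (\<integral>z. Jterm n \<Lambda> (gg z) \<partial>N)"
    unfolding u2 w2 by simp
  finally have "\<delta>\<^sup>2 * (\<integral>z. Bform n \<Lambda> (ff z) (gg z) \<partial>N)\<^sup>2
      \<le> \<delta>\<^sup>2 * (C * (\<integral>z. Dterm \<Lambda> (ff z) \<partial>N) * (\<integral>z. Jterm n \<Lambda> (gg z) \<partial>N))"
    by (intro mult_left_mono) auto
  then show ?thesis
    unfolding B D J by (simp add: power2_eq_square mult_ac)
qed

text \<open>The inequality is homogeneous of degree two in the forms, so \<delta>^2 cancels before
  the limit is taken; without this normalisation both sides would tend to 0.\<close>

lemma bound_over_Levy_measure: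
  assumes n: "branching_measure n" and \<nu>: "\<And>\<delta>. \<delta> > 0 \<Longrightarrow> infinitely_divisible \<Lambda> (\<nu> \<delta>) \<delta>"
    and bound: "\<forall>\<delta>>0. \<forall>f\<in>F0. \<forall>g\<in>F0. (Bform n (\<nu> \<delta>) f g)\<^sup>2 \<le> C * Dterm (\<nu> \<delta>) f * Jterm n (\<nu> \<delta>) g"
    and f: "f \<in> F0" and g: "g \<in> F0"
  shows "(Bform n \<Lambda> f g)\<^sup>2 \<le> C * Dterm \<Lambda> f * Jterm n \<Lambda> g"
proof -
  interpret n: branching_measure n by fact
  have LL: "levy_measure \<Lambda>" using \<nu>[of 1] by (simp add: infinitely_divisible_def)
  interpret L: levy_measure \<Lambda> by fact
  interpret FL: branching_forms n \<Lambda> ..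
  obtain m c l where fe: "f = expsum m c l" and l: "\<forall>i<m. l i \<ge> 0" using f by (auto simp: F0_eq)
  obtain p d k where ge: "g = expsum p d k" and k: "\<forall>j<p. k j \<ge> 0" using g by (auto simp: F0_eq)
  \<comment> \<open>The form over \<nu> \<delta>, divided by \<delta>. It is a finite sum, so the
    limit \<delta> to 0 can be taken term by term.\<close>
  define S where "S q r A l k \<delta> = (\<Sum>i<q. \<Sum>j<r. A i j * laplace1 \<Lambda> (l i + k j) * exp (- \<delta> * levy_exponent \<Lambda> (l i + k j)))"
    for q r :: nat and A :: "nat \<Rightarrow> nat \<Rightarrow> real" and l k :: "nat \<Rightarrow> real" and \<delta> :: real
  have lim: "((\<lambda>\<delta>. S q r A l k \<delta>) \<longlongrightarrow> laplace_form \<Lambda> q r A l k) (at_right 0)" for q r A l k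
    unfolding S_def laplace_form_def by (auto intro!: tendsto_eq_intros)
  have "(S m p (B_coeff n c l d k) l k \<delta>)\<^sup>2 \<le> C * S m m (D_coeff c l c l) l l \<delta> * S p p (J_coeff n d k d k) k k \<delta>"
    if \<delta>: "\<delta> > 0" for \<delta>
  proof -
    interpret N: infinitely_divisible \<Lambda> "\<nu> \<delta>" \<delta> by (rule \<nu>[OF \<delta>])
    interpret NL: levy_measure "\<nu> \<delta>" by (rule N.levy_measure_N)
    interpret FN: branching_forms n "\<nu> \<delta>" ..
    have B: "Bform n (\<nu> \<delta>) f g = \<delta> * S m p (B_coeff n c l d k) l k \<delta>"
      unfolding fe ge S_def FN.Bform_expsum[OF l k]
      using l k by (intro N.laplace_form_N) (blast intro: B_coeff_pos)
    have D: "Dterm (\<nu> \<delta>) f = \<delta> * S m m (D_coeff c l c l) l l \<delta>"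
      unfolding fe S_def NL.Dterm_expsum[OF l]
      using l by (intro N.laplace_form_N) (blast intro: D_coeff_pos)
    have J: "Jterm n (\<nu> \<delta>) g = \<delta> * S p p (J_coeff n d k d k) k k \<delta>"
      unfolding ge S_def FN.Jterm_expsum[OF k]
      using k by (intro N.laplace_form_N) (blast intro: J_coeff_pos)
    have "(Bform n (\<nu> \<delta>) f g)\<^sup>2 \<le> C * Dterm (\<nu> \<delta>) f * Jterm n (\<nu> \<delta>) g"
      using bound \<delta> f g by blast
    then have "\<delta>\<^sup>2 * (S m p (B_coeff n c l d k) l k \<delta>)\<^sup>2
        \<le> \<delta>\<^sup>2 * (C * S m m (D_coeff c l c l) l l \<delta> * S p p (J_coeff n d k d k) k k \<delta>)"
      unfolding B D J by (simp add: power2_eq_square mult_ac)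
    then show ?thesis using \<delta> by simp
  qed
  then have "\<forall>\<^sub>F \<delta> in at_right 0.
      (S m p (B_coeff n c l d k) l k \<delta>)\<^sup>2 \<le> C * S m m (D_coeff c l c l) l l \<delta> * S p p (J_coeff n d k d k) k k \<delta>"
    by (simp add: eventually_at_right_field) (use zero_less_one in blast)
  from tendsto_le[OF trivial_limit_at_right_real _ _ this]
  have "(laplace_form \<Lambda> m p (B_coeff n c l d k) l k)\<^sup>2
      \<le> C * laplace_form \<Lambda> m m (D_coeff c l c l) l l * laplace_form \<Lambda> p p (J_coeff n d k d k) k k"
    by (simp add: tendsto_power tendsto_mult lim)
  then show ?thesis
    unfolding fe ge FL.Bform_expsum[OF l k] L.Dterm_expsum[OF l] FL.Jterm_expsum[OF k] .
qed

section \<open>Square-integrable functions and density of exponentials\<close>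

text \<open>Functions instead of classes, in accordance with \<open>L2_generator\<close>. Operator
  identities below therefore hold almost everywhere, or as vanishing of
  \<open>L2_norm\<close>.\<close>

definition in_L2 :: "'a measure \<Rightarrow> ('a \<Rightarrow> real) \<Rightarrow> bool" where
  "in_L2 M f \<longleftrightarrow> f \<in> borel_measurable M \<and> integrable M (\<lambda>x. (f x)\<^sup>2)"

definition L2_norm :: "'a measure \<Rightarrow> ('a \<Rightarrow> real) \<Rightarrow> real" where
  "L2_norm M f = sqrt (\<integral>x. (f x)\<^sup>2 \<partial>M)"

lemma L2_norm_nonneg [simp]: "0 \<le> L2_norm M f"
  by (simp add: L2_norm_def)

lemma L2_norm_square: "(L2_norm M f)\<^sup>2 = (\<integral>x. (f x)\<^sup>2 \<partial>M)"
  by (simp add: L2_norm_def)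

lemma in_L2_measurable: "in_L2 M f \<Longrightarrow> f \<in> borel_measurable M"
  by (simp add: in_L2_def)

lemma in_L2_mult:
  "in_L2 M f \<Longrightarrow> in_L2 M g \<Longrightarrow> integrable M (\<lambda>x. f x * g x)"
  unfolding in_L2_def by (intro integrable_mult_L2) auto

lemma L2_Cauchy_Schwarz:
  assumes "in_L2 M f" "in_L2 M g"
  shows "\<bar>\<integral>x. f x * g x \<partial>M\<bar> \<le> L2_norm M f * L2_norm M g"
proof (rule power2_le_imp_le)
  show "\<bar>\<integral>x. f x * g x \<partial>M\<bar>\<^sup>2 \<le> (L2_norm M f * L2_norm M g)\<^sup>2"
    using assms integral_Cauchy_Schwarz[of f M g]
    by (simp add: power_mult_distrib L2_norm_square in_L2_def)
qed simp

lemma in_L2_add: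
  assumes "in_L2 M f" "in_L2 M g"
  shows "in_L2 M (\<lambda>x. f x + g x)"
  using assms in_L2_mult[OF assms]
  by (auto simp: in_L2_def power2_sum mult.assoc)

lemma in_L2_cmult:
  "in_L2 M f \<Longrightarrow> in_L2 M (\<lambda>x. c * f x)"
  by (auto simp: in_L2_def power_mult_distrib)

lemma in_L2_diff:
  assumes "in_L2 M f" "in_L2 M g"
  shows "in_L2 M (\<lambda>x. f x - g x)"
  using in_L2_add[OF assms(1) in_L2_cmult[OF assms(2), of "-1"]] by simp

lemma in_L2_sum:
  "(\<And>i. i \<in> I \<Longrightarrow> in_L2 M (f i)) \<Longrightarrow> in_L2 M (\<lambda>x. \<Sum>i\<in>I. f i x)"
proof (induction I rule: infinite_finite_induct)
  case (insert i I)
  then show ?case by (simp add: in_L2_add)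
qed (auto simp: in_L2_def)

lemma L2_norm_cmult: "L2_norm M (\<lambda>x. c * f x) = \<bar>c\<bar> * L2_norm M f"
  by (simp add: L2_norm_def power_mult_distrib real_sqrt_mult)

lemma L2_norm_triangle:
  assumes f: "in_L2 M f" and g: "in_L2 M g"
  shows "L2_norm M (\<lambda>x. f x + g x) \<le> L2_norm M f + L2_norm M g"
proof (rule power2_le_imp_le)
  have "(L2_norm M (\<lambda>x. f x + g x))\<^sup>2
      = (L2_norm M f)\<^sup>2 + (L2_norm M g)\<^sup>2 + 2 * (\<integral>x. f x * g x \<partial>M)"
    unfolding L2_norm_square using in_L2_mult[OF f g] f g
    by (simp add: power2_sum in_L2_def mult.assoc)
  also have "\<dots> \<le> (L2_norm M f + L2_norm M g)\<^sup>2"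
    using L2_Cauchy_Schwarz[OF f g] by (simp add: power2_sum)
  finally show "(L2_norm M (\<lambda>x. f x + g x))\<^sup>2 \<le> (L2_norm M f + L2_norm M g)\<^sup>2" .
qed simp

lemma L2_norm_diff:
  assumes "in_L2 M f" "in_L2 M g"
  shows "L2_norm M (\<lambda>x. f x - g x) \<le> L2_norm M f + L2_norm M g"
  using L2_norm_triangle[OF assms(1) in_L2_cmult[OF assms(2), of "-1"]]
  by (simp add: L2_norm_cmult[of M "-1" g, simplified])

lemma L2_norm_chain:
  assumes "in_L2 M f" "in_L2 M g" "in_L2 M h"
  shows "L2_norm M (\<lambda>x. f x - h x) \<le> L2_norm M (\<lambda>x. f x - g x) + L2_norm M (\<lambda>x. g x - h x)"
  using L2_norm_triangle[OF in_L2_diff[OF assms(1,2)] in_L2_diff[OF assms(2,3)]]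
  by simp

lemma L2_norm_minus_commute: "L2_norm M (\<lambda>x. f x - g x) = L2_norm M (\<lambda>x. g x - f x)"
  by (simp add: L2_norm_def power2_commute)

lemma L2_norm_cong_AE:
  assumes "f \<in> borel_measurable M" "g \<in> borel_measurable M" "AE x in M. f x = g x"
  shows "L2_norm M f = L2_norm M g"
  unfolding L2_norm_def using assms by (intro arg_cong[where f = sqrt] integral_cong_AE) auto

lemma L2_norm_sum:
  "(\<And>i. i \<in> I \<Longrightarrow> in_L2 M (f i)) \<Longrightarrow>
    L2_norm M (\<lambda>x. \<Sum>i\<in>I. f i x) \<le> (\<Sum>i\<in>I. L2_norm M (f i))"
proof (induction I rule: infinite_finite_induct)
  case (insert i I)
  have "L2_norm M (\<lambda>x. f i x + (\<Sum>i\<in>I. f i x)) \<le> L2_norm M (f i) + L2_norm M (\<lambda>x. \<Sum>i\<in>I. f i x)"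
    using insert.prems by (intro L2_norm_triangle in_L2_sum) auto
  then show ?case using insert by (auto intro: order_trans)
qed (auto simp: L2_norm_def)

lemma (in finite_measure) in_L2_bounded:
  assumes "f \<in> borel_measurable M" "AE x in M. \<bar>f x\<bar> \<le> B"
  shows "in_L2 M f"
  unfolding in_L2_def
proof
  show "integrable M (\<lambda>x. (f x)\<^sup>2)"
  proof (rule integrable_const_bound[where B = "B\<^sup>2"])
    show "AE x in M. norm ((f x)\<^sup>2) \<le> B\<^sup>2"
      using assms(2) by eventually_elim (metis abs_ge_zero norm_power power_mono real_norm_def)
  qed (use assms in measurable)
qed fact

section \<open>The span of exponentials as a vector space of bounded functions\<close>

lemma expsum_cmult: "(\<lambda>x. c * expsum m d l x) = expsum m (\<lambda>i. c * d i) l"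
  by (auto simp: expsum_def sum_distrib_left mult_ac)

lemma sum_lessThan_add:
  fixes f :: "nat \<Rightarrow> 'a :: comm_monoid_add"
  shows "(\<Sum>i<m+p. f i) = (\<Sum>i<m. f i) + (\<Sum>j<p. f (m + j))"
  by (induction p) (auto simp: add.assoc)

lemma expsum_add:
  "(\<lambda>x. expsum m c l x + expsum p d k x)
    = expsum (m + p) (\<lambda>i. if i < m then c i else d (i - m)) (\<lambda>i. if i < m then l i else k (i - m))"
  by (auto simp: expsum_def sum_lessThan_add)

lemma expsum_in_F0: "\<forall>i<m. l i \<ge> 0 \<Longrightarrow> expsum m c l \<in> F0"
  unfolding F0_eq by blast

lemma F0_zero: "(\<lambda>x. 0) \<in> F0"
  using expsum_in_F0[of 0 undefined undefined] by (simp add: expsum_def[abs_def])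

lemma F0_cmult:
  assumes "f \<in> F0"
  shows "(\<lambda>x. c * f x) \<in> F0"
proof -
  obtain m d l where "f = expsum m d l" "\<forall>i<m. l i \<ge> 0" using assms by (auto simp: F0_eq)
  then show ?thesis by (simp add: expsum_cmult expsum_in_F0)
qed

lemma F0_add:
  assumes "f \<in> F0" "g \<in> F0"
  shows "(\<lambda>x. f x + g x) \<in> F0"
proof -
  obtain m c l p d k where "f = expsum m c l" "\<forall>i<m. l i \<ge> 0" "g = expsum p d k" "\<forall>j<p. k j \<ge> 0"
    using assms by (auto simp: F0_eq)
  moreover then have "\<forall>i<m+p. 0 \<le> (if i < m then l i else k (i - m))" by auto
  ultimately show ?thesis unfolding F0_eq using expsum_add by blast
qed

lemma F0_sum: "(\<And>i. i \<in> I \<Longrightarrow> f i \<in> F0) \<Longrightarrow> (\<lambda>x. \<Sum>i\<in>I. f i x) \<in> F0"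
proof (induction I rule: infinite_finite_induct)
  case (insert i I)
  then show ?case by (simp add: F0_add)
qed (auto simp: F0_zero)

lemma F0_exp: "l \<ge> 0 \<Longrightarrow> (\<lambda>x. exp (- l * x)) \<in> F0"
  using expsum_in_F0[of 1 "\<lambda>_. l" "\<lambda>_. 1"] by (simp add: expsum_def[abs_def])

lemma F0_measurable: "f \<in> F0 \<Longrightarrow> f \<in> borel_measurable borel"
  by (auto simp: F0_eq)

lemma F0_bounded: "f \<in> F0 \<Longrightarrow> \<exists>B. \<forall>x\<ge>0. \<bar>f x\<bar> \<le> B"
proof -
  assume "f \<in> F0"
  then obtain m c l where f: "f = expsum m c l" "\<forall>i<m. l i \<ge> 0" by (auto simp: F0_eq)
  have "\<bar>f x\<bar> \<le> (\<Sum>i<m. \<bar>c i\<bar>)" if "x \<ge> 0" for x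
    unfolding f expsum_def
    using f that by (intro order_trans[OF sum_abs sum_mono]) (auto simp: abs_mult mult_left_le)
  then show ?thesis by blast
qed

text \<open>Polynomials in \<open>exp (- x)\<close> approximate indicators of half-lines; this gives both uniqueness of
  Laplace transforms and density of \<^const>\<open>F0\<close>.\<close>

lemma exp_poly_approx_indicator:
  fixes a :: real
  obtains N :: "nat \<Rightarrow> nat" and c :: "nat \<Rightarrow> nat \<Rightarrow> real" where
    "\<And>k x. x \<ge> 0 \<Longrightarrow> \<bar>expsum (N k) (c k) real x\<bar> \<le> 2"
    "\<And>x. x \<ge> 0 \<Longrightarrow> (\<lambda>k. expsum (N k) (c k) real x) \<longlonglongrightarrow> indicator {..a} x"
proof -
  \<comment> \<open>A continuous ramp in the variable s = exp (- x): it is 1 for s \<ge> exp (- a),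
    that is for x \<le> a, and falls with slope k to 0 below. Weierstrass on [0, 1] replaces it by a
    polynomial.\<close>
  define r :: "nat \<Rightarrow> real \<Rightarrow> real" where "r k s = max 0 (min 1 (1 - real k * (exp (- a) - s)))" for k s
  have "\<exists>N c. \<forall>x\<ge>0. \<bar>r k (exp (- x)) - expsum N c real x\<bar> < inverse (Suc k)" for k
  proof -
    have "continuous_on {0..1} (r k)" unfolding r_def by (intro continuous_intros)
    then obtain g where g: "real_polynomial_function g"
        "\<And>s. s \<in> {0..1} \<Longrightarrow> \<bar>r k s - g s\<bar> < inverse (Suc k)"
      using Stone_Weierstrass_real_polynomial_function[OF compact_Icc, of 0 1 "r k" "inverse (Suc k)"]
      by auto
    obtain b n where gb: "g = (\<lambda>x. \<Sum>i\<le>n. b i * x ^ i)"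
      using g(1) real_polynomial_function_iff_sum by blast
    \<comment> \<open>The exponent sequence \<open>real\<close> turns an exponential sum into a
      polynomial in exp (- x); degree n means n + 1 terms.\<close>
    have "expsum (Suc n) b real x = g (exp (- x))" for x
      unfolding gb expsum_def lessThan_Suc_atMost by (simp add: exp_of_nat_mult[symmetric])
    then show ?thesis using g(2) by (intro exI[of _ "Suc n"] exI[of _ b]) auto
  qed
  then obtain N c where Nc: "\<And>k x. x \<ge> 0 \<Longrightarrow> \<bar>r k (exp (- x)) - expsum (N k) (c k) real x\<bar> < inverse (Suc k)"
    by metis
  show ?thesis
  proof
    fix k and x :: real assume x: "x \<ge> 0"
    have "inverse (real (Suc k)) \<le> 1" by (simp add: field_simps)
    moreover have "0 \<le> r k (exp (- x))" "r k (exp (- x)) \<le> 1" by (auto simp: r_def)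
    ultimately show "\<bar>expsum (N k) (c k) real x\<bar> \<le> 2" using Nc[OF x, of k] by linarith
  next
    fix x :: real assume x: "x \<ge> 0"
    have "(\<lambda>k. r k (exp (- x))) \<longlonglongrightarrow> indicator {..a} x"
    proof (cases "x \<le> a")
      case True
      then have "r k (exp (- x)) = 1" for k
        by (auto simp: r_def min_def max_def mult_nonneg_nonpos)
      then show ?thesis using True by simp
    next
      case False
      then have d: "exp (- a) - exp (- x) > 0" by simp
      obtain k0 :: nat where k0: "1 / (exp (- a) - exp (- x)) \<le> real k0" using real_arch_simple by blast
      have "r k (exp (- x)) = 0" if "k \<ge> k0" for k
      proof -
        have "1 / (exp (- a) - exp (- x)) \<le> real k" using k0 that by simp
        then have "1 \<le> real k * (exp (- a) - exp (- x))" using d by (simp add: field_simps)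
        then show ?thesis by (simp add: r_def)
      qed
      then have "\<forall>\<^sub>F k in sequentially. r k (exp (- x)) = 0" by (auto simp: eventually_sequentially)
      then show ?thesis using False by (simp add: tendsto_eventually)
    qed
    moreover have "(\<lambda>k. r k (exp (- x)) - expsum (N k) (c k) real x) \<longlonglongrightarrow> 0"
      by (rule Lim_null_comparison[OF _ LIMSEQ_inverse_real_of_nat])
         (use Nc[OF x] in \<open>auto intro!: always_eventually less_imp_le\<close>)
    ultimately have "(\<lambda>k. r k (exp (- x)) - (r k (exp (- x)) - expsum (N k) (c k) real x)) \<longlonglongrightarrow> indicator {..a} x - 0"
      by (rule tendsto_diff)
    then show "(\<lambda>k. expsum (N k) (c k) real x) \<longlonglongrightarrow> indicator {..a} x" by simp
  qed
qed

text \<open>Integer arguments suffice, since the approximants of half-line indicators use only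
  integer exponents; dominated convergence then identifies the distribution functions.\<close>

lemma laplace_unique:
  assumes M1: "real_distribution M1" and M2: "real_distribution M2"
    and pos1: "AE x in M1. 0 \<le> x" and pos2: "AE x in M2. 0 \<le> x"
    and eq: "\<And>i::nat. (\<integral>x. exp (- real i * x) \<partial>M1) = (\<integral>x. exp (- real i * x) \<partial>M2)"
  shows "M1 = M2"
proof (rule cdf_unique[OF M1 M2 ext])
  fix a
  obtain N c where Nc: "\<And>k x. x \<ge> 0 \<Longrightarrow> \<bar>expsum (N k) (c k) real x\<bar> \<le> 2"
    "\<And>x. x \<ge> 0 \<Longrightarrow> (\<lambda>k. expsum (N k) (c k) real x) \<longlonglongrightarrow> indicator {..a} x"
    using exp_poly_approx_indicator[of a] by blast
  have lim: "(\<lambda>k. \<integral>x. expsum (N k) (c k) real x \<partial>M) \<longlonglongrightarrow> cdf M a"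
    and expand: "(\<integral>x. expsum (N k) (c k) real x \<partial>M) = (\<Sum>i<N k. c k i * (\<integral>x. exp (- real i * x) \<partial>M))"
    if "real_distribution M" "AE x in M. 0 \<le> x" for M k
  proof -
    interpret real_distribution M by fact
    have "(\<lambda>k. \<integral>x. expsum (N k) (c k) real x \<partial>M) \<longlonglongrightarrow> (\<integral>x. indicator {..a} x \<partial>M)"
      by (rule integral_dominated_convergence[where w = "\<lambda>_. 2"])
         (use that(2) Nc in \<open>auto elim!: eventually_mono\<close>)
    then show "(\<lambda>k. \<integral>x. expsum (N k) (c k) real x \<partial>M) \<longlonglongrightarrow> cdf M a" by (simp add: cdf_def)
    have "integrable M (\<lambda>x. exp (- real i * x))" for i
      by (rule integrable_const_bound[where B = 1]) (use that(2) in auto)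
    then show "(\<integral>x. expsum (N k) (c k) real x \<partial>M) = (\<Sum>i<N k. c k i * (\<integral>x. exp (- real i * x) \<partial>M))"
      unfolding expsum_def by (subst Bochner_Integration.integral_sum) auto
  qed
  have "(\<lambda>k. \<integral>x. expsum (N k) (c k) real x \<partial>M1) \<longlonglongrightarrow> cdf M1 a" by (rule lim[OF M1 pos1])
  moreover have "(\<lambda>k. \<integral>x. expsum (N k) (c k) real x \<partial>M1) \<longlonglongrightarrow> cdf M2 a"
    using lim[OF M2 pos2] by (simp only: expand[OF M1 pos1] expand[OF M2 pos2] eq)
  ultimately show "cdf M1 a = cdf M2 a" by (rule LIMSEQ_unique)
qed

section \<open>Density of the span in the square-integrable functions\<close>

context
  fixes N :: "real measure"
  assumes N: "real_distribution N" and N_pos: "AE x in N. 0 \<le> x"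
begin

interpretation real_distribution N by (rule N)

text \<open>Membership in the L^2(N)-closure of \<open>F0\<close>.\<close>

definition F0_approx :: "(real \<Rightarrow> real) \<Rightarrow> bool" where
  "F0_approx f \<longleftrightarrow> in_L2 N f \<and> (\<forall>\<epsilon>>0. \<exists>g\<in>F0. L2_norm N (\<lambda>x. f x - g x) < \<epsilon>)"

lemma F0_in_L2:
  assumes "f \<in> F0"
  shows "in_L2 N f"
proof -
  obtain B where "\<forall>x\<ge>0. \<bar>f x\<bar> \<le> B" using F0_bounded[OF assms] by blast
  then show ?thesis
    using F0_measurable[OF assms] N_pos by (intro in_L2_bounded[of f B]) (auto elim!: eventually_mono)
qed

lemma F0_approx_F0: "f \<in> F0 \<Longrightarrow> F0_approx f"
  unfolding F0_approx_def using F0_in_L2 by (auto simp: L2_norm_def intro!: bexI[of _ f])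

lemma F0_approx_closed:
  assumes f: "in_L2 N f"
    and appr: "\<And>\<epsilon>. \<epsilon> > 0 \<Longrightarrow> \<exists>h. F0_approx h \<and> L2_norm N (\<lambda>x. f x - h x) < \<epsilon>"
  shows "F0_approx f"
  unfolding F0_approx_def
proof (intro conjI f allI impI)
  fix \<epsilon> :: real assume "\<epsilon> > 0"
  then obtain h where h: "F0_approx h" "L2_norm N (\<lambda>x. f x - h x) < \<epsilon> / 2" using appr[of "\<epsilon> / 2"] by auto
  then obtain g where g: "g \<in> F0" "L2_norm N (\<lambda>x. h x - g x) < \<epsilon> / 2"
    using \<open>\<epsilon> > 0\<close> unfolding F0_approx_def by (meson half_gt_zero)
  have "L2_norm N (\<lambda>x. f x - g x) \<le> L2_norm N (\<lambda>x. f x - h x) + L2_norm N (\<lambda>x. h x - g x)"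
    using f h g F0_in_L2 by (intro L2_norm_chain) (auto simp: F0_approx_def)
  then show "\<exists>g\<in>F0. L2_norm N (\<lambda>x. f x - g x) < \<epsilon>" using g h by (intro bexI[of _ g]) auto
qed

lemma F0_approx_add:
  assumes f: "F0_approx f" and g: "F0_approx g"
  shows "F0_approx (\<lambda>x. f x + g x)"
  unfolding F0_approx_def
proof (intro conjI allI impI)
  show "in_L2 N (\<lambda>x. f x + g x)"
    using assms by (intro in_L2_add) (auto simp: F0_approx_def)
  fix \<epsilon> :: real assume "\<epsilon> > 0"
  then obtain f' g' where f': "f' \<in> F0" "L2_norm N (\<lambda>x. f x - f' x) < \<epsilon> / 2"
    and g': "g' \<in> F0" "L2_norm N (\<lambda>x. g x - g' x) < \<epsilon> / 2"
    using assms unfolding F0_approx_def by (meson half_gt_zero)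
  have "L2_norm N (\<lambda>x. (f x - f' x) + (g x - g' x)) \<le> L2_norm N (\<lambda>x. f x - f' x) + L2_norm N (\<lambda>x. g x - g' x)"
    using assms f' g' F0_in_L2
    by (intro L2_norm_triangle in_L2_diff) (auto simp: F0_approx_def)
  then show "\<exists>h\<in>F0. L2_norm N (\<lambda>x. f x + g x - h x) < \<epsilon>"
    using f' g' by (intro bexI[of _ "\<lambda>x. f' x + g' x"] F0_add) (auto simp: algebra_simps)
qed

lemma F0_approx_cmult:
  assumes f: "F0_approx f"
  shows "F0_approx (\<lambda>x. c * f x)"
proof (cases "c = 0")
  case True
  then show ?thesis using F0_approx_F0[OF F0_zero] by simp
next
  case False
  show ?thesis
    unfolding F0_approx_def
  proof (intro conjI allI impI)
    show "in_L2 N (\<lambda>x. c * f x)"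
      using f by (intro in_L2_cmult) (auto simp: F0_approx_def)
    fix \<epsilon> :: real assume "\<epsilon> > 0"
    then obtain g where g: "g \<in> F0" "L2_norm N (\<lambda>x. f x - g x) < \<epsilon> / \<bar>c\<bar>"
      using f False unfolding F0_approx_def by (meson divide_pos_pos zero_less_abs_iff)
    have "L2_norm N (\<lambda>x. c * f x - c * g x) = \<bar>c\<bar> * L2_norm N (\<lambda>x. f x - g x)"
      using L2_norm_cmult[of N c "\<lambda>x. f x - g x"] by (simp add: right_diff_distrib)
    also have "\<dots> < \<epsilon>" using g(2) False by (simp add: field_simps)
    finally show "\<exists>h\<in>F0. L2_norm N (\<lambda>x. c * f x - h x) < \<epsilon>"
      using g(1) by (intro bexI[of _ "\<lambda>x. c * g x"] F0_cmult)
  qed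
qed

lemma F0_approx_sum:
  "(\<And>i. i \<in> I \<Longrightarrow> F0_approx (f i)) \<Longrightarrow> F0_approx (\<lambda>x. \<Sum>i\<in>I. f i x)"
proof (induction I rule: infinite_finite_induct)
  case (insert i I)
  then show ?case by (simp add: F0_approx_add)
qed (use F0_sum[of "{}"] in \<open>auto intro!: F0_approx_F0\<close>)

lemma F0_approx_limit:
  assumes f: "in_L2 N f" and w: "integrable N w"
    and s: "\<And>k. F0_approx (s k)"
    and lim: "AE x in N. (\<lambda>k. s k x) \<longlonglongrightarrow> f x"
    and bound: "\<And>k. AE x in N. (f x - s k x)\<^sup>2 \<le> w x"
  shows "F0_approx f"
proof (rule F0_approx_closed[OF f])
  have [measurable]: "f \<in> borel_measurable N" "\<And>k. s k \<in> borel_measurable N"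
    using f s by (auto simp: F0_approx_def in_L2_def)
  have "(\<lambda>k. \<integral>x. (f x - s k x)\<^sup>2 \<partial>N) \<longlonglongrightarrow> (\<integral>x. 0 \<partial>N)"
  proof (rule integral_dominated_convergence[OF _ _ w])
    show "AE x in N. (\<lambda>k. (f x - s k x)\<^sup>2) \<longlonglongrightarrow> 0"
      using lim
    proof eventually_elim
      fix x assume "(\<lambda>k. s k x) \<longlonglongrightarrow> f x"
      then have "(\<lambda>k. (f x - s k x)\<^sup>2) \<longlonglongrightarrow> (f x - f x)\<^sup>2" by (intro tendsto_intros)
      then show "(\<lambda>k. (f x - s k x)\<^sup>2) \<longlonglongrightarrow> 0" by simp
    qed
    show "AE x in N. norm ((f x - s k x)\<^sup>2) \<le> w x" for k using bound[of k] by simp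
  qed auto
  then have "(\<lambda>k. L2_norm N (\<lambda>x. f x - s k x)) \<longlonglongrightarrow> sqrt 0"
    unfolding L2_norm_def by (intro tendsto_real_sqrt) simp
  moreover fix \<epsilon> :: real assume "\<epsilon> > 0"
  ultimately have "\<forall>\<^sub>F k in sequentially. L2_norm N (\<lambda>x. f x - s k x) < \<epsilon>"
    by (intro order_tendstoD) auto
  then obtain k where "L2_norm N (\<lambda>x. f x - s k x) < \<epsilon>"
    by (auto simp: eventually_sequentially)
  then show "\<exists>h. F0_approx h \<and> L2_norm N (\<lambda>x. f x - h x) < \<epsilon>" using s by blast
qed

text \<open>A pi-lambda argument starting from half-lines. Complements work because the constant 1
  is the exponential with exponent 0, and countable disjoint unions because partial sums converge
  boundedly.\<close>

lemma F0_approx_indicator: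
  assumes "A \<in> sets borel"
  shows "F0_approx (indicator A)"
proof -
  have sq: "in_L2 N (indicator A :: real \<Rightarrow> real)" if "A \<in> sets borel" for A
    using that by (intro in_L2_bounded[where B = 1]) (auto simp: indicator_def)
  have stable: "Int_stable (range (\<lambda>a::real. {..a}))"
    by (auto simp: Int_stable_def)
  have sub: "range (\<lambda>a::real. {..a}) \<subseteq> Pow UNIV" by auto
  have "A \<in> sigma_sets UNIV (range (\<lambda>a::real. {..a}))"
    using assms unfolding borel_eq_atMost[where 'a = real] by simp
  from stable sub this show ?thesis
  proof (induction rule: sigma_sets_induct_disjoint)
    case (basic A)
    then obtain a where A: "A = {..a}" by auto
    obtain M c where Nc: "\<And>k x. x \<ge> 0 \<Longrightarrow> \<bar>expsum (M k) (c k) real x\<bar> \<le> 2"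
      "\<And>x. x \<ge> 0 \<Longrightarrow> (\<lambda>k. expsum (M k) (c k) real x) \<longlonglongrightarrow> indicator {..a} x"
      using exp_poly_approx_indicator[of a] by blast
    show ?case
      unfolding A
    \<comment> \<open>9 = (1 + 2)^2, as the indicator is at most 1 and the approximants at most 2 in
      absolute value.\<close>
    proof (rule F0_approx_limit[where w = "\<lambda>_. 9" and s = "\<lambda>k. expsum (M k) (c k) real"])
      show "AE x in N. (indicator {..a} x - expsum (M k) (c k) real x)\<^sup>2 \<le> 9" for k
        using N_pos
      proof eventually_elim
        fix x :: real assume "0 \<le> x"
        then have "\<bar>indicator {..a} x - expsum (M k) (c k) real x\<bar> \<le> 3"
          using Nc(1)[of x k] by (auto simp: indicator_def)
        then have "\<bar>indicator {..a} x - expsum (M k) (c k) real x\<bar>\<^sup>2 \<le> 3\<^sup>2"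
          by (intro power_mono) auto
        then show "(indicator {..a} x - expsum (M k) (c k) real x)\<^sup>2 \<le> 9" by simp
      qed
      show "AE x in N. (\<lambda>k. expsum (M k) (c k) real x) \<longlonglongrightarrow> indicator {..a} x"
        using N_pos by eventually_elim (rule Nc)
      show "F0_approx (expsum (M k) (c k) real)" for k
        by (intro F0_approx_F0 expsum_in_F0) simp
    qed (auto intro!: sq)
  next
    case empty
    then show ?case using F0_approx_cmult[OF F0_approx_F0[OF F0_exp[of 0]], of 0]
      by (simp add: indicator_def[abs_def])
  next
    case (compl A)
    have "F0_approx (\<lambda>x. exp (- 0 * x) + (-1) * indicator A x)"
      by (intro F0_approx_add F0_approx_cmult F0_approx_F0 F0_exp compl) simp
    moreover have "(\<lambda>x. exp (- 0 * x) + (-1) * indicator A x) = (indicator (UNIV - A) :: real \<Rightarrow> real)"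
      by (auto simp: indicator_def)
    ultimately show ?case by simp
  next
    case (union A)
    have meas: "A i \<in> sets borel" for i
      using union(2) unfolding borel_eq_atMost[where 'a = real] by (auto simp: image_subset_iff)
    have part: "(\<Sum>i<k. indicator (A i) x) = (indicator (\<Union>i<k. A i) x :: real)" for k x
      using union(1) by (intro indicator_UN_disjoint[symmetric]) (auto simp: disjoint_family_on_def)
    show ?case
    proof (rule F0_approx_limit[where w = "\<lambda>_. 1" and s = "\<lambda>k x. \<Sum>i<k. indicator (A i) x"])
      show "F0_approx (\<lambda>x. \<Sum>i<k. indicator (A i) x)" for k
        by (intro F0_approx_sum union)
      show "AE x in N. (\<lambda>k. \<Sum>i<k. indicator (A i) x) \<longlonglongrightarrow> (indicator (\<Union>i. A i) x :: real)"
        unfolding part by (intro AE_I2 LIMSEQ_indicator_UN)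
      show "AE x in N. (indicator (\<Union>i. A i) x - (\<Sum>i<k. indicator (A i) x))\<^sup>2 \<le> (1::real)" for k
        unfolding part by (intro AE_I2) (auto simp: indicator_def)
    qed (use meas in \<open>auto intro!: sq\<close>)
  qed
qed

text \<open>A simple function is a finite combination of indicators. The approximating sequence
  satisfies |s| \<le> 2 |f|, so 9 f^2 dominates the squared errors.\<close>

lemma F0_dense:
  assumes f: "in_L2 N f" and \<epsilon>: "\<epsilon> > 0"
  shows "\<exists>g\<in>F0. L2_norm N (\<lambda>x. f x - g x) < \<epsilon>"
proof -
  have fm: "f \<in> borel_measurable N" and f2: "integrable N (\<lambda>x. (f x)\<^sup>2)"
    using f by (auto simp: in_L2_def)
  obtain s where s: "\<And>i. simple_function N (s i)" "\<And>x. x \<in> space N \<Longrightarrow> (\<lambda>i. s i x) \<longlonglongrightarrow> f x"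
    "\<And>i x. x \<in> space N \<Longrightarrow> \<bar>s i x\<bar> \<le> 2 * \<bar>f x\<bar>"
    using borel_measurable_implies_sequence_metric[OF fm, of 0] by (auto simp: dist_norm)
  have "F0_approx f"
  proof (rule F0_approx_limit[OF f, where w = "\<lambda>x. 9 * (f x)\<^sup>2" and s = s])
    show "integrable N (\<lambda>x. 9 * (f x)\<^sup>2)" using f2 by simp
    show "AE x in N. (\<lambda>k. s k x) \<longlonglongrightarrow> f x" using s(2) by auto
    show "AE x in N. (f x - s k x)\<^sup>2 \<le> 9 * (f x)\<^sup>2" for k
    proof (rule AE_I2)
      fix x assume "x \<in> space N"
      then have "\<bar>f x - s k x\<bar> \<le> 3 * \<bar>f x\<bar>" using s(3)[of x k] by linarith
      then have "\<bar>f x - s k x\<bar>\<^sup>2 \<le> (3 * \<bar>f x\<bar>)\<^sup>2" by (intro power_mono) auto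
      then show "(f x - s k x)\<^sup>2 \<le> 9 * (f x)\<^sup>2" by (simp add: power_mult_distrib)
    qed
    fix k
    have "F0_approx (\<lambda>x. \<Sum>y\<in>s k ` space N. y * indicator (s k -` {y}) x)"
    proof (intro F0_approx_sum F0_approx_cmult F0_approx_indicator)
      fix y assume "y \<in> s k ` space N"
      then show "s k -` {y} \<in> sets borel"
        using simple_functionD(2)[OF s(1)[of k], of "{y}"] by simp
    qed
    also have "(\<lambda>x. \<Sum>y\<in>s k ` space N. y * indicator (s k -` {y}) x) = s k"
    proof
      fix x
      have "(\<Sum>y\<in>s k ` space N. y * indicator (s k -` {y}) x) = (\<Sum>y\<in>s k ` space N. if y = s k x then y else 0)"
        by (intro sum.cong) (auto simp: indicator_def)
      also have "\<dots> = s k x"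
        using simple_functionD(1)[OF s(1)[of k]] by (simp add: sum.delta')
      finally show "(\<Sum>y\<in>s k ` space N. y * indicator (s k -` {y}) x) = s k x" .
    qed
    finally show "F0_approx (s k)" .
  qed
  then show ?thesis using \<epsilon> by (simp add: F0_approx_def)
qed

end

section \<open>Cores of generators of stationary Markov semigroups\<close>

lemma tendsto_integral_mult_L2:
  assumes sq: "in_L2 M f" "in_L2 M g"
      "\<And>n. in_L2 M (u n)" "\<And>n. in_L2 M (w n)"
    and lim: "((\<lambda>n. L2_norm M (\<lambda>x. u n x - f x)) \<longlongrightarrow> 0) F" "((\<lambda>n. L2_norm M (\<lambda>x. w n x - g x)) \<longlongrightarrow> 0) F"
  shows "((\<lambda>n. \<integral>x. u n x * w n x \<partial>M) \<longlongrightarrow> (\<integral>x. f x * g x \<partial>M)) F"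
proof -
  let ?\<epsilon> = "\<lambda>n. L2_norm M (\<lambda>x. u n x - f x)" and ?\<eta> = "\<lambda>n. L2_norm M (\<lambda>x. w n x - g x)"
  have bound: "\<bar>(\<integral>x. u n x * w n x \<partial>M) - (\<integral>x. f x * g x \<partial>M)\<bar>
      \<le> ?\<epsilon> n * ?\<eta> n + ?\<epsilon> n * L2_norm M g + L2_norm M f * ?\<eta> n" for n
  proof -
    note d = in_L2_diff[OF sq(3)[of n] sq(1)] in_L2_diff[OF sq(4)[of n] sq(2)]
    note i = in_L2_mult[OF d] in_L2_mult[OF d(1) sq(2)] in_L2_mult[OF sq(1) d(2)]
    have "(\<integral>x. u n x * w n x \<partial>M) - (\<integral>x. f x * g x \<partial>M) = (\<integral>x. u n x * w n x - f x * g x \<partial>M)"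
      using sq by (simp add: in_L2_mult)
    also have "\<dots> = (\<integral>x. (u n x - f x) * (w n x - g x) + (u n x - f x) * g x + f x * (w n x - g x) \<partial>M)"
      by (rule arg_cong[where f = "integral\<^sup>L M"]) (auto simp: algebra_simps)
    also have "\<dots> = (\<integral>x. (u n x - f x) * (w n x - g x) \<partial>M) + (\<integral>x. (u n x - f x) * g x \<partial>M)
        + (\<integral>x. f x * (w n x - g x) \<partial>M)"
      using i by simp
    finally show ?thesis
      using L2_Cauchy_Schwarz[OF d] L2_Cauchy_Schwarz[OF d(1) sq(2)] L2_Cauchy_Schwarz[OF sq(1) d(2)]
      by linarith
  qed
  have "((\<lambda>n. ?\<epsilon> n * ?\<eta> n + ?\<epsilon> n * L2_norm M g + L2_norm M f * ?\<eta> n) \<longlongrightarrow> 0) F"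
    using lim by (auto intro!: tendsto_eq_intros)
  then have "((\<lambda>n. (\<integral>x. u n x * w n x \<partial>M) - (\<integral>x. f x * g x \<partial>M)) \<longlongrightarrow> 0) F"
    by (rule Lim_null_comparison[rotated]) (auto intro!: always_eventually bound)
  then show ?thesis by (simp add: LIM_zero_iff)
qed

text \<open>Measurability of the kernels and invariance of \<open>N\<close> already make the
  operators contractions of L^2(N). The semigroup law enters later, and only on a core.\<close>

locale stationary_kernel =
  fixes K :: "real \<Rightarrow> real \<Rightarrow> real measure" and N :: "real measure"
  assumes N: "real_distribution N"
    and kernel: "\<And>t. t \<ge> 0 \<Longrightarrow> K t \<in> borel \<rightarrow>\<^sub>M prob_algebra borel"
    and stationary: "\<And>t. t \<ge> 0 \<Longrightarrow> N \<bind> K t = N"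

sublocale stationary_kernel \<subseteq> real_distribution N
  by (rule N)

context stationary_kernel
begin

definition P :: "real \<Rightarrow> (real \<Rightarrow> real) \<Rightarrow> real \<Rightarrow> real" where
  "P t f x = (\<integral>y. f y \<partial>K t x)"

lemma kernel_subprob [measurable (raw)]: "t \<ge> 0 \<Longrightarrow> K t \<in> borel \<rightarrow>\<^sub>M subprob_algebra borel"
  by (intro measurable_prob_algebraD kernel)

lemma prob_K: "t \<ge> 0 \<Longrightarrow> prob_space (K t x)" and sets_K: "t \<ge> 0 \<Longrightarrow> sets (K t x) = sets borel"
  using measurable_space[OF kernel, of t x] by (auto simp: space_prob_algebra)

lemma measurable_N: "borel_measurable N = borel_measurable borel"
  by (intro measurable_cong_sets) simp_all

lemma measurable_P [measurable]:
  assumes t: "t \<ge> 0" and f: "f \<in> borel_measurable borel"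
  shows "P t f \<in> borel_measurable borel"
  unfolding P_def[abs_def] using integral_measurable_subprob_algebra[OF f] kernel_subprob[OF t]
  by (rule measurable_compose[rotated])

lemma nn_integral_P:
  assumes t: "t \<ge> 0" and F: "F \<in> borel_measurable borel"
  shows "(\<integral>\<^sup>+ x. \<integral>\<^sup>+ y. F y \<partial>K t x \<partial>N) = (\<integral>\<^sup>+ x. F x \<partial>N)"
proof -
  have "K t \<in> N \<rightarrow>\<^sub>M subprob_algebra borel" using kernel_subprob[OF t] by (simp cong: measurable_cong_sets)
  then show ?thesis using nn_integral_bind[OF F, of "K t" N] stationary[OF t] by simp
qed

text \<open>By stationarity the iterated integral of |f| equals its \<open>N\<close>-integral. Where
  f fails to be \<open>K t x\<close>-integrable, \<open>P t f x\<close> is the default 0, so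
  linearity of \<open>P\<close> is available only almost everywhere.\<close>

lemma AE_K_integrable:
  fixes f :: "real \<Rightarrow> real"
  assumes t: "t \<ge> 0" and f: "integrable N f"
  shows "AE x in N. integrable (K t x) f"
proof -
  have fm [measurable]: "f \<in> borel_measurable borel" using f measurable_N by auto
  have "(\<integral>\<^sup>+ x. \<integral>\<^sup>+ y. ennreal (norm (f y)) \<partial>K t x \<partial>N) = (\<integral>\<^sup>+ x. ennreal (norm (f x)) \<partial>N)"
    by (rule nn_integral_P[OF t]) measurable
  then have "(\<integral>\<^sup>+ x. \<integral>\<^sup>+ y. ennreal (norm (f y)) \<partial>K t x \<partial>N) < \<infinity>"
    using f by (simp only: integrable_iff_bounded)
  moreover have "(\<lambda>x. \<integral>\<^sup>+ y. ennreal (norm (f y)) \<partial>K t x) \<in> borel_measurable N"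
    unfolding measurable_N
    by (rule measurable_compose[OF kernel_subprob[OF t] nn_integral_measurable_subprob_algebra]) measurable
  ultimately have "AE x in N. (\<integral>\<^sup>+ y. ennreal (norm (f y)) \<partial>K t x) \<noteq> \<infinity>"
    by (intro nn_integral_noteq_infinite) auto
  then show ?thesis
  proof eventually_elim
    fix x assume "(\<integral>\<^sup>+ y. ennreal (norm (f y)) \<partial>K t x) \<noteq> \<infinity>"
    moreover have "f \<in> borel_measurable (K t x)"
      using fm sets_K[OF t] by (simp cong: measurable_cong_sets)
    ultimately show "integrable (K t x) f" by (simp add: integrable_iff_bounded less_top)
  qed
qed

lemma in_L2_integrable: "in_L2 N f \<Longrightarrow> integrable N f"
  using in_L2_mult[of N f "\<lambda>_. 1"] by (simp add: in_L2_def)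

text \<open>Cauchy-Schwarz against the constant 1 under each probability \<open>K t x\<close>, then
  stationarity.\<close>

lemma
  assumes t: "t \<ge> 0" and f: "in_L2 N f"
  shows in_L2_P: "in_L2 N (P t f)"
    and L2_norm_P: "L2_norm N (P t f) \<le> L2_norm N f"
proof -
  have fm [measurable]: "f \<in> borel_measurable borel" and f2: "integrable N (\<lambda>x. (f x)\<^sup>2)"
    using f measurable_N by (auto simp: in_L2_def)
  have "(\<integral>\<^sup>+ x. ennreal ((P t f x)\<^sup>2) \<partial>N) \<le> (\<integral>\<^sup>+ x. \<integral>\<^sup>+ y. ennreal ((f y)\<^sup>2) \<partial>K t x \<partial>N)"
  proof (rule nn_integral_mono_AE)
    show "AE x in N. ennreal ((P t f x)\<^sup>2) \<le> (\<integral>\<^sup>+ y. ennreal ((f y)\<^sup>2) \<partial>K t x)"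
      using AE_K_integrable[OF t f2]
    proof eventually_elim
      fix x assume i: "integrable (K t x) (\<lambda>y. (f y)\<^sup>2)"
      interpret Kx: prob_space "K t x" by (rule prob_K[OF t])
      have "f \<in> borel_measurable (K t x)"
        using fm sets_K[OF t] by (simp cong: measurable_cong_sets)
      then have "(P t f x)\<^sup>2 \<le> (\<integral>y. (f y)\<^sup>2 \<partial>K t x)"
        using integral_Cauchy_Schwarz[of f "K t x" "\<lambda>_. 1"] i by (simp add: P_def Kx.prob_space)
      then show "ennreal ((P t f x)\<^sup>2) \<le> (\<integral>\<^sup>+ y. ennreal ((f y)\<^sup>2) \<partial>K t x)"
        using i by (simp add: nn_integral_eq_integral ennreal_leI)
    qed
  qed
  also have "\<dots> = (\<integral>\<^sup>+ x. ennreal ((f x)\<^sup>2) \<partial>N)" by (rule nn_integral_P[OF t]) measurable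
  also have "\<dots> = ennreal (\<integral>x. (f x)\<^sup>2 \<partial>N)" using f2 by (intro nn_integral_eq_integral) auto
  finally have le: "(\<integral>\<^sup>+ x. ennreal ((P t f x)\<^sup>2) \<partial>N) \<le> ennreal (\<integral>x. (f x)\<^sup>2 \<partial>N)" .
  have Pm: "P t f \<in> borel_measurable N" unfolding measurable_N by (rule measurable_P[OF t fm])
  have int: "integrable N (\<lambda>x. (P t f x)\<^sup>2)"
  proof (rule integrableI_bounded)
    show "(\<integral>\<^sup>+ x. ennreal (norm ((P t f x)\<^sup>2)) \<partial>N) < \<infinity>"
      using le_less_trans[OF le] by simp
  qed (use Pm in measurable)
  then show "in_L2 N (P t f)" using Pm by (simp add: in_L2_def)
  have "ennreal (\<integral>x. (P t f x)\<^sup>2 \<partial>N) \<le> ennreal (\<integral>x. (f x)\<^sup>2 \<partial>N)"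
    using le int by (simp add: nn_integral_eq_integral)
  then show "L2_norm N (P t f) \<le> L2_norm N f" by (simp add: L2_norm_def)
qed

lemma P_add:
  assumes t: "t \<ge> 0" and "in_L2 N f" "in_L2 N g"
  shows "AE x in N. P t (\<lambda>x. f x + g x) x = P t f x + P t g x"
  using AE_K_integrable[OF t in_L2_integrable[OF assms(2)]]
    AE_K_integrable[OF t in_L2_integrable[OF assms(3)]]
  by eventually_elim (simp add: P_def)

lemma P_cmult: "P t (\<lambda>x. c * f x) x = c * P t f x"
  by (simp add: P_def)

lemma P_diff:
  assumes t: "t \<ge> 0" and "in_L2 N f" "in_L2 N g"
  shows "AE x in N. P t (\<lambda>x. f x - g x) x = P t f x - P t g x"
  using P_add[OF t assms(2) in_L2_cmult[OF assms(3), of "-1"]]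
  by (simp add: P_cmult[of t "-1" g, simplified])

text \<open>By stationarity an \<open>N\<close>-null set is \<open>K t x\<close>-null for
  \<open>N\<close>-almost every x.\<close>

lemma P_cong_AE:
  assumes t: "t \<ge> 0" and m: "f \<in> borel_measurable borel" "g \<in> borel_measurable borel"
    and eq: "AE x in N. f x = g x"
  shows "AE x in N. P t f x = P t g x"
proof -
  note [measurable] = m
  have "K t \<in> N \<rightarrow>\<^sub>M subprob_algebra borel" using kernel_subprob[OF t] by (simp cong: measurable_cong_sets)
  moreover have "Measurable.pred borel (\<lambda>x. f x = g x)" by measurable
  ultimately have "AE x in N. AE y in K t x. f y = g y"
    using eq AE_bind[of "K t" N borel "\<lambda>x. f x = g x"] by (simp only: stationary[OF t])
  then show ?thesis
  proof eventually_elim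
    fix x assume "AE y in K t x. f y = g y"
    then show "P t f x = P t g x"
      unfolding P_def using m sets_K[OF t, of x] by (intro integral_cong_AE) (simp_all cong: measurable_cong_sets)
  qed
qed

section \<open>The generator as a limit of difference quotients\<close>

definition quotient :: "real \<Rightarrow> (real \<Rightarrow> real) \<Rightarrow> real \<Rightarrow> real" where
  "quotient t f x = (P t f x - f x) / t"

lemma in_L2_quotient:
  assumes t: "t \<ge> 0" and f: "in_L2 N f"
  shows "in_L2 N (quotient t f)"
  using in_L2_cmult[OF in_L2_diff[OF in_L2_P[OF t f] f], of "1 / t"]
  by (simp add: quotient_def[abs_def])

lemma L2_generator_iff:
  "L2_generator K N f h \<longleftrightarrow> in_L2 N f \<and> in_L2 N h \<and>
     ((\<lambda>t. L2_norm N (\<lambda>x. quotient t f x - h x)) \<longlongrightarrow> 0) (at_right 0)"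
proof -
  have "\<forall>\<^sub>F t in at_right 0. integrable N (\<lambda>x. (quotient t f x - h x)\<^sup>2)"
    if "in_L2 N f" "in_L2 N h"
    using eventually_at_right_less
  proof eventually_elim
    case (elim t)
    then show ?case
      using in_L2_diff[OF in_L2_quotient[of t f] that(2)] that(1)
      by (simp add: in_L2_def)
  qed
  moreover have "((\<lambda>t. \<integral>x. (quotient t f x - h x)\<^sup>2 \<partial>N) \<longlongrightarrow> 0) (at_right 0) \<longleftrightarrow>
     ((\<lambda>t. L2_norm N (\<lambda>x. quotient t f x - h x)) \<longlongrightarrow> 0) (at_right 0)"
  proof
    assume "((\<lambda>t. \<integral>x. (quotient t f x - h x)\<^sup>2 \<partial>N) \<longlongrightarrow> 0) (at_right 0)"
    from tendsto_real_sqrt[OF this]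
    show "((\<lambda>t. L2_norm N (\<lambda>x. quotient t f x - h x)) \<longlongrightarrow> 0) (at_right 0)"
      by (simp add: L2_norm_def)
  next
    assume "((\<lambda>t. L2_norm N (\<lambda>x. quotient t f x - h x)) \<longlongrightarrow> 0) (at_right 0)"
    from tendsto_power[OF this, of 2]
    show "((\<lambda>t. \<integral>x. (quotient t f x - h x)\<^sup>2 \<partial>N) \<longlongrightarrow> 0) (at_right 0)"
      by (simp add: L2_norm_square)
  qed
  ultimately show ?thesis
    unfolding L2_generator_def quotient_def P_def in_L2_def measurable_N by blast
qed

lemma L2_generator_add:
  assumes "L2_generator K N f h" "L2_generator K N u w"
  shows "L2_generator K N (\<lambda>x. f x + u x) (\<lambda>x. h x + w x)"
proof -
  have sq: "in_L2 N f" "in_L2 N h" "in_L2 N u" "in_L2 N w"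
    and lim: "((\<lambda>t. L2_norm N (\<lambda>x. quotient t f x - h x)) \<longlongrightarrow> 0) (at_right 0)"
      "((\<lambda>t. L2_norm N (\<lambda>x. quotient t u x - w x)) \<longlongrightarrow> 0) (at_right 0)"
    using assms by (auto simp: L2_generator_iff)
  have "\<forall>\<^sub>F t in at_right 0. norm (L2_norm N (\<lambda>x. quotient t (\<lambda>x. f x + u x) x - (h x + w x)))
      \<le> L2_norm N (\<lambda>x. quotient t f x - h x) + L2_norm N (\<lambda>x. quotient t u x - w x)"
    using eventually_at_right_less
  proof eventually_elim
    case (elim t)
    then have t: "t \<ge> 0" by simp
    note d = in_L2_diff[OF in_L2_quotient[OF t sq(1)] sq(2)]
      in_L2_diff[OF in_L2_quotient[OF t sq(3)] sq(4)]
      in_L2_diff[OF in_L2_quotient[OF t in_L2_add[OF sq(1,3)]]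
        in_L2_add[OF sq(2,4)]]
    have "AE x in N. quotient t (\<lambda>x. f x + u x) x - (h x + w x) = (quotient t f x - h x) + (quotient t u x - w x)"
      using P_add[OF t sq(1,3)] by eventually_elim (simp add: quotient_def add_divide_distrib diff_divide_distrib)
    then have "L2_norm N (\<lambda>x. quotient t (\<lambda>x. f x + u x) x - (h x + w x))
        = L2_norm N (\<lambda>x. (quotient t f x - h x) + (quotient t u x - w x))"
      using d in_L2_add[OF d(1,2)] by (intro L2_norm_cong_AE) (auto simp: in_L2_def)
    then show ?case using L2_norm_triangle[OF d(1,2)] by simp
  qed
  moreover have "((\<lambda>t. L2_norm N (\<lambda>x. quotient t f x - h x) + L2_norm N (\<lambda>x. quotient t u x - w x)) \<longlongrightarrow> 0) (at_right 0)"
    using tendsto_add[OF lim] by simp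
  ultimately have "((\<lambda>t. L2_norm N (\<lambda>x. quotient t (\<lambda>x. f x + u x) x - (h x + w x))) \<longlongrightarrow> 0) (at_right 0)"
    by (rule Lim_null_comparison)
  then show ?thesis using sq by (auto simp: L2_generator_iff in_L2_add)
qed

lemma L2_generator_cmult:
  assumes "L2_generator K N f h"
  shows "L2_generator K N (\<lambda>x. c * f x) (\<lambda>x. c * h x)"
proof -
  have "(\<lambda>x. quotient t (\<lambda>x. c * f x) x - c * h x) = (\<lambda>x. c * (quotient t f x - h x))" for t
    by (simp add: quotient_def P_cmult algebra_simps diff_divide_distrib)
  then have "L2_norm N (\<lambda>x. quotient t (\<lambda>x. c * f x) x - c * h x) = \<bar>c\<bar> * L2_norm N (\<lambda>x. quotient t f x - h x)" for t
    by (simp only: L2_norm_cmult)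
  then show ?thesis
    using assms tendsto_mult[OF tendsto_const[of "\<bar>c\<bar>"]]
    by (fastforce simp: L2_generator_iff in_L2_cmult)
qed

lemma L2_generator_diff:
  assumes "L2_generator K N f h" "L2_generator K N u w"
  shows "L2_generator K N (\<lambda>x. f x - u x) (\<lambda>x. h x - w x)"
  using L2_generator_add[OF assms(1) L2_generator_cmult[OF assms(2), of "-1"]] by simp

text \<open>Contractivity bounds the inner product of P t f with f by that of f with itself, so the
  difference quotients pair nonpositively with f; the sign survives the limit.\<close>

lemma L2_generator_dissipative:
  assumes "L2_generator K N f h"
  shows "(\<integral>x. h x * f x \<partial>N) \<le> 0"
proof -
  have sq: "in_L2 N f" "in_L2 N h"
    and lim: "((\<lambda>t. L2_norm N (\<lambda>x. quotient t f x - h x)) \<longlongrightarrow> 0) (at_right 0)"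
    using assms by (auto simp: L2_generator_iff)
  have nonpos: "(\<integral>x. quotient t f x * f x \<partial>N) \<le> 0" if "t > 0" for t
  proof -
    have t: "t \<ge> 0" using that by simp
    have "(\<integral>x. P t f x * f x \<partial>N) \<le> L2_norm N (P t f) * L2_norm N f"
      using L2_Cauchy_Schwarz[OF in_L2_P[OF t sq(1)] sq(1)] by linarith
    also have "\<dots> \<le> L2_norm N f * L2_norm N f"
      by (intro mult_right_mono L2_norm_P[OF t sq(1)]) simp
    also have "\<dots> = (\<integral>x. f x * f x \<partial>N)"
      using L2_norm_square[of N f] by (simp add: power2_eq_square)
    finally have "(\<integral>x. P t f x * f x \<partial>N) - (\<integral>x. f x * f x \<partial>N) \<le> 0" by simp
    also have "(\<integral>x. P t f x * f x \<partial>N) - (\<integral>x. f x * f x \<partial>N) = t * (\<integral>x. quotient t f x * f x \<partial>N)"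
    proof -
      have "(\<lambda>x. P t f x * f x - f x * f x) = (\<lambda>x. t * (quotient t f x * f x))"
        using that by (auto simp: quotient_def field_simps)
      then have "(\<integral>x. P t f x * f x - f x * f x \<partial>N) = t * (\<integral>x. quotient t f x * f x \<partial>N)"
        by simp
      then show ?thesis
        using in_L2_mult[OF in_L2_P[OF t sq(1)] sq(1)] in_L2_mult[OF sq(1) sq(1)]
        by simp
    qed
    finally show ?thesis using that by (simp add: mult_le_0_iff)
  qed
  have "((\<lambda>t. (\<integral>x. (quotient t f x - h x) * f x \<partial>N)) \<longlongrightarrow> 0) (at_right 0)"
  proof (rule Lim_null_comparison)
    show "\<forall>\<^sub>F t in at_right 0. norm (\<integral>x. (quotient t f x - h x) * f x \<partial>N)
        \<le> L2_norm N (\<lambda>x. quotient t f x - h x) * L2_norm N f"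
      using eventually_at_right_less
    proof eventually_elim
      case (elim t)
      then show ?case
        using L2_Cauchy_Schwarz[OF in_L2_diff[OF in_L2_quotient[of t, OF _ sq(1)] sq(2)] sq(1)]
        by simp
    qed
    show "((\<lambda>t. L2_norm N (\<lambda>x. quotient t f x - h x) * L2_norm N f) \<longlongrightarrow> 0) (at_right 0)"
      using lim by (auto intro!: tendsto_eq_intros)
  qed
  moreover have "\<forall>\<^sub>F t in at_right 0. (\<integral>x. (quotient t f x - h x) * f x \<partial>N) \<le> - (\<integral>x. h x * f x \<partial>N)"
    using eventually_at_right_less
  proof eventually_elim
    case (elim t)
    then have t: "t \<ge> 0" by simp
    have "(\<integral>x. (quotient t f x - h x) * f x \<partial>N) = (\<integral>x. quotient t f x * f x \<partial>N) - (\<integral>x. h x * f x \<partial>N)"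
      using in_L2_mult[OF in_L2_quotient[OF t sq(1)] sq(1)] in_L2_mult[OF sq(2) sq(1)]
      by (simp add: left_diff_distrib)
    then show ?case using nonpos elim by simp
  qed
  ultimately have "0 \<le> - (\<integral>x. h x * f x \<partial>N)"
    by (intro tendsto_le[OF trivial_limit_at_right_real tendsto_const]) auto
  then show ?thesis by simp
qed

text \<open>Dissipativity gives |f|^2 \<le> (f - L f, f). Hence f is controlled by f - L f, and
  approximating (1 - L) f is enough to approximate f together with L f.\<close>

lemma L2_generator_resolvent_bound:
  assumes g: "L2_generator K N f h"
  shows "L2_norm N f \<le> L2_norm N (\<lambda>x. f x - h x)"
proof (cases "L2_norm N f = 0")
  case False
  have sq: "in_L2 N f" "in_L2 N h" using g by (auto simp: L2_generator_iff)
  have "L2_norm N f * L2_norm N f = (\<integral>x. f x * f x \<partial>N)"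
    using L2_norm_square[of N f] by (simp add: power2_eq_square)
  also have "\<dots> \<le> (\<integral>x. f x * f x \<partial>N) - (\<integral>x. h x * f x \<partial>N)"
    using L2_generator_dissipative[OF g] by simp
  also have "\<dots> = (\<integral>x. (f x - h x) * f x \<partial>N)"
    using in_L2_mult[OF sq(1) sq(1)] in_L2_mult[OF sq(2) sq(1)]
    by (simp add: left_diff_distrib)
  also have "\<dots> \<le> L2_norm N (\<lambda>x. f x - h x) * L2_norm N f"
    using L2_Cauchy_Schwarz[OF in_L2_diff[OF sq] sq(1)] by linarith
  finally show ?thesis using False by (simp add: less_le)
qed simp

end

text \<open>Setting of the invariant-core theorem: a dense invariant subspace of the domain is a
  core. \<open>D\<close> is a set of pairs (function, generator value), and invariance and the
  semigroup law are asked for only up to null sets.\<close>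

locale generator_core = stationary_kernel +
  fixes D :: "((real \<Rightarrow> real) \<times> (real \<Rightarrow> real)) set"
  assumes D_generator: "(f, h) \<in> D \<Longrightarrow> L2_generator K N f h"
    and D_add: "(f, h) \<in> D \<Longrightarrow> (u, w) \<in> D \<Longrightarrow> (\<lambda>x. f x + u x, \<lambda>x. h x + w x) \<in> D"
    and D_cmult: "(f, h) \<in> D \<Longrightarrow> (\<lambda>x. c * f x, \<lambda>x. c * h x) \<in> D"
    and D_invariant: "(f, h) \<in> D \<Longrightarrow> t \<ge> 0 \<Longrightarrow> \<exists>f' h'. (f', h') \<in> D \<and> (AE x in N. f' x = P t f x)"
    and D_P0: "(f, h) \<in> D \<Longrightarrow> AE x in N. P 0 f x = f x"
    and D_semigroup: "(f, h) \<in> D \<Longrightarrow> s \<ge> 0 \<Longrightarrow> t \<ge> 0 \<Longrightarrow> AE x in N. P s (P t f) x = P (s + t) f x"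
    and D_dense: "in_L2 N f \<Longrightarrow> \<epsilon> > 0 \<Longrightarrow> \<exists>(u, w)\<in>D. L2_norm N (\<lambda>x. f x - u x) < \<epsilon>"
begin

lemma D_in_L2:
  assumes "(f, h) \<in> D"
  shows "in_L2 N f" "in_L2 N h"
  using D_generator[OF assms] by (auto simp: L2_generator_iff)

lemma D_zero: "(\<lambda>x. 0, \<lambda>x. 0) \<in> D"
proof -
  obtain u w where "(u, w) \<in> D"
    using D_dense[of "\<lambda>_. 0" 1] by (auto simp: in_L2_def)
  from D_cmult[OF this, of 0] show ?thesis by simp
qed

lemma D_sum:
  "(\<And>i. i \<in> I \<Longrightarrow> (f i, h i) \<in> D) \<Longrightarrow> (\<lambda>x. \<Sum>i\<in>I. f i x, \<lambda>x. \<Sum>i\<in>I. h i x) \<in> D"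
proof (induction I rule: infinite_finite_induct)
  case (insert i I)
  then show ?case using D_add[of "f i" "h i" "\<lambda>x. \<Sum>i\<in>I. f i x" "\<lambda>x. \<Sum>i\<in>I. h i x"] by simp
qed (auto simp: D_zero)

text \<open>L P t = P t L on \<open>D\<close>: the difference quotient of P t f is P t applied to
  that of f, and P t is a contraction, so both limits agree.\<close>

lemma generator_commutes:
  assumes fh: "(f, h) \<in> D" and t: "t \<ge> 0" and fh': "(f', h') \<in> D" and eq: "AE x in N. f' x = P t f x"
  shows "L2_norm N (\<lambda>x. h' x - P t h x) = 0"
proof -
  note sq = D_in_L2[OF fh] D_in_L2[OF fh']
  note sqP = in_L2_P[OF t sq(1)] in_L2_P[OF t sq(2)]
  have meas: "f' \<in> borel_measurable borel" "P t f \<in> borel_measurable borel"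
    using sq(3) sqP(1) by (auto simp: in_L2_def measurable_N)
  have lim: "((\<lambda>s. L2_norm N (\<lambda>x. quotient s f' x - h' x) + L2_norm N (\<lambda>x. quotient s f x - h x)) \<longlongrightarrow> 0 + 0) (at_right 0)"
    using D_generator[OF fh] D_generator[OF fh'] by (intro tendsto_add) (auto simp: L2_generator_iff)
  have "\<forall>\<^sub>F s in at_right 0. L2_norm N (\<lambda>x. h' x - P t h x)
      \<le> L2_norm N (\<lambda>x. quotient s f' x - h' x) + L2_norm N (\<lambda>x. quotient s f x - h x)"
    using eventually_at_right_less
  proof eventually_elim
    case (elim s)
    then have s: "s \<ge> 0" by simp
    note sqq = in_L2_quotient[OF s sq(1)] in_L2_quotient[OF s sq(3)]
    note sqd = in_L2_diff[OF sqq(1) sq(2)]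
    have "AE x in N. quotient s f' x - P t h x = P t (\<lambda>x. quotient s f x - h x) x"
      using P_cong_AE[OF s meas eq] eq D_semigroup[OF fh s t] D_semigroup[OF fh t s]
        P_diff[OF t sqq(1) sq(2)] P_diff[OF t in_L2_P[OF s sq(1)] sq(1)]
    proof eventually_elim
      case (elim x)
      have "quotient s f' x = (P t (P s f) x - P t f x) / s"
        using elim by (simp add: quotient_def add.commute)
      also have "\<dots> = P t (\<lambda>x. (1 / s) * (P s f x - f x)) x"
        unfolding P_cmult using elim by simp
      also have "(\<lambda>x. (1 / s) * (P s f x - f x)) = quotient s f"
        by (auto simp: quotient_def)
      finally show ?case using elim by simp
    qed
    then have "L2_norm N (\<lambda>x. quotient s f' x - P t h x) = L2_norm N (P t (\<lambda>x. quotient s f x - h x))"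
      using in_L2_diff[OF sqq(2) sqP(2)] in_L2_P[OF t sqd]
      by (intro L2_norm_cong_AE) (auto simp: in_L2_def)
    also have "\<dots> \<le> L2_norm N (\<lambda>x. quotient s f x - h x)"
      by (rule L2_norm_P[OF t sqd])
    finally show ?case
      using L2_norm_chain[OF sq(4) sqq(2) sqP(2)] L2_norm_minus_commute[of N h' "quotient s f'"] by simp
  qed
  from tendsto_le[OF trivial_limit_at_right_real lim tendsto_const this]
  show ?thesis by (simp add: antisym)
qed

text \<open>A discrete resolvent: with \<open>q = 1 / (1 + \<eta>)\<close> the operator \<open>1 - L\<close>, applied to
  \<open>\<eta> (w + q P\<^sub>\<eta> w + q\<^sup>2 P\<^sub>2\<^sub>\<eta> w + \<dots>)\<close>, telescopes to \<open>(1 + \<eta>) w\<close> up to errors that are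
  controlled by \<open>L w - (P\<^sub>\<eta> w - w) / \<eta>\<close>.\<close>

lemma resolvent_bound:
  assumes w: "(w, v) \<in> D" and \<eta>: "\<eta> > 0"
  shows "\<exists>(u, u')\<in>D. L2_norm N (\<lambda>x. (u x - u' x) - w x)
      \<le> \<eta> * L2_norm N w + (1 + \<eta>) * (1 / (1 + \<eta>)) ^ n * L2_norm N w
        + (1 + \<eta>) * L2_norm N (\<lambda>x. quotient \<eta> w x - v x)"
proof -
  \<comment> \<open>The relation q (1 + \<eta>) = 1 makes consecutive terms telescope.\<close>
  define q where "q = 1 / (1 + \<eta>)"
  have q: "0 < q" "q < 1" "q * (1 + \<eta>) = 1" using \<eta> by (auto simp: q_def field_simps)
  note sq = D_in_L2[OF w]
  define r where "r x = quotient \<eta> w x - v x" for x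
  have sqr: "in_L2 N r"
    unfolding r_def using \<eta> sq by (intro in_L2_diff in_L2_quotient) auto
  have "\<exists>p l. (p, l) \<in> D \<and> (AE x in N. p x = P (real k * \<eta>) w x)" for k
    using D_invariant[OF w, of "real k * \<eta>"] \<eta> by simp
  then obtain p l where D_pl: "\<And>k. (p k, l k) \<in> D" and p: "\<And>k. AE x in N. p k x = P (real k * \<eta>) w x"
    by metis
  note sqpl = D_in_L2[OF D_pl]
  have time: "real k * \<eta> \<ge> 0" for k using \<eta> by simp
  \<comment> \<open>The error in commuting L with P: zero in norm, but not pointwise, since
    \<open>l k\<close> is merely one representative. It is carried along in the sum.\<close>
  define d where "d k x = l k x - P (real k * \<eta>) v x" for k x
  have sqd: "in_L2 N (d k)" for k
    unfolding d_def using sqpl sq time by (intro in_L2_diff in_L2_P) auto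
  have d0: "L2_norm N (d k) = 0" for k
    unfolding d_def using generator_commutes[OF w time D_pl p] .
  have Pr: "AE x in N. P (real k * \<eta>) r x = (p (Suc k) x - p k x) / \<eta> - P (real k * \<eta>) v x" for k
  proof -
    have "\<eta> \<ge> 0" using \<eta> by simp
    note sqq = in_L2_quotient[OF this sq(1)] and sqP = in_L2_P[OF this sq(1)]
    show ?thesis
      using p[of k] p[of "Suc k"] D_semigroup[OF w time[of k] \<open>\<eta> \<ge> 0\<close>]
        P_diff[OF time[of k] sqq sq(2)] P_diff[OF time[of k] sqP sq(1)]
    proof eventually_elim
      case (elim x)
      have "quotient \<eta> w = (\<lambda>x. (1 / \<eta>) * (P \<eta> w x - w x))" by (auto simp: quotient_def)
      then have "P (real k * \<eta>) (quotient \<eta> w) x = (1 / \<eta>) * P (real k * \<eta>) (\<lambda>x. P \<eta> w x - w x) x"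
        by (simp only: P_cmult)
      also have "\<dots> = (p (Suc k) x - p k x) / \<eta>"
        using elim by (simp add: distrib_right add.commute)
      finally show ?case using elim by (simp add: r_def[abs_def])
    qed
  qed
  have p0: "AE x in N. p 0 x = w x"
    using p[of 0] D_P0[OF w] by eventually_elim simp
  define u where "u x = (\<Sum>k<n. \<eta> * q ^ k * p k x)" for x
  define u' where "u' x = (\<Sum>k<n. \<eta> * q ^ k * l k x)" for x
  have uu: "(u, u') \<in> D"
    unfolding u_def u'_def by (intro D_sum D_cmult D_pl)
  define E where "E x = (\<Sum>k<n. \<eta> * q ^ k * (P (real k * \<eta>) r x - d k x))" for x
  have sqPr: "in_L2 N (\<lambda>x. P (real k * \<eta>) r x - d k x)" for k
    using time by (intro in_L2_diff in_L2_P sqr sqd) auto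
  have sqE: "in_L2 N E"
    unfolding E_def by (intro in_L2_sum in_L2_cmult sqPr)
  have "AE x in N. \<forall>k. P (real k * \<eta>) r x = (p (Suc k) x - p k x) / \<eta> - P (real k * \<eta>) v x"
    using Pr by (simp add: AE_all_countable)
  then have "AE x in N. (u x - u' x) - w x = (\<eta> * w x - ((1 + \<eta>) * q ^ n) * p n x) + E x"
    using p0
  proof eventually_elim
    case (elim x)
    \<comment> \<open>From the two definitions, \<eta> (P r - d) = p (Suc k) - p k - \<eta> l k; the
      term P v cancels.\<close>
    have "\<eta> * p k x - \<eta> * l k x = ((1 + \<eta>) * p k x - p (Suc k) x) + \<eta> * (P (real k * \<eta>) r x - d k x)" for k
      using elim(1)[rule_format, of k] \<eta> by (simp add: d_def field_simps)
    then have step: "\<eta> * q ^ k * p k x - \<eta> * q ^ k * l k x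
        = (1 + \<eta>) * (q ^ k * p k x - q ^ Suc k * p (Suc k) x) + \<eta> * q ^ k * (P (real k * \<eta>) r x - d k x)" for k
    proof -
      have "\<eta> * q ^ k * p k x - \<eta> * q ^ k * l k x = q ^ k * (\<eta> * p k x - \<eta> * l k x)"
        by (simp add: algebra_simps)
      also have "\<dots> = q ^ k * ((1 + \<eta>) * p k x - (q * (1 + \<eta>)) * p (Suc k) x)
          + \<eta> * q ^ k * (P (real k * \<eta>) r x - d k x)"
        unfolding \<open>\<eta> * p k x - \<eta> * l k x = _\<close> q(3) by (simp add: algebra_simps)
      also have "q ^ k * ((1 + \<eta>) * p k x - (q * (1 + \<eta>)) * p (Suc k) x)
          = (1 + \<eta>) * (q ^ k * p k x - q ^ Suc k * p (Suc k) x)"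
        by (simp add: algebra_simps)
      finally show ?thesis .
    qed
    have "u x - u' x = (\<Sum>k<n. (1 + \<eta>) * (q ^ k * p k x - q ^ Suc k * p (Suc k) x)) + E x"
      unfolding u_def u'_def E_def sum_subtractf[symmetric] sum.distrib[symmetric] step ..
    also have "(\<Sum>k<n. (1 + \<eta>) * (q ^ k * p k x - q ^ Suc k * p (Suc k) x)) = (1 + \<eta>) * (p 0 x - q ^ n * p n x)"
      unfolding sum_distrib_left[symmetric] by (subst sum_lessThan_telescope') simp
    finally show ?case using elim(2) by (simp add: algebra_simps)
  qed
  then have "L2_norm N (\<lambda>x. (u x - u' x) - w x)
      = L2_norm N (\<lambda>x. (\<eta> * w x - ((1 + \<eta>) * q ^ n) * p n x) + E x)"
    using D_in_L2[OF uu] sq sqE sqpl(1)[of n]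
    by (intro L2_norm_cong_AE) (auto simp: in_L2_def)
  also have "\<dots> \<le> L2_norm N (\<lambda>x. \<eta> * w x) + L2_norm N (\<lambda>x. ((1 + \<eta>) * q ^ n) * p n x) + L2_norm N E"
  proof -
    note c = in_L2_cmult[OF sq(1), of \<eta>] in_L2_cmult[OF sqpl(1)[of n], of "(1 + \<eta>) * q ^ n"]
    show ?thesis
      using L2_norm_triangle[OF in_L2_diff[OF c] sqE] L2_norm_diff[OF c] by linarith
  qed
  also have "L2_norm N (\<lambda>x. \<eta> * w x) = \<eta> * L2_norm N w" using \<eta> by (simp add: L2_norm_cmult)
  also have "L2_norm N (\<lambda>x. ((1 + \<eta>) * q ^ n) * p n x) \<le> (1 + \<eta>) * q ^ n * L2_norm N w"
  proof -
    have "L2_norm N (p n) = L2_norm N (P (real n * \<eta>) w)"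
      using sqpl(1)[of n] in_L2_P[OF time sq(1)] p
      by (intro L2_norm_cong_AE) (auto simp: in_L2_def)
    also have "\<dots> \<le> L2_norm N w" by (rule L2_norm_P[OF time sq(1)])
    finally have "(1 + \<eta>) * q ^ n * L2_norm N (p n) \<le> (1 + \<eta>) * q ^ n * L2_norm N w"
      using \<eta> q by (intro mult_left_mono) auto
    then show ?thesis using \<eta> q by (simp add: L2_norm_cmult abs_mult)
  qed
  also have "L2_norm N E \<le> (1 + \<eta>) * L2_norm N r"
  proof -
    have "L2_norm N E \<le> (\<Sum>k<n. L2_norm N (\<lambda>x. \<eta> * q ^ k * (P (real k * \<eta>) r x - d k x)))"
      unfolding E_def by (intro L2_norm_sum in_L2_cmult sqPr)
    also have "\<dots> \<le> (\<Sum>k<n. \<eta> * q ^ k * L2_norm N r)"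
    proof (rule sum_mono)
      fix k
      have "L2_norm N (\<lambda>x. P (real k * \<eta>) r x - d k x) \<le> L2_norm N r"
        using L2_norm_diff[OF in_L2_P[OF time[of k] sqr] sqd[of k]] d0[of k] L2_norm_P[OF time[of k] sqr]
        by linarith
      then have "\<eta> * q ^ k * L2_norm N (\<lambda>x. P (real k * \<eta>) r x - d k x) \<le> \<eta> * q ^ k * L2_norm N r"
        using \<eta> q by (intro mult_left_mono) auto
      then show "L2_norm N (\<lambda>x. \<eta> * q ^ k * (P (real k * \<eta>) r x - d k x)) \<le> \<eta> * q ^ k * L2_norm N r"
        using \<eta> q by (simp add: L2_norm_cmult abs_mult)
    qed
    also have "\<dots> = (\<eta> * (\<Sum>k<n. q ^ k)) * L2_norm N r"
      by (simp add: sum_distrib_left sum_distrib_right mult.assoc)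
    also have "\<dots> \<le> (1 + \<eta>) * L2_norm N r"
    proof (rule mult_right_mono)
      \<comment> \<open>The total weight is at most \<eta> / (1 - q) = 1 + \<eta>, uniformly in
        n.\<close>
      have "(\<Sum>k<n. q ^ k) = (1 - q ^ n) / (1 - q)" using q by (simp add: sum_gp_strict)
      also have "\<dots> \<le> 1 / (1 - q)" using q by (intro divide_right_mono) auto
      also have "\<dots> = (1 + \<eta>) / \<eta>" using \<eta> by (simp add: q_def field_simps)
      finally show "\<eta> * (\<Sum>k<n. q ^ k) \<le> 1 + \<eta>" using \<eta> by (simp add: field_simps)
    qed simp
    finally show ?thesis .
  qed
  finally show ?thesis using uu by (intro bexI[of _ "(u, u')"]) (auto simp: q_def r_def[abs_def])
qed

text \<open>The step \<eta> is fixed first, to make the terms without n small; only then is n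
  chosen, because the decay rate of the truncation error depends on \<eta>.\<close>

lemma resolvent_dense:
  assumes w: "(w, v) \<in> D" and \<epsilon>: "\<epsilon> > 0"
  shows "\<exists>(u, u')\<in>D. L2_norm N (\<lambda>x. (u x - u' x) - w x) < \<epsilon>"
proof -
  have "((\<lambda>\<eta>. \<eta> * L2_norm N w + (1 + \<eta>) * L2_norm N (\<lambda>x. quotient \<eta> w x - v x)) \<longlongrightarrow> 0) (at_right 0)"
    using D_generator[OF w] by (auto simp: L2_generator_iff intro!: tendsto_eq_intros)
  then have "\<forall>\<^sub>F \<eta> in at_right 0. \<eta> * L2_norm N w + (1 + \<eta>) * L2_norm N (\<lambda>x. quotient \<eta> w x - v x) < \<epsilon> / 2"
    using \<epsilon> by (intro order_tendstoD) auto
  with eventually_at_right_less[of "0::real"]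
  have "\<forall>\<^sub>F \<eta> in at_right 0. \<eta> > 0 \<and> \<eta> * L2_norm N w + (1 + \<eta>) * L2_norm N (\<lambda>x. quotient \<eta> w x - v x) < \<epsilon> / 2"
    by eventually_elim simp
  then obtain \<eta> where \<eta>: "\<eta> > 0"
    "\<eta> * L2_norm N w + (1 + \<eta>) * L2_norm N (\<lambda>x. quotient \<eta> w x - v x) < \<epsilon> / 2"
    using eventually_happens'[OF trivial_limit_at_right_real] by blast
  have "(\<lambda>n. (1 + \<eta>) * (1 / (1 + \<eta>)) ^ n * L2_norm N w) \<longlonglongrightarrow> (1 + \<eta>) * 0 * L2_norm N w"
    using \<eta> by (intro tendsto_intros LIMSEQ_realpow_zero) auto
  then have "\<forall>\<^sub>F n in sequentially. (1 + \<eta>) * (1 / (1 + \<eta>)) ^ n * L2_norm N w < \<epsilon> / 2"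
    using \<epsilon> by (intro order_tendstoD) auto
  then obtain n where n: "(1 + \<eta>) * (1 / (1 + \<eta>)) ^ n * L2_norm N w < \<epsilon> / 2"
    by (auto simp: eventually_sequentially)
  obtain u u' where u: "(u, u') \<in> D" and le: "L2_norm N (\<lambda>x. (u x - u' x) - w x)
      \<le> \<eta> * L2_norm N w + (1 + \<eta>) * (1 / (1 + \<eta>)) ^ n * L2_norm N w
        + (1 + \<eta>) * L2_norm N (\<lambda>x. quotient \<eta> w x - v x)"
    using resolvent_bound[OF w \<eta>(1), of n] by auto
  from le have "L2_norm N (\<lambda>x. (u x - u' x) - w x) < \<epsilon>" using \<eta>(2) n by linarith
  then show ?thesis using u by (intro bexI[of _ "(u, u')"]) auto
qed

text \<open>f - h is approximated by some w from \<open>D\<close>, and w by u - u' with (u, u') in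
  \<open>D\<close>. The resolvent bound turns this into closeness of u to f, and subtraction into
  closeness of u' to h.\<close>

lemma core:
  assumes g: "L2_generator K N f h" and \<epsilon>: "\<epsilon> > 0"
  shows "\<exists>(u, u')\<in>D. L2_norm N (\<lambda>x. u x - f x) < \<epsilon> \<and> L2_norm N (\<lambda>x. u' x - h x) < \<epsilon>"
proof -
  have sq: "in_L2 N f" "in_L2 N h" using g by (auto simp: L2_generator_iff)
  obtain w v where w: "(w, v) \<in> D" "L2_norm N (\<lambda>x. (f x - h x) - w x) < \<epsilon> / 4"
    using D_dense[OF in_L2_diff[OF sq], of "\<epsilon> / 4"] \<epsilon> by auto
  obtain u u' where u: "(u, u') \<in> D" "L2_norm N (\<lambda>x. (u x - u' x) - w x) < \<epsilon> / 4"
    using resolvent_dense[OF w(1), of "\<epsilon> / 4"] \<epsilon> by auto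
  note squ = D_in_L2[OF u(1)] and sqw = D_in_L2[OF w(1)]
  note gd = L2_generator_diff[OF D_generator[OF u(1)] g]
  have "L2_norm N (\<lambda>x. (u x - u' x) - (f x - h x)) < \<epsilon> / 2"
    using L2_norm_chain[OF in_L2_diff[OF squ] sqw(1) in_L2_diff[OF sq]]
      w(2) u(2) L2_norm_minus_commute[of N w "\<lambda>x. f x - h x"] by linarith
  moreover have "(\<lambda>x. (u x - u' x) - (f x - h x)) = (\<lambda>x. (u x - f x) - (u' x - h x))" by auto
  ultimately have res: "L2_norm N (\<lambda>x. (u x - f x) - (u' x - h x)) < \<epsilon> / 2" by simp
  then have uf: "L2_norm N (\<lambda>x. u x - f x) < \<epsilon> / 2"
    using L2_generator_resolvent_bound[OF gd] by linarith
  note sqd = in_L2_diff[OF squ(1) sq(1)] in_L2_diff[OF squ(2) sq(2)]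
  have "L2_norm N (\<lambda>x. u' x - h x) \<le> L2_norm N (\<lambda>x. u x - f x) + L2_norm N (\<lambda>x. (u x - f x) - (u' x - h x))"
    using L2_norm_diff[OF sqd(1) in_L2_diff[OF sqd]] by simp
  then show ?thesis using uf res u(1) \<epsilon> by (intro bexI[of _ "(u, u')"]) auto
qed

lemma core_sequence:
  assumes "L2_generator K N f h"
  obtains u u' where "\<And>n::nat. (u n, u' n) \<in> D"
    "(\<lambda>n. L2_norm N (\<lambda>x. u n x - f x)) \<longlonglongrightarrow> 0" "(\<lambda>n. L2_norm N (\<lambda>x. u' n x - h x)) \<longlonglongrightarrow> 0"
proof -
  have "\<exists>u u'. (u, u') \<in> D \<and> L2_norm N (\<lambda>x. u x - f x) < inverse (Suc n)
      \<and> L2_norm N (\<lambda>x. u' x - h x) < inverse (Suc n)" for n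
    using core[OF assms, of "inverse (Suc n)"] by auto
  then obtain u u' where u: "\<And>n. (u n, u' n) \<in> D" "\<And>n. L2_norm N (\<lambda>x. u n x - f x) < inverse (Suc n)"
      "\<And>n. L2_norm N (\<lambda>x. u' n x - h x) < inverse (Suc n)"
    by metis
  have "(\<lambda>n. L2_norm N (\<lambda>x. u n x - f x)) \<longlonglongrightarrow> 0" "(\<lambda>n. L2_norm N (\<lambda>x. u' n x - h x)) \<longlonglongrightarrow> 0"
    by (rule Lim_null_comparison[OF _ LIMSEQ_inverse_real_of_nat],
        use u in \<open>auto intro!: always_eventually less_imp_le\<close>)+
  then show ?thesis using that u(1) by blast
qed

text \<open>All three integrals are continuous for convergence of functions and generator values in
  L^2, so an inequality on a core persists on the whole domain.\<close>

lemma sector_const_le: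
  assumes bound: "\<And>f h g k. (f, h) \<in> D \<Longrightarrow> (g, k) \<in> D \<Longrightarrow>
      (\<integral>x. - h x * g x \<partial>N) \<le> c * sqrt (\<integral>x. - h x * f x \<partial>N) * sqrt (\<integral>x. - k x * g x \<partial>N)"
  shows "sector_const K N \<le> ereal c"
  unfolding sector_const_def
proof (rule Inf_lower, rule CollectI, intro exI[of _ c] conjI refl allI impI)
  fix f h g k assume gen: "L2_generator K N f h" "L2_generator K N g k"
  then have sq: "in_L2 N f" "in_L2 N h" "in_L2 N g" "in_L2 N k"
    by (auto simp: L2_generator_iff)
  obtain u u' where u: "\<And>n::nat. (u n, u' n) \<in> D" and ul: "(\<lambda>n. L2_norm N (\<lambda>x. u n x - f x)) \<longlonglongrightarrow> 0"
      "(\<lambda>n. L2_norm N (\<lambda>x. u' n x - h x)) \<longlonglongrightarrow> 0"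
    using core_sequence[OF gen(1)] by blast
  obtain w w' where w: "\<And>n::nat. (w n, w' n) \<in> D" and wl: "(\<lambda>n. L2_norm N (\<lambda>x. w n x - g x)) \<longlonglongrightarrow> 0"
      "(\<lambda>n. L2_norm N (\<lambda>x. w' n x - k x)) \<longlonglongrightarrow> 0"
    using core_sequence[OF gen(2)] by blast
  note squ = D_in_L2[OF u] and sqw = D_in_L2[OF w]
  have lim1: "(\<lambda>n. \<integral>x. - u' n x * w n x \<partial>N) \<longlonglongrightarrow> (\<integral>x. - h x * g x \<partial>N)"
    using tendsto_minus[OF tendsto_integral_mult_L2[OF sq(2,3) squ(2) sqw(1) ul(2) wl(1)]] by simp
  have lim2: "(\<lambda>n. \<integral>x. - u' n x * u n x \<partial>N) \<longlonglongrightarrow> (\<integral>x. - h x * f x \<partial>N)"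
    using tendsto_minus[OF tendsto_integral_mult_L2[OF sq(2,1) squ(2,1) ul(2,1)]] by simp
  have lim3: "(\<lambda>n. \<integral>x. - w' n x * w n x \<partial>N) \<longlonglongrightarrow> (\<integral>x. - k x * g x \<partial>N)"
    using tendsto_minus[OF tendsto_integral_mult_L2[OF sq(4,3) sqw(2,1) wl(2,1)]] by simp
  show "(\<integral>x. - h x * g x \<partial>N) \<le> c * sqrt (\<integral>x. - h x * f x \<partial>N) * sqrt (\<integral>x. - k x * g x \<partial>N)"
    using bound[OF u w]
    by (intro LIMSEQ_le[OF lim1 tendsto_mult[OF tendsto_mult[OF tendsto_const tendsto_real_sqrt[OF lim2]]
      tendsto_real_sqrt[OF lim3]]]) blast
qed

end

section \<open>The branching mechanism and its flow\<close>

text \<open>R of the overview, as a real number; \<open>psi_tilde_eq\<close> links it to the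
  extended-real version.\<close>

definition rate :: "real \<Rightarrow> real \<Rightarrow> real measure \<Rightarrow> real \<Rightarrow> real" where
  "rate a b n l = a * l + b + tail_exponent n l"

text \<open>The setting of the sector bound. Positivity of a makes \<open>rate\<close> strictly
  positive at every l > 0.\<close>

locale branching_mechanism = branching_measure n for n :: "real measure" +
  fixes a b :: real
  assumes a_pos: "a > 0" and b_nonneg: "b \<ge> 0"
begin

lemma tail_exponent_mono:
  assumes "0 \<le> l" "l \<le> k"
  shows "tail_exponent n l \<le> tail_exponent n k"
  unfolding tail_exponent_def
proof (rule integral_mono_AE)
  show "AE y in ntilde n. 1 - exp (- l * y) \<le> 1 - exp (- k * y)"
    using AE_ntilde_nonneg by eventually_elim (use assms in \<open>simp add: mult_right_mono\<close>)
  show "integrable (ntilde n) (\<lambda>y. 1 - exp (- l * y))" "integrable (ntilde n) (\<lambda>y. 1 - exp (- k * y))"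
    using assms by (intro integrable_tail_exponent; simp)+
qed

lemma rate_mono: "0 \<le> l \<Longrightarrow> l \<le> k \<Longrightarrow> rate a b n l \<le> rate a b n k"
  unfolding rate_def using a_pos by (intro add_mono tail_exponent_mono mult_left_mono) auto

lemma rate_pos: "l > 0 \<Longrightarrow> rate a b n l > 0"
  unfolding rate_def using a_pos b_nonneg tail_exponent_nonneg[of l] by (simp add: add_pos_nonneg)

lemma rate_nonneg: "l \<ge> 0 \<Longrightarrow> rate a b n l \<ge> 0"
  unfolding rate_def using a_pos b_nonneg tail_exponent_nonneg[of l] by simp

lemma isCont_rate: "l > 0 \<Longrightarrow> isCont (rate a b n) l"
  unfolding rate_def[abs_def] by (intro continuous_intros isCont_tail_exponent)

lemma psi_eq_rate:
  assumes "l \<ge> 0"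
  shows "psi a b n l = l * rate a b n l"
proof -
  have "psi a b n l = a * l\<^sup>2 + b * l + compensated_laplace n l"
    by (simp only: psi_def compensated_laplace_def)
  then show ?thesis
    using tail_exponent_eq[OF assms] by (simp add: rate_def power2_eq_square algebra_simps)
qed

lemma psi_nonneg: "l \<ge> 0 \<Longrightarrow> psi a b n l \<ge> 0"
  by (simp add: psi_eq_rate rate_nonneg)

lemma psi_mono: "0 \<le> l \<Longrightarrow> l \<le> k \<Longrightarrow> psi a b n l \<le> psi a b n k"
  by (simp add: psi_eq_rate mult_mono rate_mono rate_nonneg)

lemma psi_tilde_eq:
  assumes l: "l \<ge> 0"
  shows "psi_tilde a b n l = ennreal (rate a b n l)"
proof -
  have "(\<integral>\<^sup>+ y. ennreal (1 - exp (- l * y)) \<partial>ntilde n) = ennreal (tail_exponent n l)"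
    unfolding tail_exponent_def
  proof (rule nn_integral_eq_integral[OF integrable_tail_exponent[OF l]])
    show "AE y in ntilde n. 0 \<le> 1 - exp (- l * y)"
      using AE_ntilde_nonneg by eventually_elim (use l in auto)
  qed
  then show ?thesis
    unfolding psi_tilde_def rate_def using a_pos b_nonneg l tail_exponent_nonneg[OF l] by (simp flip: ennreal_plus)
qed

text \<open>1 / R is nonincreasing, so the integral over an interval lies between its length times
  the two endpoint values. Finiteness at k allows the passage to real differences.\<close>

lemma Phi_increment:
  assumes l: "0 < l" "l < k" and fin: "Phi a b n k < \<infinity>"
  shows "(k - l) / rate a b n k \<le> enn2real (Phi a b n k) - enn2real (Phi a b n l)"
    and "enn2real (Phi a b n k) - enn2real (Phi a b n l) \<le> (k - l) / rate a b n l"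
proof -
  define I where "I = (\<integral>\<^sup>+ u. indicator {l<..k} u * inverse (psi_tilde a b n u) \<partial>lborel)"
  have split: "Phi a b n k = Phi a b n l + I"
  proof -
    have meas: "(\<lambda>u. indicator {0<..k'} u * inverse (psi_tilde a b n u)) \<in> borel_measurable lborel" for k'
    proof -
      have "continuous_on {0<..} (rate a b n)"
        using isCont_rate by (auto intro!: continuous_at_imp_continuous_on)
      then have [measurable]: "(\<lambda>u. indicator {0<..} u * rate a b n u) \<in> borel_measurable borel"
        using borel_measurable_continuous_on_indicator[of "{0<..}" "rate a b n"] by simp
      have "(\<lambda>u. indicator {0<..k'} u * inverse (psi_tilde a b n u))
          = (\<lambda>u. indicator {0<..k'} u * inverse (ennreal (indicator {0<..} u * rate a b n u)))"
        by (auto simp: indicator_def psi_tilde_eq)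
      then show ?thesis by simp
    qed
    \<comment> \<open>The endpoint 0 is discarded because measurability of the integrand is derived
      from continuity of \<open>rate\<close>, established at positive arguments.\<close>
    have zero: "(\<integral>\<^sup>+ u. indicator {0..k'} u * inverse (psi_tilde a b n u) \<partial>lborel)
        = (\<integral>\<^sup>+ u. indicator {0<..k'} u * inverse (psi_tilde a b n u) \<partial>lborel)" for k'
    proof (rule nn_integral_cong_AE)
      show "AE u in lborel. indicator {0..k'} u * inverse (psi_tilde a b n u)
          = indicator {0<..k'} u * inverse (psi_tilde a b n u)"
        using AE_lborel_singleton[of 0] by eventually_elim (auto simp: indicator_def)
    qed
    have "(\<lambda>u. indicator {l<..k} u * inverse (psi_tilde a b n u))
        = (\<lambda>u. indicator {l<..} u * (indicator {0<..k} u * inverse (psi_tilde a b n u)))"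
      using l by (auto simp: indicator_def)
    then have meas2: "(\<lambda>u. indicator {l<..k} u * inverse (psi_tilde a b n u)) \<in> borel_measurable lborel"
      using meas[of k] by simp
    have "Phi a b n k = (\<integral>\<^sup>+ u. indicator {0<..l} u * inverse (psi_tilde a b n u)
        + indicator {l<..k} u * inverse (psi_tilde a b n u) \<partial>lborel)"
      unfolding Phi_def zero using l by (intro nn_integral_cong) (auto simp: indicator_def)
    also have "\<dots> = Phi a b n l + I"
      unfolding Phi_def zero I_def by (rule nn_integral_add[OF meas meas2])
    finally show ?thesis .
  qed
  have inv: "inverse (psi_tilde a b n u) = ennreal (1 / rate a b n u)" if "u > 0" for u
    using that rate_pos[OF that] by (simp add: psi_tilde_eq inverse_ennreal inverse_eq_divide)
  have const: "(\<integral>\<^sup>+ u. indicator {l<..k} u * ennreal c \<partial>lborel) = ennreal ((k - l) * c)" if "c \<ge> 0" for c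
    using l that by (subst mult.commute, subst nn_integral_cmult_indicator) (auto simp: ennreal_mult'' mult.commute)
  have lower: "ennreal ((k - l) * (1 / rate a b n k)) \<le> I"
  proof -
    have "(\<integral>\<^sup>+ u. indicator {l<..k} u * ennreal (1 / rate a b n k) \<partial>lborel) \<le> I"
      unfolding I_def using l
      by (intro nn_integral_mono) (auto simp: indicator_def inv intro!: ennreal_leI divide_left_mono rate_mono mult_pos_pos rate_pos)
    then show ?thesis using rate_pos[of k] l by (subst (asm) const) auto
  qed
  have upper: "I \<le> ennreal ((k - l) * (1 / rate a b n l))"
  proof -
    have "I \<le> (\<integral>\<^sup>+ u. indicator {l<..k} u * ennreal (1 / rate a b n l) \<partial>lborel)"
      unfolding I_def using l
      by (intro nn_integral_mono) (auto simp: indicator_def inv intro!: ennreal_leI divide_left_mono rate_mono mult_pos_pos rate_pos)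
    then show ?thesis using rate_pos[of l] l by (subst (asm) const) auto
  qed
  have fins: "Phi a b n l < \<top>" "I < \<top>" using fin unfolding split by (auto simp: ennreal_add_eq_top less_top)
  then have "enn2real (Phi a b n k) - enn2real (Phi a b n l) = enn2real I"
    unfolding split by (simp add: enn2real_plus)
  moreover have "(k - l) * (1 / rate a b n k) \<le> enn2real I"
    using enn2real_mono[OF lower fins(2)] rate_pos[of k] l by simp
  moreover have "enn2real I \<le> (k - l) * (1 / rate a b n l)"
    using upper rate_pos[of l] l by (intro enn2real_leI) auto
  ultimately show "(k - l) / rate a b n k \<le> enn2real (Phi a b n k) - enn2real (Phi a b n l)"
    and "enn2real (Phi a b n k) - enn2real (Phi a b n l) \<le> (k - l) / rate a b n l"
    by simp_all
qed

end

locale cbci_mechanism = branching_mechanism n a b + levy_measure \<Lambda> for n \<Lambda> :: "real measure" and a b :: real +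
  fixes v :: "real \<Rightarrow> real \<Rightarrow> real"
  assumes Phi_eq: "\<And>l. l \<ge> 0 \<Longrightarrow> Phi a b n l = ennreal (levy_exponent \<Lambda> l)"
    and v_init: "\<And>l. l \<ge> 0 \<Longrightarrow> v 0 l = l"
    and v_ode: "\<And>l t. l \<ge> 0 \<Longrightarrow> t \<ge> 0 \<Longrightarrow>
        ((\<lambda>s. v s l) has_real_derivative - psi a b n (v t l)) (at t within {0..})"
begin

lemma levy_exponent_nonneg: "l \<ge> 0 \<Longrightarrow> levy_exponent \<Lambda> l \<ge> 0"
  unfolding levy_exponent_def
  by (intro integral_nonneg_AE eventually_mono[OF pos]) simp

text \<open>The derivative of the exponent is already known to exist, so the limit of right
  difference quotients identifies it; these are squeezed between 1 / R(l + h) and 1 / R(l).\<close>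

lemma laplace1_eq_rate:
  assumes l: "l > 0"
  shows "laplace1 \<Lambda> l = 1 / rate a b n l"
proof -
  have "((\<lambda>h. (levy_exponent \<Lambda> (l + h) - levy_exponent \<Lambda> l) / h) \<longlongrightarrow> laplace1 \<Lambda> l) (at 0)"
    using DERIV_integral_one_minus_exp_neg[OF l] unfolding levy_exponent_def[abs_def] DERIV_def .
  then have lim: "((\<lambda>h. (levy_exponent \<Lambda> (l + h) - levy_exponent \<Lambda> l) / h) \<longlongrightarrow> laplace1 \<Lambda> l) (at_right 0)"
    by (rule tendsto_mono[OF at_le[OF subset_UNIV]])
  have "((\<lambda>h. l + h) \<longlongrightarrow> l) (at_right 0)"
    by (rule tendsto_eq_rhs[OF tendsto_add[OF tendsto_const tendsto_ident_at]]) simp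
  from isCont_tendsto_compose[OF isCont_rate[OF l] this]
  have low: "((\<lambda>h. 1 / rate a b n (l + h)) \<longlongrightarrow> 1 / rate a b n l) (at_right 0)"
    using rate_pos[OF l] by (intro tendsto_divide tendsto_const) auto
  have incr: "1 / rate a b n (l + h) \<le> (levy_exponent \<Lambda> (l + h) - levy_exponent \<Lambda> l) / h"
    "(levy_exponent \<Lambda> (l + h) - levy_exponent \<Lambda> l) / h \<le> 1 / rate a b n l" if h: "h > 0" for h
  proof -
    have "enn2real (Phi a b n l) = levy_exponent \<Lambda> l" "enn2real (Phi a b n (l + h)) = levy_exponent \<Lambda> (l + h)"
      "Phi a b n (l + h) < \<infinity>"
      using h l by (simp_all add: Phi_eq levy_exponent_nonneg)
    then have "h * (1 / rate a b n (l + h)) \<le> levy_exponent \<Lambda> (l + h) - levy_exponent \<Lambda> l"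
      "levy_exponent \<Lambda> (l + h) - levy_exponent \<Lambda> l \<le> h * (1 / rate a b n l)"
      using Phi_increment[of l "l + h"] h l by simp_all
    then show "1 / rate a b n (l + h) \<le> (levy_exponent \<Lambda> (l + h) - levy_exponent \<Lambda> l) / h"
      "(levy_exponent \<Lambda> (l + h) - levy_exponent \<Lambda> l) / h \<le> 1 / rate a b n l"
      unfolding pos_le_divide_eq[OF h] pos_divide_le_eq[OF h] by (simp_all only: mult.commute)
  qed
  have "((\<lambda>h. (levy_exponent \<Lambda> (l + h) - levy_exponent \<Lambda> l) / h) \<longlongrightarrow> 1 / rate a b n l) (at_right 0)"
    by (rule real_tendsto_sandwich[OF _ _ low tendsto_const];
        rule eventually_mono[OF eventually_at_right_less], rule incr, assumption)
  then show ?thesis using lim by (intro tendsto_unique[OF trivial_limit_at_right_real])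
qed

lemma DERIV_levy_exponent: "l > 0 \<Longrightarrow> (levy_exponent \<Lambda> has_real_derivative 1 / rate a b n l) (at l)"
  using DERIV_integral_one_minus_exp_neg[of l] laplace1_eq_rate[of l] unfolding levy_exponent_def[abs_def] by simp

section \<open>Positivity, monotonicity and flow property of the solutions\<close>

lemma continuous_on_v:
  assumes "l \<ge> 0"
  shows "continuous_on {0..t} (\<lambda>s. v s l)"
proof -
  have "continuous_on {0..} (\<lambda>s. v s l)"
    unfolding continuous_on_eq_continuous_within
    using v_ode[OF assms] by (auto intro: DERIV_continuous)
  then show ?thesis by (rule continuous_on_subset) auto
qed

lemma DERIV_v:
  assumes "l \<ge> 0" "t > 0"
  shows "((\<lambda>s. v s l) has_real_derivative - psi a b n (v t l)) (at t)"
proof -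
  have "at t within {0..} = at t" using assms(2) by (intro at_within_interior) (simp add: interior_Ici[of "-1"])
  then show ?thesis using v_ode[of l t] assms by simp
qed

text \<open>Nonnegativity of \<open>psi\<close> is available at nonnegative arguments, so positivity
  before t is assumed. \<open>v_pos\<close> uses this up to a first zero; afterwards the assumption
  can be discharged.\<close>

lemma v_decreasing_while_pos:
  assumes l: "l > 0" and t: "t \<ge> 0" and pos: "\<And>s. 0 < s \<Longrightarrow> s < t \<Longrightarrow> v s l > 0"
  shows "v t l \<le> l"
proof (cases "t = 0")
  case False
  have "v t l \<le> v 0 l"
  proof (rule DERIV_nonpos_imp_decreasing_open[where f = "\<lambda>s. v s l"])
    fix s assume s: "0 < s" "s < t"
    then show "\<exists>y. ((\<lambda>s. v s l) has_real_derivative y) (at s) \<and> y \<le> 0"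
      using DERIV_v[of l s] psi_nonneg[of "v s l"] pos[OF s] l by (intro exI[of _ "- psi a b n (v s l)"]) auto
  qed (use t l continuous_on_v[of l t] in auto)
  then show ?thesis using l v_init[of l] by simp
qed (use l v_init in auto)

text \<open>A Gronwall argument up to the first time \<tau> at which v is nonpositive. Before
  \<tau>, \<psi>(v) = v R(v) \<le> v R(l), so v exp (R(l) s) is nondecreasing and stays at least l,
  a contradiction at \<tau>.\<close>

lemma v_pos:
  assumes l: "l > 0" and t: "t \<ge> 0"
  shows "v t l > 0"
proof (rule ccontr)
  assume neg: "\<not> v t l > 0"
  define S where "S = {s\<in>{0..t}. v s l \<le> 0}"
  have "compact S"
  proof -
    have "closed S" unfolding S_def
      using l by (intro continuous_on_closed_Collect_le continuous_on_v continuous_on_const) auto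
    moreover have "bounded S" unfolding S_def by (rule bounded_subset[OF bounded_closed_interval[of 0 t]]) auto
    ultimately show ?thesis by (simp add: compact_eq_bounded_closed)
  qed
  moreover have "t \<in> S" using neg t by (simp add: S_def)
  ultimately obtain \<tau> where \<tau>: "\<tau> \<in> S" "\<And>s. s \<in> S \<Longrightarrow> \<tau> \<le> s"
    using compact_attains_inf[of S] by blast
  have "\<tau> \<noteq> 0" using \<tau>(1) v_init[of l] l by (auto simp: S_def)
  then have \<tau>_pos: "\<tau> > 0" "\<tau> \<le> t" "v \<tau> l \<le> 0" using \<tau>(1) by (auto simp: S_def)
  have before: "v s l > 0" if "0 \<le> s" "s < \<tau>" for s
    using \<tau>(2)[of s] that \<tau>_pos by (force simp: S_def)
  let ?R = "rate a b n l"
  have "v 0 l * exp (?R * 0) \<le> v \<tau> l * exp (?R * \<tau>)"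
  proof (rule DERIV_nonneg_imp_increasing_open[where f = "\<lambda>s. v s l * exp (?R * s)"])
    fix s assume s: "0 < s" "s < \<tau>"
    have vs: "0 < v s l" "v s l \<le> l"
      using before[of s] s v_decreasing_while_pos[OF l, of s] before by auto
    have "((\<lambda>s. v s l * exp (?R * s)) has_real_derivative
        (- psi a b n (v s l) * exp (?R * s) + v s l * (exp (?R * s) * ?R))) (at s)"
      using DERIV_v[of l s] l s by (auto intro!: derivative_eq_intros)
    moreover have "- psi a b n (v s l) * exp (?R * s) + v s l * (exp (?R * s) * ?R)
        = exp (?R * s) * (v s l * (?R - rate a b n (v s l)))"
      using vs by (simp add: psi_eq_rate algebra_simps)
    moreover have "\<dots> \<ge> 0" using vs rate_mono[of "v s l" l] by simp
    ultimately show "\<exists>y. ((\<lambda>s. v s l * exp (?R * s)) has_real_derivative y) (at s) \<and> y \<ge> 0" by metis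
  next
    show "continuous_on {0..\<tau>} (\<lambda>s. v s l * exp (?R * s))"
      using l by (intro continuous_intros continuous_on_v) auto
  qed (use \<tau>_pos in auto)
  then have "0 < v \<tau> l * exp (?R * \<tau>)" using v_init[of l] l by simp
  then show False using \<tau>_pos by (simp add: zero_less_mult_iff)
qed

lemma v_le: "l > 0 \<Longrightarrow> t \<ge> 0 \<Longrightarrow> v t l \<le> l"
  using v_decreasing_while_pos[of l t] v_pos[of l] by auto

lemma v_antimono:
  assumes l: "l > 0" and st: "0 \<le> s" "s \<le> t"
  shows "v t l \<le> v s l"
proof (cases "s = t")
  case False
  show ?thesis
  proof (rule DERIV_nonpos_imp_decreasing_open[where f = "\<lambda>s. v s l"])
    fix r assume "s < r" "r < t"
    then show "\<exists>y. ((\<lambda>s. v s l) has_real_derivative y) (at r) \<and> y \<le> 0"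
      using DERIV_v[of l r] psi_nonneg[of "v r l"] v_pos[OF l, of r] l st
      by (intro exI[of _ "- psi a b n (v r l)"]) auto
  next
    show "continuous_on {s..t} (\<lambda>s. v s l)"
      using continuous_on_v[of l t] l st by (auto intro: continuous_on_subset)
  qed (use st in auto)
qed simp

text \<open>\<Phi>' = 1 / R and \<psi>(v) = v R(v), so the chain rule leaves - v. The immigration
  integral of v thus becomes an increment of \<Phi>.\<close>

lemma DERIV_levy_exponent_v:
  assumes "l > 0" "t > 0"
  shows "((\<lambda>s. levy_exponent \<Lambda> (v s l)) has_real_derivative - v t l) (at t)"
proof -
  have v: "v t l > 0" using v_pos assms by simp
  have "((\<lambda>s. levy_exponent \<Lambda> (v s l)) has_real_derivative 1 / rate a b n (v t l) * - psi a b n (v t l)) (at t)"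
    using DERIV_chain2[OF DERIV_levy_exponent[OF v] DERIV_v[of l t]] assms by simp
  also have "1 / rate a b n (v t l) * - psi a b n (v t l) = - v t l"
    using v rate_pos[OF v] by (simp add: psi_eq_rate)
  finally show ?thesis .
qed

lemma isCont_levy_exponent: "l > 0 \<Longrightarrow> isCont (levy_exponent \<Lambda>) l"
  by (rule DERIV_isCont[OF DERIV_levy_exponent])

lemma continuous_on_levy_exponent_v:
  assumes "l > 0"
  shows "continuous_on {0..t} (\<lambda>s. levy_exponent \<Lambda> (v s l))"
proof -
  have "continuous_on {0<..} (levy_exponent \<Lambda>)"
    by (intro continuous_at_imp_continuous_on ballI isCont_levy_exponent) simp
  moreover have "continuous_on {0..t} (\<lambda>s. v s l)"
    using assms by (intro continuous_on_v) simp
  moreover have "(\<lambda>s. v s l) ` {0..t} \<subseteq> {0<..}"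
    using v_pos[OF assms] by auto
  ultimately show ?thesis
    by (rule continuous_on_compose2)
qed

lemma integral_v:
  assumes l: "l > 0" and t: "t \<ge> 0"
  shows "integral {0..t} (\<lambda>s. v s l) = levy_exponent \<Lambda> l - levy_exponent \<Lambda> (v t l)"
proof -
  have "((\<lambda>s. v s l) has_integral (- levy_exponent \<Lambda> (v t l) - - levy_exponent \<Lambda> (v 0 l))) {0..t}"
  proof (rule fundamental_theorem_of_calculus_interior)
    show "continuous_on {0..t} (\<lambda>s. - levy_exponent \<Lambda> (v s l))"
      by (intro continuous_on_minus continuous_on_levy_exponent_v l)
    fix s assume "s \<in> {0<..<t}"
    then show "((\<lambda>s. - levy_exponent \<Lambda> (v s l)) has_vector_derivative v s l) (at s)"
      using DERIV_minus[OF DERIV_levy_exponent_v[OF l, of s]]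
      by (simp add: has_real_derivative_iff_has_vector_derivative)
  qed (use t in auto)
  then show ?thesis using v_init[of l] l by (simp add: integral_unique)
qed

text \<open>Uniqueness of solutions: \<^const>\<open>psi\<close> is nondecreasing, so the squared distance of two
  positive solutions is nonincreasing.\<close>

lemma v_flow:
  assumes l: "l > 0" and s: "s \<ge> 0" and t: "t \<ge> 0"
  shows "v s (v t l) = v (s + t) l"
proof -
  let ?x = "\<lambda>s. v s (v t l)" and ?y = "\<lambda>s. v (s + t) l"
  have vt: "v t l > 0" by (rule v_pos[OF l t])
  have "(?x s - ?y s)\<^sup>2 \<le> (?x 0 - ?y 0)\<^sup>2"
  proof (cases "s = 0")
    case False
    show ?thesis
    proof (rule DERIV_nonpos_imp_decreasing_open[where f = "\<lambda>r. (?x r - ?y r)\<^sup>2"])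
      fix r assume r: "0 < r" "r < s"
      have dy: "(?y has_real_derivative - psi a b n (?y r)) (at r)"
      proof -
        have "((\<lambda>s. v s l) has_real_derivative - psi a b n (v (r + t) l)) (at (r + t))"
          using l r t by (intro DERIV_v) auto
        then show ?thesis by (rule DERIV_shift[THEN iffD1])
      qed
      have dx: "(?x has_real_derivative - psi a b n (?x r)) (at r)"
        using DERIV_v[of "v t l" r] vt r by simp
      have der: "((\<lambda>r. (?x r - ?y r)\<^sup>2) has_real_derivative
          2 * ((?x r - ?y r) * (- psi a b n (?x r) - - psi a b n (?y r)))) (at r)"
        using DERIV_power[OF DERIV_diff[OF dx dy], of 2] by (simp add: algebra_simps)
      have nonpos: "2 * ((?x r - ?y r) * (- psi a b n (?x r) - - psi a b n (?y r))) \<le> 0"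
      proof -
        have "?x r > 0" "?y r > 0" using v_pos vt l r t by auto
        then have "0 \<le> (?x r - ?y r) * (psi a b n (?x r) - psi a b n (?y r))"
          using psi_mono[of "?x r" "?y r"] psi_mono[of "?y r" "?x r"]
          by (cases "?x r \<le> ?y r") (auto intro: mult_nonneg_nonneg mult_nonpos_nonpos)
        then show ?thesis by (simp add: right_diff_distrib)
      qed
      show "\<exists>y. ((\<lambda>r. (?x r - ?y r)\<^sup>2) has_real_derivative y) (at r) \<and> y \<le> 0"
        by (rule exI, rule conjI[OF der nonpos])
    next
      have "continuous_on {0..s} ?y"
      proof (rule continuous_on_compose2[of "{0..s + t}" "\<lambda>r. v r l" "{0..s}" "\<lambda>r. r + t"])
        show "continuous_on {0..s + t} (\<lambda>r. v r l)" using l by (intro continuous_on_v) simp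
        show "continuous_on {0..s} (\<lambda>r. r + t)" by (intro continuous_intros)
      qed (use t in auto)
      moreover have "continuous_on {0..s} ?x" using continuous_on_v vt by simp
      ultimately show "continuous_on {0..s} (\<lambda>r. (?x r - ?y r)\<^sup>2)" by (intro continuous_intros)
    qed (use s in auto)
  qed simp
  also have "(?x 0 - ?y 0)\<^sup>2 = 0" using v_init[of "v t l"] vt by simp
  finally show ?thesis by simp
qed

end

section \<open>The generator on exponentials and the sector constant\<close>

locale cbci_process = cbci_mechanism n \<Lambda> a b v + infinitely_divisible \<Lambda> N \<delta>
  for n \<Lambda> N :: "real measure" and a b \<delta> :: real and v :: "real \<Rightarrow> real \<Rightarrow> real" +
  fixes K :: "real \<Rightarrow> real \<Rightarrow> real measure"
  assumes K_kernel: "\<And>t. t \<ge> 0 \<Longrightarrow> K t \<in> borel \<rightarrow>\<^sub>M prob_algebra borel"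
    and K_supp: "\<And>t x. t \<ge> 0 \<Longrightarrow> x \<ge> 0 \<Longrightarrow> emeasure (K t x) {..<0} = 0"
    and K_Laplace: "\<And>t x l. t \<ge> 0 \<Longrightarrow> x \<ge> 0 \<Longrightarrow> l \<ge> 0 \<Longrightarrow>
        (\<integral>y. exp (- l * y) \<partial>K t x) = exp (- x * v t l - \<delta> * integral {0..t} (\<lambda>s. v s l))"
begin

text \<open>At \<open>l = 0\<close> the hypotheses do not directly say that \<open>v t 0 = 0\<close>; the flow is
  redefined there so that the formulas below hold for all \<open>l \<ge> 0\<close>.\<close>

definition flow :: "real \<Rightarrow> real \<Rightarrow> real" where
  "flow t l = (if l = 0 then 0 else v t l)"

text \<open>For l > 0 this is the immigration factor exp (- \<delta> \<integral> v s l ds) over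
  [0, t], rewritten by \<open>integral_v\<close>. As an increment of \<Phi> it composes along the
  flow by cancellation.\<close>

definition weight :: "real \<Rightarrow> real \<Rightarrow> real" where
  "weight t l = exp (- \<delta> * (levy_exponent \<Lambda> l - levy_exponent \<Lambda> (flow t l)))"

lemma flow_nonneg: "l \<ge> 0 \<Longrightarrow> t \<ge> 0 \<Longrightarrow> flow t l \<ge> 0"
  using v_pos[of l t] by (cases "l = 0") (auto simp: flow_def intro: less_imp_le)

lemma flow_0: "l \<ge> 0 \<Longrightarrow> flow 0 l = l"
  using v_init[of l] by (simp add: flow_def)

lemma flow_flow:
  assumes "l \<ge> 0" "s \<ge> 0" "t \<ge> 0"
  shows "flow s (flow t l) = flow (s + t) l"
  using v_flow[of l s t] v_pos[of l t] assms by (cases "l = 0") (auto simp: flow_def)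

lemma prob_space_K: "t \<ge> 0 \<Longrightarrow> prob_space (K t x)"
  and sets_kernel: "t \<ge> 0 \<Longrightarrow> sets (K t x) = sets borel"
  using measurable_space[OF K_kernel, of t x] by (auto simp: space_prob_algebra)

lemma AE_K_nonneg:
  assumes "t \<ge> 0" "x \<ge> 0"
  shows "AE y in K t x. 0 \<le> y"
proof (rule AE_I)
  show "{y \<in> space (K t x). \<not> 0 \<le> y} \<subseteq> {..<0}" by auto
qed (use K_supp[OF assms] sets_kernel[OF assms(1)] in auto)

lemma integral_K_exp:
  assumes t: "t \<ge> 0" and x: "x \<ge> 0" and l: "l \<ge> 0"
  shows "(\<integral>y. exp (- l * y) \<partial>K t x) = weight t l * exp (- flow t l * x)"
proof (cases "l = 0")
  case True
  interpret Kx: prob_space "K t x" by (rule prob_space_K[OF t])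
  show ?thesis using True by (simp add: Kx.prob_space weight_def flow_def)
next
  case False
  then show ?thesis
    unfolding K_Laplace[OF t x l] using integral_v[of l t] l t
    by (simp add: weight_def flow_def mult.commute flip: exp_add)
qed

lemma integrable_K_exp:
  assumes t: "t \<ge> 0" and x: "x \<ge> 0" and l: "l \<ge> 0"
  shows "integrable (K t x) (\<lambda>y. exp (- l * y))"
proof -
  interpret Kx: prob_space "K t x" by (rule prob_space_K[OF t])
  have "(\<lambda>y. exp (- l * y)) \<in> borel_measurable borel" by measurable
  then have "(\<lambda>y. exp (- l * y)) \<in> borel_measurable (K t x)"
    using sets_kernel[OF t, of x] by (simp cong: measurable_cong_sets)
  moreover have "AE y in K t x. norm (exp (- l * y)) \<le> 1"
    using AE_K_nonneg[OF t x] by eventually_elim (use l in simp)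
  ultimately show ?thesis by (intro Kx.integrable_const_bound[where B = 1]) auto
qed

lemma integral_K_expsum:
  assumes t: "t \<ge> 0" and x: "x \<ge> 0" and l: "\<forall>i<m. l i \<ge> 0"
  shows "(\<integral>y. expsum m c l y \<partial>K t x) = expsum m (\<lambda>i. c i * weight t (l i)) (\<lambda>i. flow t (l i)) x"
proof -
  have "(\<integral>y. expsum m c l y \<partial>K t x) = (\<Sum>i<m. \<integral>y. c i * exp (- l i * y) \<partial>K t x)"
    unfolding expsum_def using l
    by (intro Bochner_Integration.integral_sum integrable_mult_right integrable_K_exp t x) auto
  also have "\<dots> = (\<Sum>i<m. c i * (weight t (l i) * exp (- flow t (l i) * x)))"
    using l by (intro sum.cong refl) (simp only: integral_mult_right_zero integral_K_exp[OF t x] lessThan_iff)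
  finally show ?thesis by (simp add: expsum_def mult.assoc)
qed

lemma real_distribution_N: "real_distribution N"
  by (intro real_distribution.intro real_distribution_axioms.intro sets_N prob_space_axioms)

text \<open>At the level of Laplace transforms the weight exp (- \<delta> (\<Phi>(l) -
  \<Phi>(flow))) meets exp (- \<delta> \<Phi>(flow)), leaving exp (- \<delta> \<Phi>(l)); uniqueness
  of the transform concludes.\<close>

lemma bind_K: "t \<ge> 0 \<Longrightarrow> N \<bind> K t = N"
proof -
  assume t: "t \<ge> 0"
  have N_alg: "N \<in> space (prob_algebra borel)"
    using sets_N prob_space_axioms by (simp add: space_prob_algebra)
  have KN: "K t \<in> N \<rightarrow>\<^sub>M subprob_algebra borel"
    using measurable_prob_algebraD[OF K_kernel[OF t]] sets_N by (simp cong: measurable_cong_sets)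
  show ?thesis
  proof (rule laplace_unique)
    show "real_distribution (N \<bind> K t)"
      using prob_space_bind'[OF N_alg K_kernel[OF t]] sets_bind'[OF N_alg K_kernel[OF t]]
      by (intro real_distribution.intro real_distribution_axioms.intro)
    show "real_distribution N" by (rule real_distribution_N)
    show "AE x in N. 0 \<le> x" by (rule AE_nonneg)
    have "AE x in N. AE y in K t x. 0 \<le> y"
      using AE_nonneg by eventually_elim (rule AE_K_nonneg[OF t])
    then show "AE x in N \<bind> K t. 0 \<le> x"
      by (subst AE_bind[OF KN]) auto
    fix i :: nat
    let ?l = "real i"
    have l: "?l \<ge> 0" by simp
    have "(\<integral>\<^sup>+ x. ennreal (exp (- ?l * x)) \<partial>(N \<bind> K t)) = (\<integral>\<^sup>+ x. \<integral>\<^sup>+ y. ennreal (exp (- ?l * y)) \<partial>K t x \<partial>N)"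
      by (rule nn_integral_bind[OF _ KN]) measurable
    also have "\<dots> = (\<integral>\<^sup>+ x. ennreal (weight t ?l) * ennreal (exp (- flow t ?l * x)) \<partial>N)"
    proof (rule nn_integral_cong_AE)
      show "AE x in N. (\<integral>\<^sup>+ y. ennreal (exp (- ?l * y)) \<partial>K t x) = ennreal (weight t ?l) * ennreal (exp (- flow t ?l * x))"
        using AE_nonneg
      proof eventually_elim
        fix x :: real assume x: "0 \<le> x"
        have "(\<integral>\<^sup>+ y. ennreal (exp (- ?l * y)) \<partial>K t x) = ennreal (\<integral>y. exp (- ?l * y) \<partial>K t x)"
          by (intro nn_integral_eq_integral integrable_K_exp t x l) simp
        then show "(\<integral>\<^sup>+ y. ennreal (exp (- ?l * y)) \<partial>K t x) = ennreal (weight t ?l) * ennreal (exp (- flow t ?l * x))"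
          unfolding integral_K_exp[OF t x l] by (simp add: ennreal_mult' weight_def)
      qed
    qed
    also have "\<dots> = ennreal (weight t ?l) * ennreal (exp (- \<delta> * levy_exponent \<Lambda> (flow t ?l)))"
      unfolding laplace_nn[OF flow_nonneg[OF l t], symmetric]
      by (rule nn_integral_cmult) measurable
    also have "\<dots> = ennreal (exp (- \<delta> * levy_exponent \<Lambda> ?l))"
      unfolding weight_def by (subst ennreal_mult'[symmetric]) (simp_all add: algebra_simps flip: exp_add)
    also have "\<dots> = (\<integral>\<^sup>+ x. ennreal (exp (- ?l * x)) \<partial>N)" by (rule laplace_nn[OF l, symmetric])
    finally have eq: "(\<integral>\<^sup>+ x. ennreal (exp (- ?l * x)) \<partial>(N \<bind> K t)) = (\<integral>\<^sup>+ x. ennreal (exp (- ?l * x)) \<partial>N)" .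
    have meas: "(\<lambda>x. exp (- ?l * x)) \<in> borel_measurable (N \<bind> K t)"
      "(\<lambda>x. exp (- ?l * x)) \<in> borel_measurable N"
      using sets_bind'[OF N_alg K_kernel[OF t]] sets_N by (simp_all cong: measurable_cong_sets)
    show "(\<integral>x. exp (- ?l * x) \<partial>(N \<bind> K t)) = (\<integral>x. exp (- ?l * x) \<partial>N)"
      using eq meas by (simp only: integral_eq_nn_integral AE_I2 exp_ge_zero simp_thms)
  qed
qed

lemma stationary_kernel_K: "stationary_kernel K N"
  by (intro stationary_kernel.intro real_distribution_N K_kernel bind_K)

end

sublocale cbci_process \<subseteq> S: stationary_kernel K N
  by (rule stationary_kernel_K)

context cbci_process
begin

section \<open>Semigroup and generator on exponentials\<close>

lemma P_expsum:
  "t \<ge> 0 \<Longrightarrow> x \<ge> 0 \<Longrightarrow> \<forall>i<m. l i \<ge> 0 \<Longrightarrow>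
    S.P t (expsum m c l) x = expsum m (\<lambda>i. c i * weight t (l i)) (\<lambda>i. flow t (l i)) x"
  unfolding S.P_def by (rule integral_K_expsum)

lemma P_exp: "t \<ge> 0 \<Longrightarrow> x \<ge> 0 \<Longrightarrow> l \<ge> 0 \<Longrightarrow> S.P t (\<lambda>x. exp (- l * x)) x = weight t l * exp (- flow t l * x)"
  unfolding S.P_def by (rule integral_K_exp)

text \<open>The formal generator applied to exp (- l x): the diffusion, drift and jump terms add up
  to x \<psi>(l), and immigration contributes - \<delta> l.\<close>

definition generator_exp :: "real \<Rightarrow> real \<Rightarrow> real" where
  "generator_exp l x = (x * psi a b n l - \<delta> * l) * exp (- l * x)"

lemma psi_0: "psi a b n 0 = 0"
  by (simp add: psi_eq_rate)

lemma levy_exponent_mono: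
  assumes "0 \<le> l" "l \<le> k"
  shows "levy_exponent \<Lambda> l \<le> levy_exponent \<Lambda> k"
  unfolding levy_exponent_def
proof (rule integral_mono_AE)
  show "integrable \<Lambda> (\<lambda>x. 1 - exp (- l * x))" "integrable \<Lambda> (\<lambda>x. 1 - exp (- k * x))"
    using assms by (intro integrable_one_minus_exp_neg; simp)+
  show "AE x in \<Lambda>. 1 - exp (- l * x) \<le> 1 - exp (- k * x)"
    using pos by eventually_elim (use assms in \<open>simp add: mult_right_mono\<close>)
qed

text \<open>A bound uniform in x and t, for dominated convergence. By the mean value theorem the
  quotient is a time derivative at some s < t. Since v is nonincreasing, v s l \<ge> l / 2, which
  leaves the decay exp (- l x / 2) to absorb the factor x; this gives 2 / l.\<close>

lemma P_exp_increment_bound: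
  assumes l: "l > 0" and x: "x \<ge> 0" and t: "t > 0" and vt: "v t l \<ge> l / 2"
  shows "\<bar>S.quotient t (\<lambda>x. exp (- l * x)) x\<bar> \<le> psi a b n l * (2 / l) + \<delta> * l"
proof -
  define \<phi> where "\<phi> s = exp (- \<delta> * (levy_exponent \<Lambda> l - levy_exponent \<Lambda> (v s l))) * exp (- v s l * x)" for s
  have \<phi>_eq: "S.P s (\<lambda>x. exp (- l * x)) x = \<phi> s" if "s \<ge> 0" for s
    using P_exp[OF that x] l by (simp add: \<phi>_def weight_def flow_def)
  have \<phi>0: "\<phi> 0 = exp (- l * x)" using l v_init[of l] by (simp add: \<phi>_def)
  have der: "(\<phi> has_real_derivative \<phi> s * (x * psi a b n (v s l) - \<delta> * v s l)) (at s)" if "s > 0" for s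
  proof -
    note d1 = DERIV_levy_exponent_v[OF l that] and d2 = DERIV_v[OF less_imp_le[OF l] that]
    show ?thesis unfolding \<phi>_def
      by (rule derivative_eq_intros d1 d2 refl)+ (simp add: algebra_simps)
  qed
  have cont: "continuous_on {0..t} \<phi>"
    unfolding \<phi>_def using continuous_on_levy_exponent_v[OF l, of t] continuous_on_v[of l t] l
    by (intro continuous_intros) auto
  obtain s where s: "0 < s" "s < t" "\<phi> t - \<phi> 0 = (t - 0) * (\<phi> s * (x * psi a b n (v s l) - \<delta> * v s l))"
  proof -
    have "\<exists>D z. 0 < z \<and> z < t \<and> (\<phi> has_real_derivative D) (at z) \<and> \<phi> t - \<phi> 0 = (t - 0) * D"
      using der by (intro MVT[OF t cont]) (auto simp: real_differentiable_def)
    then obtain D z where z: "0 < z" "z < t" "(\<phi> has_real_derivative D) (at z)" "\<phi> t - \<phi> 0 = (t - 0) * D"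
      by blast
    then show ?thesis using that[of z] DERIV_unique[OF z(3) der[OF z(1)]] by simp
  qed
  have vs: "v s l > 0" "v s l \<le> l" "v s l \<ge> l / 2"
    using v_pos[OF l, of s] v_le[OF l, of s] v_antimono[OF l, of s t] s vt by auto
  have "\<bar>S.quotient t (\<lambda>x. exp (- l * x)) x\<bar> = \<bar>\<phi> s * (x * psi a b n (v s l) - \<delta> * v s l)\<bar>"
    unfolding S.quotient_def using \<phi>_eq[of t] t \<phi>0 s(3) by simp
  also have "\<dots> \<le> exp (- (l / 2) * x) * (x * psi a b n l + \<delta> * l)"
    unfolding abs_mult
  proof (rule mult_mono)
    have "levy_exponent \<Lambda> (v s l) \<le> levy_exponent \<Lambda> l"
      using vs by (intro levy_exponent_mono) auto
    then have "exp (- \<delta> * (levy_exponent \<Lambda> l - levy_exponent \<Lambda> (v s l))) \<le> 1"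
      using \<delta>_pos by (simp add: mult_nonneg_nonneg)
    moreover have "exp (- v s l * x) \<le> exp (- (l / 2) * x)"
      using mult_right_mono[OF vs(3) x] by simp
    ultimately have "\<phi> s \<le> 1 * exp (- (l / 2) * x)" unfolding \<phi>_def by (intro mult_mono) auto
    then show "\<bar>\<phi> s\<bar> \<le> exp (- (l / 2) * x)" by (simp add: \<phi>_def)
    have "0 \<le> x * psi a b n (v s l)" "x * psi a b n (v s l) \<le> x * psi a b n l" "0 \<le> \<delta> * v s l" "\<delta> * v s l \<le> \<delta> * l"
      using vs x \<delta>_pos psi_nonneg[of "v s l"] psi_mono[of "v s l" l] by (auto intro: mult_left_mono)
    then show "\<bar>x * psi a b n (v s l) - \<delta> * v s l\<bar> \<le> x * psi a b n l + \<delta> * l" by linarith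
  qed auto
  also have "\<dots> = psi a b n l * (x * exp (- (l / 2) * x)) + (\<delta> * l) * exp (- (l / 2) * x)"
    by (simp add: algebra_simps)
  also have "\<dots> \<le> psi a b n l * (2 / l) + (\<delta> * l) * 1"
    using mult_exp_neg_le[of "l / 2" x] l x psi_nonneg[of l] \<delta>_pos
    by (intro add_mono mult_left_mono) auto
  finally show ?thesis by simp
qed

text \<open>At time 0 the differential equation gives only a one-sided derivative, so the chain rule
  is applied within {0..}.\<close>

lemma quotient_exp_tendsto:
  assumes l: "l > 0" and x: "x \<ge> 0"
  shows "((\<lambda>t. S.quotient t (\<lambda>x. exp (- l * x)) x) \<longlongrightarrow> generator_exp l x) (at_right 0)"
proof -
  define \<phi> where "\<phi> s = exp (- \<delta> * (levy_exponent \<Lambda> l - levy_exponent \<Lambda> (v s l))) * exp (- v s l * x)" for s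
  have v0: "v 0 l = l" using l v_init[of l] by simp
  have d2: "((\<lambda>s. v s l) has_real_derivative - psi a b n l) (at 0 within {0..})"
    using v_ode[of l 0] l v0 by simp
  have "(levy_exponent \<Lambda> has_real_derivative 1 / rate a b n l) (at (v 0 l))"
    using DERIV_levy_exponent[OF l] v0 by simp
  from DERIV_chain2[OF this d2]
  have d1: "((\<lambda>s. levy_exponent \<Lambda> (v s l)) has_real_derivative - l) (at 0 within {0..})"
    using l rate_pos[OF l] by (simp add: psi_eq_rate)
  have "(\<phi> has_real_derivative generator_exp l x) (at 0 within {0..})"
    unfolding \<phi>_def generator_exp_def
    by (rule derivative_eq_intros d1 d2 refl)+ (simp add: v0 algebra_simps)
  then have lim: "((\<lambda>t. (\<phi> t - \<phi> 0) / (t - 0)) \<longlongrightarrow> generator_exp l x) (at_right 0)"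
    by (simp add: has_field_derivative_iff at_within_Ici_at_right)
  have "\<phi> 0 = exp (- l * x)" by (simp add: \<phi>_def v0)
  have "(\<phi> t - \<phi> 0) / (t - 0) = S.quotient t (\<lambda>x. exp (- l * x)) x" if "t > 0" for t
    using P_exp[of t x l] that x l v0 by (simp add: S.quotient_def \<phi>_def weight_def flow_def)
  then have "\<forall>\<^sub>F t in at_right 0. (\<phi> t - \<phi> 0) / (t - 0) = S.quotient t (\<lambda>x. exp (- l * x)) x"
    by (intro eventually_mono[OF eventually_at_right_less[of "0::real"]])
  from Lim_transform_eventually[OF lim this] show ?thesis .
qed

lemma abs_generator_exp_le:
  assumes l: "l > 0" and x: "x \<ge> 0"
  shows "\<bar>generator_exp l x\<bar> \<le> psi a b n l * (1 / l) + \<delta> * l"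
proof -
  have p: "psi a b n l \<ge> 0" using psi_nonneg[of l] l by simp
  have "\<bar>generator_exp l x\<bar> \<le> psi a b n l * (x * exp (- l * x)) + \<delta> * l * exp (- l * x)"
  proof -
    have "generator_exp l x = psi a b n l * (x * exp (- l * x)) - \<delta> * l * exp (- l * x)"
      by (simp add: generator_exp_def algebra_simps)
    moreover have "0 \<le> psi a b n l * (x * exp (- l * x))" "0 \<le> \<delta> * l * exp (- l * x)"
      using p x l \<delta>_pos by simp_all
    ultimately show ?thesis by linarith
  qed
  also have "\<dots> \<le> psi a b n l * (1 / l) + \<delta> * l * 1"
    using mult_exp_neg_le[OF l, of x] p x l \<delta>_pos by (intro add_mono mult_left_mono) auto
  finally show ?thesis by simp
qed

lemma generator_exp_0: "generator_exp 0 = (\<lambda>x. 0)"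
  by (auto simp: generator_exp_def psi_0)

lemma borel_measurable_generator_exp [measurable]: "generator_exp l \<in> borel_measurable borel"
  unfolding generator_exp_def[abs_def] by measurable

lemma in_L2_exp:
  assumes "l \<ge> 0"
  shows "in_L2 N (\<lambda>x. exp (- l * x))"
proof (rule in_L2_bounded[where B = 1])
  show "AE x in N. \<bar>exp (- l * x)\<bar> \<le> 1"
    using AE_nonneg by eventually_elim (use assms in simp)
qed measurable

lemma in_L2_generator_exp:
  assumes "l \<ge> 0"
  shows "in_L2 N (generator_exp l)"
proof (cases "l = 0")
  case False
  then have l: "l > 0" using assms by simp
  show ?thesis
  proof (rule in_L2_bounded)
    show "AE x in N. \<bar>generator_exp l x\<bar> \<le> psi a b n l * (1 / l) + \<delta> * l"
      using AE_nonneg by eventually_elim (rule abs_generator_exp_le[OF l])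
  qed measurable
qed (simp add: generator_exp_0 in_L2_def)

text \<open>Pointwise convergence on the nonnegative half-line, together with a constant bound on a
  probability space, gives convergence in L^2. The constant \<open>B\<close> adds the bounds for the
  quotient and for its limit; \<open>T\<close> secures v t l \<ge> l / 2.\<close>

lemma generator_exp_L2_pos:
  assumes l: "l > 0"
  shows "L2_generator K N (\<lambda>x. exp (- l * x)) (generator_exp l)"
proof -
  note sq = in_L2_exp[OF less_imp_le[OF l]] in_L2_generator_exp[OF less_imp_le[OF l]]
  let ?e = "\<lambda>x. exp (- l * x)"
  define B where "B = (psi a b n l * (2 / l) + \<delta> * l) + (psi a b n l * (1 / l) + \<delta> * l)"
  have "continuous_on {0..1} (\<lambda>s. v s l)" using l by (intro continuous_on_v) simp
  then have "((\<lambda>s. v s l) \<longlongrightarrow> v 0 l) (at 0 within {0..1})" by (simp add: continuous_on_def)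
  then have "((\<lambda>s. v s l) \<longlongrightarrow> l) (at_right 0)"
    using v_init[of l] l at_within_Icc_at_right[of "0::real" 1] by simp
  then have "\<forall>\<^sub>F t in at_right 0. v t l > l / 2"
    using l by (intro order_tendstoD) auto
  then obtain T where T: "T > 0" "\<And>t. 0 < t \<Longrightarrow> t < T \<Longrightarrow> v t l > l / 2"
    unfolding eventually_at_right_field by auto
  have "((\<lambda>t. \<integral>x. (S.quotient t ?e x - generator_exp l x)\<^sup>2 \<partial>N) \<longlongrightarrow> 0) (at_right 0)"
  proof (rule tendsto_at_right_sequentially[OF T(1)])
    fix \<tau> :: "nat \<Rightarrow> real" assume \<tau>: "\<And>k. 0 < \<tau> k" "\<And>k. \<tau> k < T" "\<tau> \<longlonglongrightarrow> 0"
    have right: "filterlim \<tau> (at_right 0) sequentially"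
      using \<tau> by (intro tendsto_imp_filterlim_at_right) auto
    have "(\<lambda>k. \<integral>x. (S.quotient (\<tau> k) ?e x - generator_exp l x)\<^sup>2 \<partial>N) \<longlonglongrightarrow> (\<integral>x. 0 \<partial>N)"
    proof (rule integral_dominated_convergence[where w = "\<lambda>_. B\<^sup>2"])
      show "(\<lambda>x. (S.quotient (\<tau> k) ?e x - generator_exp l x)\<^sup>2) \<in> borel_measurable N" for k
        using in_L2_diff[OF S.in_L2_quotient[OF less_imp_le[OF \<tau>(1)] sq(1)] sq(2), of k]
        by (intro borel_measurable_power in_L2_measurable)
      show "AE x in N. (\<lambda>k. (S.quotient (\<tau> k) ?e x - generator_exp l x)\<^sup>2) \<longlonglongrightarrow> 0"
        using AE_nonneg
      proof eventually_elim
        fix x :: real assume "0 \<le> x"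
        from filterlim_compose[OF quotient_exp_tendsto[OF l this] right]
        have "(\<lambda>k. (S.quotient (\<tau> k) ?e x - generator_exp l x)\<^sup>2) \<longlonglongrightarrow> (generator_exp l x - generator_exp l x)\<^sup>2"
          by (intro tendsto_power tendsto_diff tendsto_const)
        then show "(\<lambda>k. (S.quotient (\<tau> k) ?e x - generator_exp l x)\<^sup>2) \<longlonglongrightarrow> 0" by simp
      qed
      show "AE x in N. norm ((S.quotient (\<tau> k) ?e x - generator_exp l x)\<^sup>2) \<le> B\<^sup>2" for k
        using AE_nonneg
      proof eventually_elim
        fix x :: real assume x: "0 \<le> x"
        have "\<bar>S.quotient (\<tau> k) ?e x - generator_exp l x\<bar> \<le> B"
          using P_exp_increment_bound[OF l x \<tau>(1) less_imp_le[OF T(2)[OF \<tau>(1,2)]], of k] abs_generator_exp_le[OF l x]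
          unfolding B_def by linarith
        then have "\<bar>S.quotient (\<tau> k) ?e x - generator_exp l x\<bar>\<^sup>2 \<le> B\<^sup>2" by (intro power_mono) auto
        then show "norm ((S.quotient (\<tau> k) ?e x - generator_exp l x)\<^sup>2) \<le> B\<^sup>2" by simp
      qed
    qed auto
    then show "(\<lambda>k. \<integral>x. (S.quotient (\<tau> k) ?e x - generator_exp l x)\<^sup>2 \<partial>N) \<longlonglongrightarrow> 0" by simp
  qed
  from tendsto_real_sqrt[OF this]
  have "((\<lambda>t. L2_norm N (\<lambda>x. S.quotient t ?e x - generator_exp l x)) \<longlongrightarrow> 0) (at_right 0)"
    by (simp add: L2_norm_def)
  then show ?thesis using sq by (simp add: S.L2_generator_iff)
qed

lemma generator_exp_L2:
  assumes l: "l \<ge> 0"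
  shows "L2_generator K N (\<lambda>x. exp (- l * x)) (generator_exp l)"
proof (cases "l = 0")
  case True
  have "S.P t (\<lambda>x. 1) x = 1" if "t \<ge> 0" for t x
    using prob_space.prob_space[OF prob_space_K[OF that]] by (simp add: S.P_def)
  then have "S.quotient t (\<lambda>x. 1) x = 0" if "t > 0" for t x
    using that by (simp add: S.quotient_def)
  then have "\<forall>\<^sub>F t in at_right 0. L2_norm N (\<lambda>x. S.quotient t (\<lambda>x. 1) x - 0) = 0"
    by (intro eventually_mono[OF eventually_at_right_less[of "0::real"]]) (simp add: L2_norm_def)
  then have "((\<lambda>t. L2_norm N (\<lambda>x. S.quotient t (\<lambda>x. 1) x - 0)) \<longlongrightarrow> 0) (at_right 0)"
    by (rule tendsto_eventually)
  then show ?thesis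
    using True by (simp add: S.L2_generator_iff generator_exp_0 in_L2_def)
qed (use assms generator_exp_L2_pos in auto)

definition gensum :: "nat \<Rightarrow> (nat \<Rightarrow> real) \<Rightarrow> (nat \<Rightarrow> real) \<Rightarrow> real \<Rightarrow> real" where
  "gensum m c l x = (\<Sum>i<m. c i * generator_exp (l i) x)"

text \<open>Pairs are built from one common list of coefficients and exponents, so the generator
  value need not be shown independent of the way a function is written as a sum.\<close>

definition exp_graph :: "((real \<Rightarrow> real) \<times> (real \<Rightarrow> real)) set" where
  "exp_graph = {(expsum m c l, gensum m c l) | m c l. \<forall>i<m. l i \<ge> 0}"

end

text \<open>Cauchy-Schwarz for sqrt x f'(x) and sqrt x g'(x); the identification with the weight x
  holds almost everywhere because \<open>M\<close> lives on x \<ge> 0.\<close>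

lemma (in levy_measure) D_form_Cauchy_Schwarz:
  assumes l: "\<forall>i<m. l i \<ge> 0" and k: "\<forall>j<p. k j \<ge> 0"
  shows "(laplace_form M m p (D_coeff c l d k) l k)\<^sup>2 \<le> Dterm M (expsum m c l) * Dterm M (expsum p d k)"
proof -
  define u w where "u x = sqrt x * deriv (expsum m c l) x" and "w x = sqrt x * deriv (expsum p d k) x" for x
  have "(\<lambda>x. deriv (expsum m c l) x) \<in> borel_measurable borel" "(\<lambda>x. deriv (expsum p d k) x) \<in> borel_measurable borel"
    unfolding deriv_expsum by measurable
  then have meas [measurable]: "u \<in> borel_measurable M" "w \<in> borel_measurable M"
      "(\<lambda>x. deriv (expsum m c l) x) \<in> borel_measurable M" "(\<lambda>x. deriv (expsum p d k) x) \<in> borel_measurable M"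
    unfolding u_def[abs_def] w_def[abs_def] by measurable
  have eqs: "AE x in M. (u x)\<^sup>2 = x * (deriv (expsum m c l) x * deriv (expsum m c l) x)"
    "AE x in M. (w x)\<^sup>2 = x * (deriv (expsum p d k) x * deriv (expsum p d k) x)"
    "AE x in M. u x * w x = x * (deriv (expsum m c l) x * deriv (expsum p d k) x)"
    using pos by (eventually_elim, simp add: u_def w_def power2_eq_square)+
  have int: "integrable M (\<lambda>x. (u x)\<^sup>2)" "integrable M (\<lambda>x. (w x)\<^sup>2)"
    by (subst integrable_cong_AE[OF _ _ eqs(1)]; (intro D_form l | measurable))
       (subst integrable_cong_AE[OF _ _ eqs(2)]; (intro D_form k | measurable))
  have "(\<integral>x. u x * w x \<partial>M) = laplace_form M m p (D_coeff c l d k) l k"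
    unfolding D_form(2)[OF l k, symmetric] by (intro integral_cong_AE eqs(3)) measurable
  moreover have "(\<integral>x. (u x)\<^sup>2 \<partial>M) = Dterm M (expsum m c l)" "(\<integral>x. (w x)\<^sup>2 \<partial>M) = Dterm M (expsum p d k)"
    unfolding Dterm_def power2_eq_square[of "deriv _ _"] by (intro integral_cong_AE eqs(1,2); measurable)+
  ultimately show ?thesis
    using integral_Cauchy_Schwarz[OF meas(1,2) int] by simp
qed

context cbci_process
begin

lemma gensum_cmult: "(\<lambda>x. c * gensum m d l x) = gensum m (\<lambda>i. c * d i) l"
  by (auto simp: gensum_def sum_distrib_left mult_ac)

lemma gensum_add:
  "(\<lambda>x. gensum m c l x + gensum p d k x)
    = gensum (m + p) (\<lambda>i. if i < m then c i else d (i - m)) (\<lambda>i. if i < m then l i else k (i - m))"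
  by (auto simp: gensum_def sum_lessThan_add)

lemma L2_generator_expsum:
  "\<forall>i<m. l i \<ge> 0 \<Longrightarrow> L2_generator K N (expsum m c l) (gensum m c l)"
proof (induction m)
  case 0
  then show ?case
    using S.L2_generator_cmult[OF generator_exp_L2[of 0], of 0] by (simp add: expsum_def[abs_def] gensum_def[abs_def])
next
  case (Suc m)
  then have "L2_generator K N (\<lambda>x. expsum m c l x + c m * exp (- l m * x)) (\<lambda>x. gensum m c l x + c m * generator_exp (l m) x)"
    by (intro S.L2_generator_add S.L2_generator_cmult generator_exp_L2) auto
  then show ?case by (simp add: expsum_def[abs_def] gensum_def[abs_def])
qed

text \<open>Every identity for \<open>P\<close> is proved for starting points x \<ge> 0 and hence
  \<open>N\<close>-almost everywhere; the kernels at negative x are arbitrary. Composition of two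
  time steps reduces to \<open>flow_flow\<close> and cancellation in \<open>weight\<close>.\<close>

lemma generator_core_exp_graph: "generator_core K N exp_graph"
proof (intro generator_core.intro stationary_kernel_K generator_core_axioms.intro)
  fix f h assume "(f, h) \<in> exp_graph"
  then obtain m c l where fh: "f = expsum m c l" "h = gensum m c l" and l: "\<forall>i<m. l i \<ge> 0"
    by (auto simp: exp_graph_def)
  have l0: "l i \<ge> 0" if "i < m" for i using l that by simp
  show "L2_generator K N f h" unfolding fh by (rule L2_generator_expsum[OF l])
  show "(\<lambda>x. c * f x, \<lambda>x. c * h x) \<in> exp_graph" for c
    unfolding fh expsum_cmult gensum_cmult exp_graph_def using l by blast
  show "(\<lambda>x. f x + u x, \<lambda>x. h x + w x) \<in> exp_graph" if uw_graph: "(u, w) \<in> exp_graph" for u w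
  proof -
    obtain p d k where uw: "u = expsum p d k" "w = gensum p d k" and k: "\<forall>j<p. k j \<ge> 0"
      using uw_graph by (auto simp: exp_graph_def)
    have "\<forall>i<m+p. 0 \<le> (if i < m then l i else k (i - m))" using l k by auto
    then show ?thesis unfolding fh uw expsum_add gensum_add exp_graph_def by blast
  qed
  have flow: "\<forall>i<m. flow t (l i) \<ge> 0" if "t \<ge> 0" for t using l flow_nonneg that by simp
  show "\<exists>f' h'. (f', h') \<in> exp_graph \<and> (AE x in N. f' x = S.P t f x)" if t: "t \<ge> 0" for t
  proof (intro exI conjI)
    show "(expsum m (\<lambda>i. c i * weight t (l i)) (\<lambda>i. flow t (l i)),
        gensum m (\<lambda>i. c i * weight t (l i)) (\<lambda>i. flow t (l i))) \<in> exp_graph"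
      using flow[OF t] unfolding exp_graph_def by blast
    show "AE x in N. expsum m (\<lambda>i. c i * weight t (l i)) (\<lambda>i. flow t (l i)) x = S.P t f x"
      using AE_nonneg by eventually_elim (simp add: fh P_expsum[OF t _ l])
  qed
  show "AE x in N. S.P 0 f x = f x"
    using AE_nonneg
  proof eventually_elim
    fix x :: real assume "0 \<le> x"
    from P_expsum[OF order_refl this l] show "S.P 0 f x = f x"
      unfolding fh using l0 by (simp add: expsum_def flow_0 weight_def)
  qed
  show "AE x in N. S.P s (S.P t f) x = S.P (s + t) f x" if s: "s \<ge> 0" and t: "t \<ge> 0" for s t
    using AE_nonneg
  proof eventually_elim
    fix x :: real assume x: "0 \<le> x"
    let ?f' = "expsum m (\<lambda>i. c i * weight t (l i)) (\<lambda>i. flow t (l i))"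
    have "f \<in> borel_measurable borel" unfolding fh by measurable
    then have meas: "S.P t f \<in> borel_measurable (K s x)" "?f' \<in> borel_measurable (K s x)"
      using S.measurable_P[OF t] sets_kernel[OF s, of x] by (simp_all cong: measurable_cong_sets)
    \<comment> \<open>The explicit formula for P t f may be inserted under \<open>K s x\<close>
      because this measure, for x \<ge> 0, does not charge negative y.\<close>
    have "AE y in K s x. S.P t f y = ?f' y"
      using AE_K_nonneg[OF s x] by eventually_elim (simp add: fh P_expsum[OF t _ l])
    then have "S.P s (S.P t f) x = S.P s ?f' x"
      unfolding S.P_def[of s] using meas by (intro integral_cong_AE) auto
    also have "\<dots> = expsum m (\<lambda>i. c i * weight t (l i) * weight s (flow t (l i))) (\<lambda>i. flow s (flow t (l i))) x"
      by (rule P_expsum[OF s x flow[OF t]])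
    also have "\<dots> = expsum m (\<lambda>i. c i * weight (s + t) (l i)) (\<lambda>i. flow (s + t) (l i)) x"
      unfolding expsum_def
    proof (intro sum.cong refl)
      fix i assume "i \<in> {..<m}"
      then have "flow s (flow t (l i)) = flow (s + t) (l i)" using flow_flow[OF l0 s t] by simp
      then show "c i * weight t (l i) * weight s (flow t (l i)) * exp (- flow s (flow t (l i)) * x)
          = c i * weight (s + t) (l i) * exp (- flow (s + t) (l i) * x)"
        by (simp add: weight_def algebra_simps flip: exp_add)
    qed
    also have "\<dots> = S.P (s + t) f x"
      unfolding fh using P_expsum[OF _ x l, of "s + t"] s t by simp
    finally show "S.P s (S.P t f) x = S.P (s + t) f x" .
  qed
next
  fix f and \<epsilon> :: real assume "in_L2 N f" "\<epsilon> > 0"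
  then obtain g where g: "g \<in> F0" "L2_norm N (\<lambda>x. f x - g x) < \<epsilon>"
    using F0_dense[OF real_distribution_N AE_nonneg] by blast
  then obtain m c l where "g = expsum m c l" "\<forall>i<m. l i \<ge> 0" by (auto simp: F0_eq)
  then show "\<exists>(u, w)\<in>exp_graph. L2_norm N (\<lambda>x. f x - u x) < \<epsilon>"
    using g by (intro bexI[of _ "(expsum m c l, gensum m c l)"]) (auto simp: exp_graph_def)
qed

text \<open>The immigration term is \<delta> l times a Laplace transform, the branching term
  \<psi>(l) times a moment. Expressing the former by the same moment leaves l (R(l + k) - R(l)), in
  which b cancels and a contributes a l k.\<close>

lemma form_exp:
  assumes l: "l \<ge> 0" and k: "k \<ge> 0"
  shows "integrable N (\<lambda>x. - generator_exp l x * exp (- k * x))"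
    and "(\<integral>x. - generator_exp l x * exp (- k * x) \<partial>N)
      = (a * (l * k) + l * (tail_exponent n (l + k) - tail_exponent n l)) * laplace1 N (l + k)"
proof -
  show "integrable N (\<lambda>x. - generator_exp l x * exp (- k * x))"
    using in_L2_mult[OF in_L2_generator_exp[OF l] in_L2_exp[OF k]] by simp
  show "(\<integral>x. - generator_exp l x * exp (- k * x) \<partial>N)
      = (a * (l * k) + l * (tail_exponent n (l + k) - tail_exponent n l)) * laplace1 N (l + k)"
  proof (cases "l = 0")
    case False
    then have lk: "l + k > 0" using l k by simp
    interpret NL: levy_measure N by (rule levy_measure_N)
    have eq: "- generator_exp l x * exp (- k * x)
        = \<delta> * l * exp (- (l + k) * x) - psi a b n l * (x * exp (- (l + k) * x))" for x
      unfolding generator_exp_def exp_neg_add_mult by (simp add: algebra_simps)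
    have "(\<integral>x. - generator_exp l x * exp (- k * x) \<partial>N)
        = \<delta> * l * (\<integral>x. exp (- (l + k) * x) \<partial>N) - psi a b n l * laplace1 N (l + k)"
    proof -
      have "integrable N (\<lambda>x. \<delta> * l * exp (- (l + k) * x))"
        "integrable N (\<lambda>x. psi a b n l * (x * exp (- (l + k) * x)))"
        using lk by (intro integrable_mult_right integrable_exp_neg NL.integrable_mult_exp_neg; simp)+
      then show ?thesis
        unfolding eq laplace1_def by (simp only: Bochner_Integration.integral_diff integral_mult_right_zero)
    qed
    \<comment> \<open>Combines m of \<open>N\<close> = \<delta> exp (- \<delta> \<Phi>) m of
      \<Lambda> with m of \<Lambda> = 1 / R.\<close>
    also have "\<delta> * (\<integral>x. exp (- (l + k) * x) \<partial>N) = rate a b n (l + k) * laplace1 N (l + k)"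
      using laplace[of "l + k"] lk rate_pos[OF lk] unfolding laplace1_eq[OF lk] laplace1_eq_rate[OF lk] by simp
    then have "\<delta> * l * (\<integral>x. exp (- (l + k) * x) \<partial>N) = l * rate a b n (l + k) * laplace1 N (l + k)"
      by (metis mult.assoc mult.left_commute)
    finally show ?thesis
      unfolding psi_eq_rate[OF l] rate_def by (simp add: algebra_simps)
  qed (simp add: generator_exp_0)
qed

lemma form_expsum:
  assumes l: "\<forall>i<m. l i \<ge> 0" and k: "\<forall>j<p. k j \<ge> 0"
  shows "(\<integral>x. - gensum m c l x * expsum p d k x \<partial>N)
      = a * laplace_form N m p (D_coeff c l d k) l k + Bform n N (expsum m c l) (expsum p d k)"
proof -
  interpret NL: levy_measure N by (rule levy_measure_N)
  interpret FN: branching_forms n N ..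
  have eq: "- gensum m c l x * expsum p d k x
      = (\<Sum>i<m. \<Sum>j<p. (c i * d j) * (- generator_exp (l i) x * exp (- k j * x)))" for x
    unfolding gensum_def expsum_def sum_negf[symmetric] sum_product by (simp add: mult_ac)
  have "(\<integral>x. - gensum m c l x * expsum p d k x \<partial>N)
      = (\<Sum>i<m. \<Sum>j<p. \<integral>x. (c i * d j) * (- generator_exp (l i) x * exp (- k j * x)) \<partial>N)"
    unfolding eq using l k by (intro integral_double_sum integrable_mult_right form_exp) auto
  also have "\<dots> = (\<Sum>i<m. \<Sum>j<p. a * (D_coeff c l d k i j * laplace1 N (l i + k j))
      + B_coeff n c l d k i j * laplace1 N (l i + k j))"
  proof (intro sum.cong refl)
    fix i j assume "i \<in> {..<m}" "j \<in> {..<p}"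
    then have "l i \<ge> 0" "k j \<ge> 0" using l k by auto
    from form_exp(2)[OF this]
    show "(\<integral>x. (c i * d j) * (- generator_exp (l i) x * exp (- k j * x)) \<partial>N)
        = a * (D_coeff c l d k i j * laplace1 N (l i + k j)) + B_coeff n c l d k i j * laplace1 N (l i + k j)"
      unfolding integral_mult_right_zero by (simp add: D_coeff_def B_coeff_def algebra_simps)
  qed
  finally show ?thesis
    unfolding FN.Bform_expsum[OF l k] laplace_form_def by (simp add: sum.distrib sum_distrib_left)
qed

text \<open>The two summands of the constant belong to the two parts of the form: Cauchy-Schwarz for
  the diffusion part gives 1, and the assumed inequality for \<open>Bform\<close> gives the square
  root.\<close>

lemma sector_const_bound:
  assumes C: "C > 0"
    and bound: "\<forall>f\<in>F0. \<forall>g\<in>F0. (Bform n N f g)\<^sup>2 \<le> C * Dterm N f * Jterm n N g"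
  shows "sector_const K N \<le> ereal (1 + sqrt (2 * C / a))"
proof -
  interpret core: generator_core K N exp_graph by (rule generator_core_exp_graph)
  interpret NL: levy_measure N by (rule levy_measure_N)
  interpret FN: branching_forms n N ..
  show ?thesis
  proof (rule core.sector_const_le)
    fix f h g w assume "(f, h) \<in> exp_graph" "(g, w) \<in> exp_graph"
    then obtain m c l p d k where fh: "f = expsum m c l" "h = gensum m c l" and l: "\<forall>i<m. l i \<ge> 0"
      and gw: "g = expsum p d k" "w = gensum p d k" and k: "\<forall>j<p. k j \<ge> 0"
      by (auto simp: exp_graph_def)
    define Df Dg Jf Jg where "Df = Dterm N f" and "Dg = Dterm N g" and "Jf = Jterm n N f" and "Jg = Jterm n N g"
    have nonneg: "Df \<ge> 0" "Dg \<ge> 0" "Jf \<ge> 0" "Jg \<ge> 0"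
      by (simp_all add: Df_def Dg_def Jf_def Jg_def Dterm_nonneg Jterm_nonneg levy_measure_N)
    have Ef: "(\<integral>x. - h x * f x \<partial>N) = a * Df + Jf / 2"
      unfolding Df_def Jf_def fh form_expsum[OF l l] FN.Bform_diagonal[OF l] NL.Dterm_expsum[OF l] ..
    have Eg: "(\<integral>x. - w x * g x \<partial>N) = a * Dg + Jg / 2"
      unfolding Dg_def Jg_def gw form_expsum[OF k k] FN.Bform_diagonal[OF k] NL.Dterm_expsum[OF k] ..
    define X Y where "X = sqrt (a * Df + Jf / 2)" and "Y = sqrt (a * Dg + Jg / 2)"
    have XY: "X \<ge> 0" "Y \<ge> 0" using nonneg a_pos by (simp_all add: X_def Y_def)
    have "a * laplace_form N m p (D_coeff c l d k) l k \<le> a * (sqrt Df * sqrt Dg)"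
    proof -
      have "\<bar>laplace_form N m p (D_coeff c l d k) l k\<bar> \<le> sqrt Df * sqrt Dg"
      proof (rule power2_le_imp_le)
        show "\<bar>laplace_form N m p (D_coeff c l d k) l k\<bar>\<^sup>2 \<le> (sqrt Df * sqrt Dg)\<^sup>2"
          using NL.D_form_Cauchy_Schwarz[OF l k, of c d] nonneg
          by (simp add: power_mult_distrib Df_def Dg_def fh gw)
      qed (use nonneg in simp)
      then show ?thesis using a_pos by simp
    qed
    also have "\<dots> = sqrt (a * Df) * sqrt (a * Dg)"
      using a_pos by (simp add: real_sqrt_mult)
    also have "\<dots> \<le> X * Y"
      unfolding X_def Y_def using nonneg a_pos by (intro mult_mono real_sqrt_le_mono) auto
    finally have diff_part: "a * laplace_form N m p (D_coeff c l d k) l k \<le> X * Y" .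
    have "Bform n N f g \<le> sqrt (2 * C / a) * (X * Y)"
    proof -
      have "f \<in> F0" "g \<in> F0" unfolding fh gw using l k by (auto intro: expsum_in_F0)
      then have "(Bform n N f g)\<^sup>2 \<le> C * Df * Jg" using bound by (simp add: Df_def Jg_def)
      \<comment> \<open>The factors are arranged so that a Df and Jg / 2 appear, each dominated by
        the diagonal form of f and of g respectively; this is the origin of 2 / a.\<close>
      also have "\<dots> = (2 * C / a) * ((a * Df) * (Jg / 2))" using a_pos by simp
      also have "\<dots> \<le> (2 * C / a) * ((a * Df + Jf / 2) * (a * Dg + Jg / 2))"
        using nonneg a_pos C by (intro mult_left_mono mult_mono) auto
      also have "\<dots> = (sqrt (2 * C / a) * (X * Y))\<^sup>2"
        unfolding X_def Y_def using nonneg a_pos C by (simp add: power_mult_distrib)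
      finally have "\<bar>Bform n N f g\<bar> \<le> \<bar>sqrt (2 * C / a) * (X * Y)\<bar>"
        by (simp add: abs_le_square_iff)
      moreover have "sqrt (2 * C / a) * (X * Y) \<ge> 0" using XY C a_pos by simp
      ultimately show ?thesis by linarith
    qed
    then show "(\<integral>x. - h x * g x \<partial>N)
        \<le> (1 + sqrt (2 * C / a)) * sqrt (\<integral>x. - h x * f x \<partial>N) * sqrt (\<integral>x. - w x * g x \<partial>N)"
      using diff_part unfolding Ef Eg X_def[symmetric] Y_def[symmetric]
      unfolding fh gw form_expsum[OF l k] by (simp add: distrib_right mult.assoc)
  qed
qed

end

theorem theorem3p3:
  fixes a b C :: real and n \<Lambda> :: "real measure"
    and \<nu> :: "real \<Rightarrow> real measure"
    and v :: "real \<Rightarrow> real \<Rightarrow> real"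
    and K :: "real \<Rightarrow> real \<Rightarrow> real \<Rightarrow> real measure"
  assumes a_nonneg: "a \<ge> 0" and b_nonneg: "b \<ge> 0"
    and n_borel: "sets n = sets borel" and n_pos: "emeasure n {..0} = 0"
    and n_int: "(\<integral>\<^sup>+ y. ennreal (min (y\<^sup>2) y) \<partial>n) < \<infinity>"
    and Phi1: "Phi a b n 1 < \<infinity>"
    and Lambda_borel: "sets \<Lambda> = sets borel" and Lambda_pos: "emeasure \<Lambda> {..0} = 0"
    and Lambda_Levy: "(\<integral>\<^sup>+ y. ennreal (min 1 y) \<partial>\<Lambda>) < \<infinity>"
    and Phi_Lambda: "\<And>l. l \<ge> 0 \<Longrightarrow> Phi a b n l = (\<integral>\<^sup>+ y. ennreal (1 - exp (- l * y)) \<partial>\<Lambda>)"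
    and C_pos: "0 < C"
    \<comment> \<open>nu delta: the stationary distribution, given by its Laplace transform\<close>
    and nu_prob: "\<And>\<delta>. \<delta> > 0 \<Longrightarrow> prob_space (\<nu> \<delta>)"
    and nu_borel: "\<And>\<delta>. \<delta> > 0 \<Longrightarrow> sets (\<nu> \<delta>) = sets borel"
    and nu_supp: "\<And>\<delta>. \<delta> > 0 \<Longrightarrow> emeasure (\<nu> \<delta>) {..<0} = 0"
    and nu_Laplace: "\<And>\<delta> l. \<delta> > 0 \<Longrightarrow> l \<ge> 0 \<Longrightarrow>
        (\<integral>\<^sup>+ x. ennreal (exp (- l * x)) \<partial>\<nu> \<delta>) = ennreal (exp (- \<delta> * enn2real (Phi a b n l)))"
    \<comment> \<open>v t l: solution of d/dt v = - psi(v), v 0 = l\<close>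
    and v_init: "\<And>l. l \<ge> 0 \<Longrightarrow> v 0 l = l"
    and v_ode: "\<And>l t. l \<ge> 0 \<Longrightarrow> t \<ge> 0 \<Longrightarrow>
        ((\<lambda>s. v s l) has_real_derivative - psi a b n (v t l)) (at t within {0..})"
    \<comment> \<open>K delta t x: transition kernels of the CBCI-process with quadruplet (a,b,n,delta)\<close>
    and K_kernel: "\<And>\<delta> t. \<delta> > 0 \<Longrightarrow> t \<ge> 0 \<Longrightarrow> K \<delta> t \<in> borel \<rightarrow>\<^sub>M prob_algebra borel"
    and K_supp: "\<And>\<delta> t x. \<delta> > 0 \<Longrightarrow> t \<ge> 0 \<Longrightarrow> x \<ge> 0 \<Longrightarrow> emeasure (K \<delta> t x) {..<0} = 0"
    and K_Laplace: "\<And>\<delta> t x l. \<delta> > 0 \<Longrightarrow> t \<ge> 0 \<Longrightarrow> x \<ge> 0 \<Longrightarrow> l \<ge> 0 \<Longrightarrow>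
        (\<integral>y. exp (- l * y) \<partial>K \<delta> t x) = exp (- x * v t l - \<delta> * integral {0..t} (\<lambda>s. v s l))"
  shows "((\<forall>\<delta>>0. \<forall>f\<in>F0. \<forall>g\<in>F0.
             (Bform n (\<nu> \<delta>) f g)\<^sup>2 \<le> C * Dterm (\<nu> \<delta>) f * Jterm n (\<nu> \<delta>) g)
          \<longleftrightarrow>
          (\<forall>f\<in>F0. \<forall>g\<in>F0. (Bform n \<Lambda> f g)\<^sup>2 \<le> C * Dterm \<Lambda> f * Jterm n \<Lambda> g))
      \<and> (\<forall>\<delta>>0. a > 0 \<longrightarrow>
           (\<forall>f\<in>F0. \<forall>g\<in>F0. (Bform n (\<nu> \<delta>) f g)\<^sup>2 \<le> C * Dterm (\<nu> \<delta>) f * Jterm n (\<nu> \<delta>) g) \<longrightarrow>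
           sector_const (K \<delta>) (\<nu> \<delta>) \<le> ereal (1 + sqrt (2 * C / a)))"
proof -
  have n: "branching_measure n"
    by (intro branching_measure.intro n_borel n_pos n_int)
  have AE_\<Lambda>: "AE x in \<Lambda>. 0 \<le> x"
  proof (rule AE_I)
    show "{x \<in> space \<Lambda>. \<not> 0 \<le> x} \<subseteq> {..0}" by auto
  qed (use Lambda_pos Lambda_borel in auto)
  have "integrable \<Lambda> (\<lambda>x. min 1 x)"
  proof (rule integrableI_nonneg)
    show "(\<lambda>x. min 1 x) \<in> borel_measurable \<Lambda>"
      using Lambda_borel by (simp cong: measurable_cong_sets)
    show "AE x in \<Lambda>. 0 \<le> min 1 x" using AE_\<Lambda> by eventually_elim simp
  qed (rule Lambda_Levy)
  then have \<Lambda>: "levy_measure \<Lambda>"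
    by (intro levy_measure.intro Lambda_borel AE_\<Lambda>)
  have Phi_eq: "Phi a b n l = ennreal (levy_exponent \<Lambda> l)" and exponent_nonneg: "0 \<le> levy_exponent \<Lambda> l"
    if l: "l \<ge> 0" for l
  proof -
    have nonneg: "AE x in \<Lambda>. 0 \<le> 1 - exp (- l * x)"
      using AE_\<Lambda> by eventually_elim (use l in simp)
    show "Phi a b n l = ennreal (levy_exponent \<Lambda> l)"
      unfolding Phi_Lambda[OF l] levy_exponent_def
      by (rule nn_integral_eq_integral[OF levy_measure.integrable_one_minus_exp_neg[OF \<Lambda> l] nonneg])
    show "0 \<le> levy_exponent \<Lambda> l"
      unfolding levy_exponent_def by (rule integral_nonneg_AE[OF nonneg])
  qed
  have \<nu>: "infinitely_divisible \<Lambda> (\<nu> \<delta>) \<delta>" if \<delta>: "\<delta> > 0" for \<delta>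
    using \<Lambda> nu_prob[OF \<delta>] \<delta> nu_borel[OF \<delta>] nu_supp[OF \<delta>] nu_Laplace[OF \<delta>] Phi_eq exponent_nonneg
    by (simp add: infinitely_divisible_def infinitely_divisible_axioms_def)
  have "sector_const (K \<delta>) (\<nu> \<delta>) \<le> ereal (1 + sqrt (2 * C / a))"
    if \<delta>: "\<delta> > 0" and a: "a > 0"
      and bound: "\<forall>f\<in>F0. \<forall>g\<in>F0. (Bform n (\<nu> \<delta>) f g)\<^sup>2 \<le> C * Dterm (\<nu> \<delta>) f * Jterm n (\<nu> \<delta>) g" for \<delta>
  proof (rule cbci_process.sector_const_bound[OF _ C_pos bound])
    show "cbci_process n \<Lambda> (\<nu> \<delta>) a b \<delta> v (K \<delta>)"
      by (intro cbci_process.intro cbci_mechanism.intro branching_mechanism.intro n \<Lambda> \<nu>[OF \<delta>]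
        branching_mechanism_axioms.intro cbci_mechanism_axioms.intro cbci_process_axioms.intro
        a b_nonneg Phi_eq v_init v_ode K_kernel[OF \<delta>] K_supp[OF \<delta>] K_Laplace[OF \<delta>])
  qed
  moreover have "(Bform n (\<nu> \<delta>) f g)\<^sup>2 \<le> C * Dterm (\<nu> \<delta>) f * Jterm n (\<nu> \<delta>) g"
    if "\<forall>f\<in>F0. \<forall>g\<in>F0. (Bform n \<Lambda> f g)\<^sup>2 \<le> C * Dterm \<Lambda> f * Jterm n \<Lambda> g" "\<delta> > 0" "f \<in> F0" "g \<in> F0"
    for \<delta> f g
    using bound_over_stationary_law[OF n \<nu> C_pos] that by blast
  moreover have "(Bform n \<Lambda> f g)\<^sup>2 \<le> C * Dterm \<Lambda> f * Jterm n \<Lambda> g"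
    if "\<forall>\<delta>>0. \<forall>f\<in>F0. \<forall>g\<in>F0. (Bform n (\<nu> \<delta>) f g)\<^sup>2 \<le> C * Dterm (\<nu> \<delta>) f * Jterm n (\<nu> \<delta>) g"
      "f \<in> F0" "g \<in> F0" for f g
    using that by (intro bound_over_Levy_measure[of n \<Lambda> \<nu> C f g] n \<nu>)
  ultimately show ?thesis by blast
qed

end
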